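(* Let $k$ be a field, let $G$ be a $C_5$-free vertex decomposable graph with vertex set $\{x_1,\dots,x_n\}$, and let $R=k[x_1,\dots,x_n]$. Then $$\mathrm{pd}(R/I(G))=\mathrm{bight}(I(G))=d'_G.$$
   Context: All graphs are finite and simple. For a graph $G$ with $V(G)=\{x_1,\dots,x_n\}$, the edge ideal is $I(G)=\langle x_ix_j \mid \{x_i,x_j\}\in E(G)\rangle\subseteq R=k[x_1,\dots,x_n]$. For a vertex $v$, $N_G(v)$ is the set of neighbors of $v$ and $N[v]=N_G[v]=N_G(v)\cup\{v\}$. For $S\subseteq V(G)$, $G\setminus S$ is the induced subgraph on $V(G)\setminus S$. An independent set of $G$ is a subset of $V(G)$ containing no edge of $G$. $G$ is $C_5$-free if it contains no cycle of length $5$ as a (not necessarily induced) subgraph. A graph $G$ is (recursively) vertex decomposable if $G$ has no edges, or if (i) there is a vertex $x$ of $G$ such that $G\setminus\{x\}$ and $G\setminus N[x]$ are both vertex decomposable, and (ii) no independent set in $G\setminus N[x]$ is a maximal independent set in $G\setminus\{x\}$. $\mathrm{pd}$ denotes projective dimension over $R$. A vertex cover of $G$ is a subset of $V(G)$ meeting every edge; it is minimal if no proper subset is a vertex cover. $\mathrm{bight}(I(G))$ (big height) is the maximum height among the minimal prime divisors of $I(G)$; equivalently the maximum of $|C|$ over minimal vertex covers $C$ of $G$. A bouquet of $G$ is a subgraph $B$ of $G$ with $V(B)=\{z,w_1,\dots,w_d\}$ and $E(B)=\{\{z,w_i\}\mid 1\le i\le d\}$, $d\ge 1$, with $z$ designated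 as its root; the $w_i$ are its flowers and the edges $\{z,w_i\}$ its stems. For a set $\mathcal B=\{B_1,\dots,B_m\}$ of bouquets of $G$, $F(\mathcal B)$ is the set of all flowers and $R(\mathcal B)$ the set of all roots of bouquets in $\mathcal B$. $\mathcal B$ is semi-strongly disjoint in $G$ if $V(B_i)\cap V(B_j)=\emptyset$ for all $i\ne j$ and $R(\mathcal B)$ is an independent set of $G$. Then $$d'_G=\max\{|F(\mathcal B)| \mid \mathcal B \text{ is a semi-strongly disjoint set of bouquets of } G\},$$ where the empty set of bouquets is allowed (so $d'_G=0$ if $G$ has no edges). *)

theory Defs
  imports
    "HOL-Library.Poly_Mapping"
    "HOL-Library.Extended_Nat"
    "HOL-Algebra.QuotRing"
    "HOL-Algebra.Module"
begin

section \<open>Graphs\<close>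

record 'v sgraph =
  verts :: "'v set"
  edges :: "'v set set"

definition simple_graph :: "'v sgraph \<Rightarrow> bool" where
  "simple_graph G \<longleftrightarrow> finite (verts G) \<and> (\<forall>e\<in>edges G. e \<subseteq> verts G \<and> card e = 2)"

definition neighbors :: "'v sgraph \<Rightarrow> 'v \<Rightarrow> 'v set" where
  "neighbors G v = {w. {v, w} \<in> edges G}"

definition closed_neighbors :: "'v sgraph \<Rightarrow> 'v \<Rightarrow> 'v set" where
  "closed_neighbors G v = insert v (neighbors G v)"

definition delete_verts :: "'v sgraph \<Rightarrow> 'v set \<Rightarrow> 'v sgraph" where
  "delete_verts G S = \<lparr>verts = verts G - S, edges = {e \<in> edges G. e \<inter> S = {}}\<rparr>"

definition independent :: "'v sgraph \<Rightarrow> 'v set \<Rightarrow> bool" where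
  "independent G S \<longleftrightarrow> S \<subseteq> verts G \<and> (\<forall>e\<in>edges G. \<not> e \<subseteq> S)"

definition max_independent :: "'v sgraph \<Rightarrow> 'v set \<Rightarrow> bool" where
  "max_independent G S \<longleftrightarrow> independent G S \<and> (\<forall>T. independent G T \<and> S \<subseteq> T \<longrightarrow> T = S)"

text \<open>A cycle, as a not necessarily induced subgraph, is given by the list of its vertices.\<close>

definition is_cycle :: "'v sgraph \<Rightarrow> 'v list \<Rightarrow> bool" where
  "is_cycle G vs \<longleftrightarrow> 3 \<le> length vs \<and> distinct vs \<and> set vs \<subseteq> verts G \<and>
     (\<forall>i<length vs. {vs ! i, vs ! (Suc i mod length vs)} \<in> edges G)"

definition C5_free :: "'v sgraph \<Rightarrow> bool" where
  "C5_free G \<longleftrightarrow> \<not> (\<exists>vs. length vs = 5 \<and> is_cycle G vs)"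

inductive vertex_decomposable :: "'v sgraph \<Rightarrow> bool" where
  no_edges: "edges G = {} \<Longrightarrow> vertex_decomposable G"
| shedding:
    "x \<in> verts G \<Longrightarrow>
     vertex_decomposable (delete_verts G {x}) \<Longrightarrow>
     vertex_decomposable (delete_verts G (closed_neighbors G x)) \<Longrightarrow>
     \<forall>S. independent (delete_verts G (closed_neighbors G x)) S
         \<longrightarrow> \<not> max_independent (delete_verts G {x}) S \<Longrightarrow>
     vertex_decomposable G"


section \<open>Bouquets\<close>

text \<open>
  A pair \<open>(z, W)\<close> stands for the bouquet with root \<open>z\<close> and set of flowers \<open>W\<close>; its stems are
  the edges \<open>{z, w}\<close> with \<open>w \<in> W\<close>.
\<close>

type_synonym 'v bouquet = "'v \<times> 'v set"

definition is_bouquet :: "'v sgraph \<Rightarrow> 'v bouquet \<Rightarrow> bool" where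
  "is_bouquet G B \<longleftrightarrow>
     fst B \<in> verts G \<and> snd B \<subseteq> verts G \<and> snd B \<noteq> {} \<and> (\<forall>w\<in>snd B. {fst B, w} \<in> edges G)"

definition bouquet_verts :: "'v bouquet \<Rightarrow> 'v set" where
  "bouquet_verts B = insert (fst B) (snd B)"

definition flowers :: "'v bouquet set \<Rightarrow> 'v set" where
  "flowers \<B> = (\<Union>B\<in>\<B>. snd B)"

definition roots :: "'v bouquet set \<Rightarrow> 'v set" where
  "roots \<B> = fst ` \<B>"

definition semi_strongly_disjoint :: "'v sgraph \<Rightarrow> 'v bouquet set \<Rightarrow> bool" where
  "semi_strongly_disjoint G \<B> \<longleftrightarrow>
     (\<forall>B\<in>\<B>. is_bouquet G B) \<and>
     (\<forall>B\<in>\<B>. \<forall>C\<in>\<B>. B \<noteq> C \<longrightarrow> bouquet_verts B \<inter> bouquet_verts C = {}) \<and>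
     independent G (roots \<B>)"

definition d_prime :: "'v sgraph \<Rightarrow> nat" where
  "d_prime G = Max {card (flowers \<B>) | \<B>. semi_strongly_disjoint G \<B>}"


section \<open>Polynomial rings and edge ideals\<close>

text \<open>
  Polynomials with coefficients in \<open>'k\<close> are finitely supported functions on exponent vectors;
  \<open>poly_ring V\<close> is the ring $k[x_v \mid v \in V]$.
\<close>

definition poly_ring :: "'v set \<Rightarrow> (('v \<Rightarrow>\<^sub>0 nat) \<Rightarrow>\<^sub>0 'k::comm_ring_1) ring" where
  "poly_ring V =
     \<lparr>carrier = {p. \<forall>m\<in>Poly_Mapping.keys p. Poly_Mapping.keys m \<subseteq> V},
      mult = (*), one = 1, zero = 0, add = (+)\<rparr>"

definition var :: "'v \<Rightarrow> ('v \<Rightarrow>\<^sub>0 nat) \<Rightarrow>\<^sub>0 'k::comm_ring_1" where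
  "var v = Poly_Mapping.single (Poly_Mapping.single v 1) 1"

definition edge_ideal :: "'v sgraph \<Rightarrow> (('v \<Rightarrow>\<^sub>0 nat) \<Rightarrow>\<^sub>0 'k::comm_ring_1) set" where
  "edge_ideal G = genideal (poly_ring (verts G)) {var v * var w | v w. {v, w} \<in> edges G}"

lemma cring_poly_ring: "cring (poly_ring V :: (('v \<Rightarrow>\<^sub>0 nat) \<Rightarrow>\<^sub>0 'k::comm_ring_1) ring)"
proof -
  let ?R = "poly_ring V :: (('v \<Rightarrow>\<^sub>0 nat) \<Rightarrow>\<^sub>0 'k) ring"
  have add: "p + q \<in> carrier ?R" if "p \<in> carrier ?R" "q \<in> carrier ?R" for p q
    using that keys_add[of p q] by (auto simp: poly_ring_def)
  have mult: "p * q \<in> carrier ?R" if "p \<in> carrier ?R" "q \<in> carrier ?R" for p q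
  proof -
    have "Poly_Mapping.keys m \<subseteq> V" if m: "m \<in> Poly_Mapping.keys (p * q)" for m
    proof -
      obtain a b where "m = a + b" "a \<in> Poly_Mapping.keys p" "b \<in> Poly_Mapping.keys q"
        using keys_mult[of p q] m by blast
      with \<open>p \<in> _\<close> \<open>q \<in> _\<close> show ?thesis
        using keys_add[of a b] by (fastforce simp: poly_ring_def)
    qed
    then show ?thesis by (auto simp: poly_ring_def)
  qed
  have neg: "- p \<in> carrier ?R" if "p \<in> carrier ?R" for p
    using that by (simp add: poly_ring_def Poly_Mapping.keys_minus)
  have ops: "mult ?R = (*)" "one ?R = 1" "zero ?R = 0" "add ?R = (+)"
    by (simp_all add: poly_ring_def)
  have zero_one: "0 \<in> carrier ?R" "1 \<in> carrier ?R"
    by (simp_all add: poly_ring_def)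
  show ?thesis
  proof (rule cringI)
    show "abelian_group ?R"
    proof (rule abelian_groupI)
      fix x assume "x \<in> carrier ?R"
      then show "\<exists>y\<in>carrier ?R. y \<oplus>\<^bsub>?R\<^esub> x = \<zero>\<^bsub>?R\<^esub>"
        by (intro bexI[of _ "- x"] neg) (simp_all add: ops)
    qed (simp_all only: ops add zero_one ac_simps add_0_left add_0_right)
    show "Group.comm_monoid ?R"
      by (rule comm_monoidI) (simp_all only: ops mult zero_one ac_simps mult_1_left mult_1_right)
  qed (simp only: ops distrib_right)
qed


section \<open>Heights and big height\<close>

definition prime_height :: "('a, 'b) ring_scheme \<Rightarrow> 'a set \<Rightarrow> enat" where
  "prime_height R P =
     Sup {enat n | n. \<exists>Q :: nat \<Rightarrow> 'a set.
       (\<forall>i\<le>n. primeideal (Q i) R) \<and> (\<forall>i<n. Q i \<subset> Q (Suc i)) \<and> Q n = P}"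

definition minimal_prime :: "('a, 'b) ring_scheme \<Rightarrow> 'a set \<Rightarrow> 'a set \<Rightarrow> bool" where
  "minimal_prime R I P \<longleftrightarrow>
     primeideal P R \<and> I \<subseteq> P \<and> (\<forall>Q. primeideal Q R \<and> I \<subseteq> Q \<and> Q \<subseteq> P \<longrightarrow> Q = P)"

definition bight :: "('a, 'b) ring_scheme \<Rightarrow> 'a set \<Rightarrow> enat" where
  "bight R I = Sup {prime_height R P | P. minimal_prime R I P}"


section \<open>Projective dimension\<close>

definition mod_hom ::
    "('a, 'c) ring_scheme \<Rightarrow> ('a, 'm, 'd) module_scheme \<Rightarrow> ('a, 'n, 'e) module_scheme \<Rightarrow> ('m \<Rightarrow> 'n) set"
  where
  "mod_hom R M N =
     {h. h \<in> carrier M \<rightarrow> carrier N \<and>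
         (\<forall>x\<in>carrier M. \<forall>y\<in>carrier M. h (x \<oplus>\<^bsub>M\<^esub> y) = h x \<oplus>\<^bsub>N\<^esub> h y) \<and>
         (\<forall>r\<in>carrier R. \<forall>x\<in>carrier M. h (r \<odot>\<^bsub>M\<^esub> x) = r \<odot>\<^bsub>N\<^esub> h x)}"

definition quot_module :: "('a, 'c) ring_scheme \<Rightarrow> 'a set \<Rightarrow> ('a, 'a set) module" where
  "quot_module R I =
     \<lparr>carrier = carrier (R Quot I), mult = mult (R Quot I), one = one (R Quot I),
      zero = zero (R Quot I), add = add (R Quot I),
      smult = (\<lambda>r X. (I +>\<^bsub>R\<^esub> r) \<otimes>\<^bsub>R Quot I\<^esub> X)\<rparr>"

text \<open>
  The lifting property of a projective module \<open>P\<close> with elements in \<open>'p\<close>. HOL cannot quantify over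
  the types of the modules \<open>M\<close> and \<open>N\<close>. No generality is lost by the types chosen here: the free
  module on the elements of \<open>P\<close> consists of finitely supported functions \<open>'p \<Rightarrow> 'a\<close>, and
  lifting the identity of \<open>P\<close> along its canonical map onto \<open>P\<close> exhibits \<open>P\<close> as a direct summand of
  a free module. Lemma \<open>projective_module_lift\<close> below derives the lifting property for arbitrary
  types.
\<close>

definition projective_module :: "('a, 'c) ring_scheme \<Rightarrow> ('a, 'p) module \<Rightarrow> bool" where
  "projective_module R P \<longleftrightarrow> Module.module R P \<and>
     (\<forall>(M :: ('a, 'p \<Rightarrow> 'a) module) (N :: ('a, 'p) module) g f.
        Module.module R M \<and> Module.module R N \<and>
        g \<in> mod_hom R M N \<and> g ` carrier M = carrier N \<and> f \<in> mod_hom R P N \<longrightarrow>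
        (\<exists>h\<in>mod_hom R P M. \<forall>x\<in>carrier P. g (h x) = f x))"

definition free_module :: "('a, 'c) ring_scheme \<Rightarrow> 'p set \<Rightarrow> ('a, 'p \<Rightarrow> 'a) module" where
  "free_module R B =
     \<lparr>carrier = {\<phi>. range \<phi> \<subseteq> carrier R \<and> (\<forall>p. p \<notin> B \<longrightarrow> \<phi> p = \<zero>\<^bsub>R\<^esub>) \<and> finite {p. \<phi> p \<noteq> \<zero>\<^bsub>R\<^esub>}},
      mult = undefined, one = undefined, zero = (\<lambda>_. \<zero>\<^bsub>R\<^esub>),
      add = (\<lambda>\<phi> \<psi> p. \<phi> p \<oplus>\<^bsub>R\<^esub> \<psi> p), smult = (\<lambda>r \<phi> p. r \<otimes>\<^bsub>R\<^esub> \<phi> p)\<rparr>"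

definition lincomb ::
    "('a, 'c) ring_scheme \<Rightarrow> ('a, 'm, 'd) module_scheme \<Rightarrow> ('p \<Rightarrow> 'm) \<Rightarrow> ('p \<Rightarrow> 'a) \<Rightarrow> 'm" where
  "lincomb R M v \<phi> = finsum M (\<lambda>p. \<phi> p \<odot>\<^bsub>M\<^esub> v p) {p. \<phi> p \<noteq> \<zero>\<^bsub>R\<^esub>}"

lemma module_free_module:
  assumes "cring R"
  shows "Module.module R (free_module R B)"
proof -
  interpret R: cring R by fact
  let ?F = "free_module R B"
  have add: "(\<lambda>p. \<phi> p \<oplus>\<^bsub>R\<^esub> \<psi> p) \<in> carrier ?F" if "\<phi> \<in> carrier ?F" "\<psi> \<in> carrier ?F" for \<phi> \<psi>
  proof -
    have "finite ({p. \<phi> p \<noteq> \<zero>\<^bsub>R\<^esub>} \<union> {p. \<psi> p \<noteq> \<zero>\<^bsub>R\<^esub>})"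
      using that by (auto simp: free_module_def)
    then have "finite {p. \<phi> p \<oplus>\<^bsub>R\<^esub> \<psi> p \<noteq> \<zero>\<^bsub>R\<^esub>}"
      by (rule rev_finite_subset) auto
    then show ?thesis
      using that by (auto simp: free_module_def image_subset_iff)
  qed
  have smult: "(\<lambda>p. r \<otimes>\<^bsub>R\<^esub> \<phi> p) \<in> carrier ?F" if "r \<in> carrier R" "\<phi> \<in> carrier ?F" for r \<phi>
  proof -
    have "finite {p. \<phi> p \<noteq> \<zero>\<^bsub>R\<^esub>}"
      using that by (auto simp: free_module_def)
    then have "finite {p. r \<otimes>\<^bsub>R\<^esub> \<phi> p \<noteq> \<zero>\<^bsub>R\<^esub>}"
      by (rule rev_finite_subset) (use that in auto)
    then show ?thesis
      using that by (auto simp: free_module_def image_subset_iff)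
  qed
  have ab: "abelian_group ?F"
  proof (rule abelian_groupI)
    fix \<phi> assume \<phi>: "\<phi> \<in> carrier ?F"
    have "(\<lambda>p. \<ominus>\<^bsub>R\<^esub> \<one>\<^bsub>R\<^esub> \<otimes>\<^bsub>R\<^esub> \<phi> p) \<in> carrier ?F"
      by (rule smult) (use \<phi> in auto)
    moreover have "(\<lambda>p. (\<ominus>\<^bsub>R\<^esub> \<one>\<^bsub>R\<^esub> \<otimes>\<^bsub>R\<^esub> \<phi> p) \<oplus>\<^bsub>R\<^esub> \<phi> p) = (\<lambda>_. \<zero>\<^bsub>R\<^esub>)"
      using \<phi> by (auto simp: free_module_def image_subset_iff R.l_minus R.l_neg)
    ultimately show "\<exists>y\<in>carrier ?F. y \<oplus>\<^bsub>?F\<^esub> \<phi> = \<zero>\<^bsub>?F\<^esub>"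
      by (intro bexI) (auto simp: free_module_def)
  qed (use add in \<open>auto simp: free_module_def image_subset_iff R.add.m_ac\<close>)
  show ?thesis
    by (rule moduleI[OF R.is_cring ab])
      (use smult in \<open>auto simp: free_module_def image_subset_iff R.l_distr R.r_distr R.m_assoc\<close>)
qed

lemma lincomb_superset:
  assumes "Module.module R M" "\<phi> \<in> carrier (free_module R B)" "v \<in> B \<rightarrow> carrier M"
    and "finite S" "{p. \<phi> p \<noteq> \<zero>\<^bsub>R\<^esub>} \<subseteq> S" "S \<subseteq> B"
  shows "lincomb R M v \<phi> = finsum M (\<lambda>p. \<phi> p \<odot>\<^bsub>M\<^esub> v p) S"
proof -
  interpret Module.module R M by fact
  show ?thesis
    unfolding lincomb_def
    by (rule M.add.finprod_mono_neutral_cong_left)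
      (use assms in \<open>auto simp: free_module_def image_subset_iff Pi_iff subset_iff\<close>)
qed

lemma lincomb_hom:
  assumes "Module.module R M" "v \<in> B \<rightarrow> carrier M"
  shows "lincomb R M v \<in> mod_hom R (free_module R B) M"
proof -
  interpret Module.module R M by fact
  let ?F = "free_module R B"
  let ?s = "\<lambda>\<phi>. {p. \<phi> p \<noteq> \<zero>\<^bsub>R\<^esub>}"
  interpret F: Module.module R ?F by (rule module_free_module) (rule R.is_cring)
  have s: "finite (?s \<phi>)" "?s \<phi> \<subseteq> B" and c: "\<phi> p \<in> carrier R" if "\<phi> \<in> carrier ?F" for \<phi> p
    using that by (auto simp: free_module_def)
  have v: "v p \<in> carrier M" if "p \<in> B" for p
    using assms that by auto
  have closed: "lincomb R M v \<phi> \<in> carrier M" if "\<phi> \<in> carrier ?F" for \<phi>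
    unfolding lincomb_def by (rule M.finsum_closed) (use s[OF that] c[OF that] v in auto)
  have add: "lincomb R M v (\<phi> \<oplus>\<^bsub>?F\<^esub> \<psi>) = lincomb R M v \<phi> \<oplus>\<^bsub>M\<^esub> lincomb R M v \<psi>"
    if \<phi>: "\<phi> \<in> carrier ?F" and \<psi>: "\<psi> \<in> carrier ?F" for \<phi> \<psi>
  proof -
    let ?S = "?s \<phi> \<union> ?s \<psi>"
    have S: "finite ?S" "?S \<subseteq> B" using s[OF \<phi>] s[OF \<psi>] by auto
    have fact: "lincomb R M v \<chi> = finsum M (\<lambda>p. \<chi> p \<odot>\<^bsub>M\<^esub> v p) ?S"
      if "\<chi> \<in> carrier ?F" "?s \<chi> \<subseteq> ?S" for \<chi>
      by (rule lincomb_superset[OF assms(1) that(1) assms(2) S(1) that(2) S(2)])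
    have sub: "?s (\<phi> \<oplus>\<^bsub>?F\<^esub> \<psi>) \<subseteq> ?S"
      by (auto simp: free_module_def)
    have "finsum M (\<lambda>p. (\<phi> \<oplus>\<^bsub>?F\<^esub> \<psi>) p \<odot>\<^bsub>M\<^esub> v p) ?S =
          finsum M (\<lambda>p. \<phi> p \<odot>\<^bsub>M\<^esub> v p \<oplus>\<^bsub>M\<^esub> \<psi> p \<odot>\<^bsub>M\<^esub> v p) ?S"
    proof (rule M.finsum_cong')
      fix p assume "p \<in> ?S"
      then have "v p \<in> carrier M" using S(2) v by auto
      then show "(\<phi> \<oplus>\<^bsub>?F\<^esub> \<psi>) p \<odot>\<^bsub>M\<^esub> v p = \<phi> p \<odot>\<^bsub>M\<^esub> v p \<oplus>\<^bsub>M\<^esub> \<psi> p \<odot>\<^bsub>M\<^esub> v p"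
        using c[OF \<phi>] c[OF \<psi>] by (simp add: free_module_def smult_l_distr)
    qed (use S(2) v c[OF \<phi>] c[OF \<psi>] in auto)
    also have "\<dots> = finsum M (\<lambda>p. \<phi> p \<odot>\<^bsub>M\<^esub> v p) ?S \<oplus>\<^bsub>M\<^esub> finsum M (\<lambda>p. \<psi> p \<odot>\<^bsub>M\<^esub> v p) ?S"
      by (rule M.finsum_addf) (use S(2) v c[OF \<phi>] c[OF \<psi>] in auto)
    finally show ?thesis
      using fact[OF F.a_closed[OF \<phi> \<psi>] sub] fact[OF \<phi>] fact[OF \<psi>] by simp
  qed
  have smult: "lincomb R M v (r \<odot>\<^bsub>?F\<^esub> \<phi>) = r \<odot>\<^bsub>M\<^esub> lincomb R M v \<phi>"
    if r: "r \<in> carrier R" and \<phi>: "\<phi> \<in> carrier ?F" for r \<phi>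
  proof -
    have sub: "?s (r \<odot>\<^bsub>?F\<^esub> \<phi>) \<subseteq> ?s \<phi>"
      using r by (auto simp: free_module_def)
    have "lincomb R M v (r \<odot>\<^bsub>?F\<^esub> \<phi>) = finsum M (\<lambda>p. (r \<odot>\<^bsub>?F\<^esub> \<phi>) p \<odot>\<^bsub>M\<^esub> v p) (?s \<phi>)"
      by (rule lincomb_superset[OF assms(1) F.smult_closed[OF r \<phi>] assms(2) s(1)[OF \<phi>] sub s(2)[OF \<phi>]])
    also have "\<dots> = finsum M (\<lambda>p. r \<odot>\<^bsub>M\<^esub> (\<phi> p \<odot>\<^bsub>M\<^esub> v p)) (?s \<phi>)"
    proof (rule M.finsum_cong')
      fix p assume "p \<in> ?s \<phi>"
      then have "v p \<in> carrier M" using s(2)[OF \<phi>] v by auto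
      then show "(r \<odot>\<^bsub>?F\<^esub> \<phi>) p \<odot>\<^bsub>M\<^esub> v p = r \<odot>\<^bsub>M\<^esub> (\<phi> p \<odot>\<^bsub>M\<^esub> v p)"
        using c[OF \<phi>] r by (simp add: free_module_def smult_assoc1)
    qed (use s(2)[OF \<phi>] v c[OF \<phi>] r in auto)
    also have "\<dots> = r \<odot>\<^bsub>M\<^esub> lincomb R M v \<phi>"
      unfolding lincomb_def
      by (rule finsum_smult_ldistr[symmetric]) (use s[OF \<phi>] v c[OF \<phi>] r in auto)
    finally show ?thesis .
  qed
  show ?thesis
    unfolding mod_hom_def using closed add smult by auto
qed

lemma lincomb_unit:
  assumes "Module.module R M" "v \<in> B \<rightarrow> carrier M" "p \<in> B"
  shows "(\<lambda>q. if q = p then \<one>\<^bsub>R\<^esub> else \<zero>\<^bsub>R\<^esub>) \<in> carrier (free_module R B)" (is "?e \<in> _")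
    and "lincomb R M v (\<lambda>q. if q = p then \<one>\<^bsub>R\<^esub> else \<zero>\<^bsub>R\<^esub>) = v p"
proof -
  interpret Module.module R M by fact
  have "finite {q. ?e q \<noteq> \<zero>\<^bsub>R\<^esub>}"
    by (rule finite_subset[of _ "{p}"]) auto
  then show e: "?e \<in> carrier (free_module R B)"
    using assms(3) by (auto simp: free_module_def)
  have "lincomb R M v ?e = finsum M (\<lambda>q. ?e q \<odot>\<^bsub>M\<^esub> v q) {p}"
    by (rule lincomb_superset[OF assms(1) e assms(2)]) (use assms(3) in auto)
  also have "\<dots> = v p"
    using assms(2,3) by (simp add: Pi_iff)
  finally show "lincomb R M v ?e = v p" .
qed

lemma lincomb_apply_hom:
  assumes "Module.module R M" "Module.module R N" "g \<in> mod_hom R M N"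
    and "v \<in> B \<rightarrow> carrier M" "\<phi> \<in> carrier (free_module R B)"
  shows "g (lincomb R M v \<phi>) = lincomb R N (\<lambda>p. g (v p)) \<phi>"
proof -
  interpret M: Module.module R M by fact
  interpret N: Module.module R N by fact
  have g: "g x \<in> carrier N" "g (x \<oplus>\<^bsub>M\<^esub> y) = g x \<oplus>\<^bsub>N\<^esub> g y"
    if "x \<in> carrier M" "y \<in> carrier M" for x y
    using assms(3) that by (auto simp: mod_hom_def)
  have gs: "g (r \<odot>\<^bsub>M\<^esub> x) = r \<odot>\<^bsub>N\<^esub> g x" if "r \<in> carrier R" "x \<in> carrier M" for r x
    using assms(3) that by (auto simp: mod_hom_def)
  have g0: "g \<zero>\<^bsub>M\<^esub> = \<zero>\<^bsub>N\<^esub>"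
    using gs[of "\<zero>\<^bsub>R\<^esub>" "\<zero>\<^bsub>M\<^esub>"] g(1)[of "\<zero>\<^bsub>M\<^esub>" "\<zero>\<^bsub>M\<^esub>"] by simp
  have c: "\<phi> p \<in> carrier R" for p
    using assms(5) by (auto simp: free_module_def)
  have "g (finsum M (\<lambda>p. \<phi> p \<odot>\<^bsub>M\<^esub> v p) S) = finsum N (\<lambda>p. \<phi> p \<odot>\<^bsub>N\<^esub> g (v p)) S"
    if "finite S" "S \<subseteq> B" for S
    using that
  proof (induction rule: finite_induct)
    case (insert p S)
    have v: "v q \<in> carrier M" if "q \<in> insert p S" for q
      using assms(4) insert.prems that by auto
    then have gv: "g (v q) \<in> carrier N" if "q \<in> insert p S" for q
      using g(1) that by blast
    have "finsum M (\<lambda>p. \<phi> p \<odot>\<^bsub>M\<^esub> v p) S \<in> carrier M"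
      by (rule M.finsum_closed) (use v c in auto)
    then show ?case
      using insert v gv c by (simp add: g gs M.finsum_insert N.finsum_insert Pi_iff)
  qed (simp add: g0)
  then show ?thesis
    using assms(5) by (force simp: lincomb_def free_module_def)
qed

lemma projective_module_lift:
  fixes P :: "('a, 'p) module" and M :: "('a, 'm) module" and N :: "('a, 'n) module"
  assumes "projective_module R P" "Module.module R M" "Module.module R N"
    and g: "g \<in> mod_hom R M N" "g ` carrier M = carrier N" and f: "f \<in> mod_hom R P N"
  shows "\<exists>h\<in>mod_hom R P M. \<forall>x\<in>carrier P. g (h x) = f x"
proof -
  let ?B = "carrier P"
  let ?F = "free_module R ?B"
  have P: "Module.module R P"
    using assms(1) by (simp add: projective_module_def)
  interpret P: Module.module R P by fact
  interpret F: Module.module R ?F by (rule module_free_module) (rule P.R.is_cring)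
  let ?\<pi> = "lincomb R P id"
  have \<pi>: "?\<pi> \<in> mod_hom R ?F P"
    by (rule lincomb_hom[OF P]) auto
  have surj: "?\<pi> ` carrier ?F = carrier P"
  proof
    show "?\<pi> ` carrier ?F \<subseteq> carrier P"
      using \<pi> by (auto simp: mod_hom_def)
    show "carrier P \<subseteq> ?\<pi> ` carrier ?F"
      using lincomb_unit[OF P, of id ?B] by (force simp: image_iff)
  qed
  have "(\<lambda>x. x) \<in> mod_hom R P P"
    by (auto simp: mod_hom_def)
  moreover have "Module.module R ?F"
    by (rule module_free_module) (rule P.R.is_cring)
  ultimately have "\<exists>h\<in>mod_hom R P ?F. \<forall>x\<in>carrier P. ?\<pi> (h x) = x"
    using assms(1)[unfolded projective_module_def, THEN conjunct2, rule_format, of ?F P ?\<pi> "\<lambda>x. x"]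
      P \<pi> surj by simp
  then obtain s where s: "s \<in> mod_hom R P ?F" "\<And>x. x \<in> carrier P \<Longrightarrow> ?\<pi> (s x) = x"
    by auto
  have "\<exists>m\<in>carrier M. g m = f p" if "p \<in> ?B" for p
  proof -
    have "f p \<in> g ` carrier M"
      using f that unfolding g(2) by (auto simp: mod_hom_def)
    then show ?thesis by auto
  qed
  then have "\<forall>p\<in>?B. \<exists>m. m \<in> carrier M \<and> g m = f p" by blast
  then obtain v where "\<forall>p\<in>?B. v p \<in> carrier M \<and> g (v p) = f p"
    by (rule bchoice[THEN exE])
  then have v: "v \<in> ?B \<rightarrow> carrier M" "\<And>p. p \<in> ?B \<Longrightarrow> g (v p) = f p"
    by auto
  let ?k = "lincomb R M v"
  have k: "?k \<in> mod_hom R ?F M"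
    by (rule lincomb_hom[OF assms(2) v(1)])
  have "g (?k (s x)) = f x" if x: "x \<in> carrier P" for x
  proof -
    have sx: "s x \<in> carrier ?F"
      using s(1) x by (auto simp: mod_hom_def)
    interpret N: Module.module R N by fact
    have "g (?k (s x)) = lincomb R N (\<lambda>p. g (v p)) (s x)"
      by (rule lincomb_apply_hom[OF assms(2,3) g(1) v(1) sx])
    also have "\<dots> = lincomb R N (\<lambda>p. f p) (s x)"
      unfolding lincomb_def
    proof (rule N.finsum_cong')
      fix p assume "p \<in> {p. s x p \<noteq> \<zero>\<^bsub>R\<^esub>}"
      then have "p \<in> ?B" using sx by (auto simp: free_module_def)
      then show "s x p \<odot>\<^bsub>N\<^esub> g (v p) = s x p \<odot>\<^bsub>N\<^esub> f p" by (simp add: v(2))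
    next
      show "(\<lambda>p. s x p \<odot>\<^bsub>N\<^esub> f p) \<in> {p. s x p \<noteq> \<zero>\<^bsub>R\<^esub>} \<rightarrow> carrier N"
        using sx f by (auto simp: free_module_def mod_hom_def Pi_iff image_subset_iff)
    qed simp
    also have "\<dots> = f (?\<pi> (s x))"
      using lincomb_apply_hom[OF P assms(3) f, of id ?B "s x"] sx by auto
    finally show ?thesis
      by (simp add: s(2) x)
  qed
  moreover have "(\<lambda>x. ?k (s x)) \<in> mod_hom R P M"
    using k s(1) by (auto simp: mod_hom_def Pi_iff)
  ultimately show ?thesis
    by (intro bexI[of _ "\<lambda>x. ?k (s x)"]) auto
qed

text \<open>
  The complex $\cdots \to P_2 \to P_1 \to P_0 \to M \to 0$ with differentials
  $d_i : P_{i+1} \to P_i$ and augmentation $\varepsilon : P_0 \to M$.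
\<close>

definition projective_resolution ::
    "('a, 'c) ring_scheme \<Rightarrow> ('a, 'm) module \<Rightarrow>
     (nat \<Rightarrow> ('a, 'p) module) \<Rightarrow> (nat \<Rightarrow> 'p \<Rightarrow> 'p) \<Rightarrow> ('p \<Rightarrow> 'm) \<Rightarrow> bool" where
  "projective_resolution R M P d \<epsilon> \<longleftrightarrow>
     (\<forall>i. projective_module R (P i)) \<and>
     (\<forall>i. d i \<in> mod_hom R (P (Suc i)) (P i)) \<and>
     \<epsilon> \<in> mod_hom R (P 0) M \<and>
     \<epsilon> ` carrier (P 0) = carrier M \<and>
     d 0 ` carrier (P 1) = {x \<in> carrier (P 0). \<epsilon> x = \<zero>\<^bsub>M\<^esub>} \<and>
     (\<forall>i. d (Suc i) ` carrier (P (Suc (Suc i))) = {x \<in> carrier (P (Suc i)). d i x = \<zero>\<^bsub>P i\<^esub>})"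

text \<open>
  The infimum of the lengths of the projective resolutions of \<open>M\<close>, infinite if there is no finite
  one. The elements of the resolving modules are taken from the type \<open>'m \<times> nat \<Rightarrow> 'a\<close>. Over a
  nonzero ring this is no restriction: its cardinality is at least that of \<open>'m\<close>, \<open>nat\<close> and \<open>'a\<close>,
  hence at least that of all terms of a resolution built by taking the free module on the elements
  of the previous kernel, and of the kernels themselves. The zero module gets dimension \<open>0\<close>.
\<close>

definition projdim :: "('a, 'c) ring_scheme \<Rightarrow> ('a, 'm) module \<Rightarrow> enat" where
  "projdim R M =
     Inf {enat n | n. \<exists>(P :: nat \<Rightarrow> ('a, 'm \<times> nat \<Rightarrow> 'a) module) d \<epsilon>.
       projective_resolution R M P d \<epsilon> \<and> (\<forall>i>n. carrier (P i) = {\<zero>\<^bsub>P i\<^esub>})}"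

lemma module_quot_module:
  assumes "cring R" "ideal I R"
  shows "Module.module R (quot_module R I)"
proof -
  interpret R: cring R by fact
  interpret I: ideal I R by fact
  interpret Q: cring "R Quot I" by (rule I.quotient_is_cring) fact
  interpret h: ring_hom_ring R "R Quot I" "(+>\<^bsub>R\<^esub>) I" by (rule I.rcos_ring_hom_ring)
  show ?thesis
  proof (rule moduleI)
    show "abelian_group (quot_module R I)"
      by (rule abelian_groupI)
        (use Q.add.l_inv_ex in \<open>auto simp: quot_module_def Q.add.m_ac\<close>)
  qed (auto simp: quot_module_def Q.l_distr Q.r_distr Q.m_assoc assms)
qed

end

theory Submission
  imports Defs "HOL-Library.Function_Algebras"
begin

text \<open>
  Let \<open>c\<close> be the largest size of a minimal vertex cover, that is, of the complement of a maximal
  independent set. All three invariants equal \<open>c\<close>.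

  For bouquets, the flowers miss every maximal independent set that contains the roots; conversely
  each vertex of a minimal cover is a flower of a neighbour in the complementary independent set.

  The minimal primes are generated by the variables of the minimal vertex covers. The height of such
  a prime is bounded by counting: elements chosen along a chain of \<open>n\<close> strict inclusions of primes
  have linearly independent monomials, and \<open>card V\<close> variables leave no room for this if
  \<open>n > card V\<close>.

  For a shedding vertex \<open>x\<close> the edge ideal is \<open>J + x L\<close> with \<open>J = I(G - x)\<close> and
  \<open>L = I(G - N[x]) + (N(x))\<close>, and \<open>0 \<rightarrow> J \<rightarrow> J \<oplus> L \<rightarrow> J + x L \<rightarrow> 0\<close> is exact. By induction
  the projective dimension is at most \<open>c\<close>. Conversely, if \<open>S\<close> is a maximal independent set,
  the product of its variables is a nonzero element of \<open>R / I\<close> that is killed by the \<open>card (V - S)\<close>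
  remaining variables. Their Koszul cohomology on a projective module vanishes below degree
  \<open>card (V - S)\<close> and the vanishing range shrinks by at most one with each step of a resolution, so
  every projective resolution of \<open>R / I\<close> has length at least \<open>card (V - S)\<close>.
\<close>

text \<open>The upper bound survives the induction because the two operations on the graph lower
  \<open>c\<close> by the right amounts. Deleting a shedding vertex lowers it by at least one, which
  pays for the extra step caused by the kernel term J; deleting N[x] lowers it by at least the
  number of neighbours, which pays for the variables added to form L. Vanishing of Koszul cohomology
  serves instead because it passes to arbitrary free modules and to direct summands, and because it
  can be chased with elements. For the height bound, a chain below a prime generated by variables is
  continued upwards to the ideal of all variables. A chain of length n yields N^n independent
  products whose exponents are bounded linearly in N, while the monomials with such exponents number
  only on the order of N^(card V).\<close>

declare plus_fun_apply [simp del] zero_fun_apply [simp del]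

section \<open>Koszul cochains and depth\<close>

text \<open>
  The Koszul complex as an iterated mapping cone: a Boolean list of length \<open>length rs\<close> encodes a
  subset of \<open>rs\<close>, and its number of entries \<open>True\<close> is the cohomological degree.
\<close>

primrec koszul ::
  "('a, 'c) ring_scheme \<Rightarrow> ('a, 'm, 'd) module_scheme \<Rightarrow> 'a list \<Rightarrow> (bool list \<Rightarrow> 'm) \<Rightarrow> bool list \<Rightarrow> 'm" where
  "koszul R M [] \<phi> bs = \<zero>\<^bsub>M\<^esub>"
| "koszul R M (r # rs) \<phi> bs = (case bs of [] \<Rightarrow> \<zero>\<^bsub>M\<^esub> | b # bs \<Rightarrow>
     if b then r \<odot>\<^bsub>M\<^esub> \<phi> (False # bs) \<oplus>\<^bsub>M\<^esub> (\<ominus>\<^bsub>R\<^esub> \<one>\<^bsub>R\<^esub>) \<odot>\<^bsub>M\<^esub> koszul R M rs (\<lambda>bs. \<phi> (True # bs)) bs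
     else koszul R M rs (\<lambda>bs. \<phi> (False # bs)) bs)"

text \<open>Degrees are collected rather than fixed: an element may have components in all degrees
  below \<open>j\<close>. The strict bound leaves only the zero cochain for \<open>j = 0\<close>,
  and values at lists of the wrong length are fixed to zero.\<close>

definition cochains :: "('a, 'm, 'd) module_scheme \<Rightarrow> nat \<Rightarrow> nat \<Rightarrow> (bool list \<Rightarrow> 'm) set" where
  "cochains M n j = {\<phi>. \<forall>bs. \<phi> bs \<in> carrier M \<and>
     (\<phi> bs \<noteq> \<zero>\<^bsub>M\<^esub> \<longrightarrow> length bs = n \<and> count_list bs True < j)}"

text \<open>Vanishing of Koszul cohomology in all degrees below \<open>j\<close>; the primitive
  lives one degree lower. For \<open>j = 1\<close> it is forced to be zero, so the condition says
  that no nonzero element is killed by all of \<open>rs\<close>.\<close>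

definition depth_ge :: "('a, 'c) ring_scheme \<Rightarrow> 'a list \<Rightarrow> ('a, 'm, 'd) module_scheme \<Rightarrow> nat \<Rightarrow> bool" where
  "depth_ge R rs M j \<longleftrightarrow> (\<forall>\<phi>\<in>cochains M (length rs) j. (\<forall>bs. koszul R M rs \<phi> bs = \<zero>\<^bsub>M\<^esub>) \<longrightarrow>
     (\<exists>\<beta>\<in>cochains M (length rs) (j - 1). \<forall>bs. koszul R M rs \<beta> bs = \<phi> bs))"

text \<open>Kernels stay in the type of the ambient module, with only the carrier changed. The sign
  in the differential is a scalar of the ring for this reason: the additive inverse of a module is
  defined through its carrier, whereas the operations used here do not see it.\<close>

lemma koszul_restrict: "koszul R (M\<lparr>carrier := K\<rparr>) rs \<phi> bs = koszul R M rs \<phi> bs"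
  by (induction rs arbitrary: \<phi> bs) (simp_all split: list.split)

lemma mod_homD:
  assumes "g \<in> mod_hom R M N"
  shows "x \<in> carrier M \<Longrightarrow> g x \<in> carrier N"
    and "x \<in> carrier M \<Longrightarrow> y \<in> carrier M \<Longrightarrow> g (x \<oplus>\<^bsub>M\<^esub> y) = g x \<oplus>\<^bsub>N\<^esub> g y"
    and "r \<in> carrier R \<Longrightarrow> x \<in> carrier M \<Longrightarrow> g (r \<odot>\<^bsub>M\<^esub> x) = r \<odot>\<^bsub>N\<^esub> g x"
  using assms by (auto simp: mod_hom_def)

lemma mod_hom_zero:
  assumes "Module.module R M" "Module.module R N" "g \<in> mod_hom R M N"
  shows "g \<zero>\<^bsub>M\<^esub> = \<zero>\<^bsub>N\<^esub>"
proof -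
  interpret M: Module.module R M by fact
  interpret N: Module.module R N by fact
  show ?thesis
    using mod_homD(3)[OF assms(3), of "\<zero>\<^bsub>R\<^esub>" "\<zero>\<^bsub>M\<^esub>"] mod_homD(1)[OF assms(3), of "\<zero>\<^bsub>M\<^esub>"] by simp
qed

lemma module_restrict:
  assumes "Module.module R M" "K \<subseteq> carrier M" "\<zero>\<^bsub>M\<^esub> \<in> K"
    and "\<And>x y. x \<in> K \<Longrightarrow> y \<in> K \<Longrightarrow> x \<oplus>\<^bsub>M\<^esub> y \<in> K" "\<And>r x. r \<in> carrier R \<Longrightarrow> x \<in> K \<Longrightarrow> r \<odot>\<^bsub>M\<^esub> x \<in> K"
  shows "Module.module R (M\<lparr>carrier := K\<rparr>)"
proof -
  interpret Module.module R M by fact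
  have K: "x \<in> carrier M" if "x \<in> K" for x using assms(2) that by auto
  have "(\<ominus>\<^bsub>R\<^esub> \<one>\<^bsub>R\<^esub>) \<odot>\<^bsub>M\<^esub> x \<oplus>\<^bsub>M\<^esub> x = \<zero>\<^bsub>M\<^esub>" if "x \<in> K" for x
    using smult_l_distr[of "\<ominus>\<^bsub>R\<^esub> \<one>\<^bsub>R\<^esub>" "\<one>\<^bsub>R\<^esub>" x] K[OF that] by (simp add: R.l_neg)
  then have "abelian_group (M\<lparr>carrier := K\<rparr>)"
    by (intro abelian_groupI)
      (use assms K in \<open>auto simp: M.a_ac intro!: bexI[of _ "(\<ominus>\<^bsub>R\<^esub> \<one>\<^bsub>R\<^esub>) \<odot>\<^bsub>M\<^esub> _"]\<close>)
  then show ?thesis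
    by (intro moduleI R.is_cring) (use assms K in \<open>auto simp: smult_l_distr smult_r_distr smult_assoc1\<close>)
qed

lemma module_kernel:
  assumes "Module.module R M" "Module.module R N" "g \<in> mod_hom R M N"
  shows "Module.module R (M\<lparr>carrier := {x \<in> carrier M. g x = \<zero>\<^bsub>N\<^esub>}\<rparr>)"
proof -
  interpret M: Module.module R M by fact
  interpret N: Module.module R N by fact
  show ?thesis
    by (rule module_restrict[OF assms(1)])
      (auto simp: mod_homD[OF assms(3)] mod_hom_zero[OF assms])
qed

context Module.module
begin

lemma koszul_closed:
  assumes "set rs \<subseteq> carrier R" "\<And>bs. \<phi> bs \<in> carrier M"
  shows "koszul R M rs \<phi> bs \<in> carrier M"
  using assms by (induction rs arbitrary: \<phi> bs) (auto split: list.split)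

lemma koszul_zero:
  assumes "set rs \<subseteq> carrier R"
  shows "koszul R M rs (\<lambda>_. \<zero>\<^bsub>M\<^esub>) bs = \<zero>\<^bsub>M\<^esub>"
  using assms by (induction rs arbitrary: bs) (auto split: list.split)

lemma koszul_add:
  assumes "set rs \<subseteq> carrier R" "\<And>bs. \<phi> bs \<in> carrier M" "\<And>bs. \<psi> bs \<in> carrier M"
  shows "koszul R M rs (\<lambda>bs. \<phi> bs \<oplus>\<^bsub>M\<^esub> \<psi> bs) bs = koszul R M rs \<phi> bs \<oplus>\<^bsub>M\<^esub> koszul R M rs \<psi> bs"
  using assms by (induction rs arbitrary: \<phi> \<psi> bs)
    (auto split: list.split simp: smult_r_distr koszul_closed M.a_ac)

lemma koszul_smult:
  assumes "set rs \<subseteq> carrier R" "\<And>bs. \<phi> bs \<in> carrier M" "s \<in> carrier R"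
  shows "koszul R M rs (\<lambda>bs. s \<odot>\<^bsub>M\<^esub> \<phi> bs) bs = s \<odot>\<^bsub>M\<^esub> koszul R M rs \<phi> bs"
  using assms by (induction rs arbitrary: \<phi> bs)
    (auto split: list.split simp: smult_r_distr koszul_closed smult_assoc1[symmetric] R.m_comm)

lemma add_neg_smult:
  assumes "x \<in> carrier M"
  shows "x \<oplus>\<^bsub>M\<^esub> (\<ominus>\<^bsub>R\<^esub> \<one>\<^bsub>R\<^esub>) \<odot>\<^bsub>M\<^esub> x = \<zero>\<^bsub>M\<^esub>"
  using smult_l_distr[of "\<one>\<^bsub>R\<^esub>" "\<ominus>\<^bsub>R\<^esub> \<one>\<^bsub>R\<^esub>" x] assms by (simp add: R.r_neg)

text \<open>With a cochain split as (a, b) by its first entry, the differential is (a, b) \<mapsto>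
  (d a, r a - d b). Applying it twice leaves r (d a) - d (r a) + d (d b) in the second half.\<close>

lemma koszul_koszul:
  assumes "set rs \<subseteq> carrier R" "\<And>bs. \<phi> bs \<in> carrier M"
  shows "koszul R M rs (koszul R M rs \<phi>) bs = \<zero>\<^bsub>M\<^esub>"
  using assms
proof (induction rs arbitrary: \<phi> bs)
  case (Cons r rs)
  have rs: "set rs \<subseteq> carrier R" "r \<in> carrier R" using Cons.prems by auto
  show ?case
  proof (cases bs)
    case bs: (Cons b cs)
    have IH: "koszul R M rs (\<lambda>cs. koszul R M rs (\<lambda>bs. \<phi> (b # bs)) cs) cs = \<zero>\<^bsub>M\<^esub>" for b cs
      using Cons.IH[OF rs(1), of "\<lambda>bs. \<phi> (b # bs)"] Cons.prems(2) by simp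
    have c: "koszul R M rs (\<lambda>bs. \<phi> (b # bs)) cs \<in> carrier M" for b cs
      by (rule koszul_closed) (use rs Cons.prems in auto)
    show ?thesis
    proof (cases b)
      case True
      then show ?thesis
        using Cons.prems rs
        by (simp add: bs koszul_add koszul_smult c IH smult_r_null add_neg_smult)
    qed (simp add: bs IH)
  qed simp
qed simp

lemma cochains_zeroI:
  assumes "\<phi> \<in> cochains M n j" "length bs = n \<Longrightarrow> count_list bs True \<ge> j"
  shows "\<phi> bs = \<zero>\<^bsub>M\<^esub>"
  using assms by (force simp: cochains_def)

lemma koszul_cochains:
  assumes "set rs \<subseteq> carrier R" "\<phi> \<in> cochains M (length rs) j"
  shows "koszul R M rs \<phi> \<in> cochains M (length rs) (Suc j)"
proof (cases j)
  case 0
  then have "\<phi> = (\<lambda>_. \<zero>\<^bsub>M\<^esub>)"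
    using assms(2) by (auto simp: cochains_def)
  then show ?thesis
    by (simp add: cochains_def koszul_zero[OF assms(1)])
next
  case (Suc i)
  have "koszul R M rs \<phi> bs = \<zero>\<^bsub>M\<^esub>"
    if "length bs = length rs \<Longrightarrow> count_list bs True \<ge> Suc (Suc i)" "set rs \<subseteq> carrier R"
      "\<phi> \<in> cochains M (length rs) (Suc i)" for bs
    using that
  proof (induction rs arbitrary: \<phi> bs i)
    case (Cons r rs)
    show ?case
    proof (cases bs)
      case bs: (Cons b cs)
      show ?thesis
      proof (cases b)
        case True
        have "\<phi> (False # cs) = \<zero>\<^bsub>M\<^esub>"
          by (rule cochains_zeroI[OF Cons.prems(3)]) (use Cons.prems(1) bs True in auto)
        moreover have "koszul R M rs (\<lambda>bs. \<phi> (True # bs)) cs = \<zero>\<^bsub>M\<^esub>"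
        \<comment> \<open>The \<open>True\<close> half already carries one degree, so its bound is
          one smaller. For \<open>i = 0\<close> that half is zero, and the induction hypothesis,
          stated for positive bounds, does not apply.\<close>
        proof (cases i)
          case 0
          then have "(\<lambda>bs. \<phi> (True # bs)) = (\<lambda>_. \<zero>\<^bsub>M\<^esub>)"
            using Cons.prems(3) by (force simp: cochains_def)
          then show ?thesis
            using Cons.prems(2) by (simp add: koszul_zero)
        next
          case (Suc k)
          show ?thesis
            by (rule Cons.IH[of _ k]) (use Cons.prems bs True Suc in \<open>auto simp: cochains_def\<close>)
        qed
        ultimately show ?thesis
          using Cons.prems(2) bs True by simp
      next
        case False
        have "koszul R M rs (\<lambda>bs. \<phi> (False # bs)) cs = \<zero>\<^bsub>M\<^esub>"
          by (rule Cons.IH[of _ i]) (use Cons.prems bs False in \<open>auto simp: cochains_def\<close>)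
        then show ?thesis
          using bs False by simp
      qed
    qed simp
  qed simp
  moreover have "koszul R M rs \<phi> bs \<in> carrier M" for bs
    by (rule koszul_closed) (use assms in \<open>auto simp: cochains_def\<close>)
  ultimately show ?thesis
    using assms Suc by (force simp: cochains_def not_less)
qed

lemma koszul_replicate_False: "koszul R M rs \<beta> (replicate (length rs) False) = \<zero>\<^bsub>M\<^esub>"
  by (induction rs arbitrary: \<beta>) auto

text \<open>Placed at the all-\<open>False\<close> list, \<open>m\<close> becomes a cocycle of
  degree zero. Positive depth writes it as a coboundary, and coboundaries vanish at that
  list.\<close>

lemma socle_zero:
  assumes "depth_ge R rs M j" "0 < j" "set rs \<subseteq> carrier R"
    and m: "m \<in> carrier M" "\<And>r. r \<in> set rs \<Longrightarrow> r \<odot>\<^bsub>M\<^esub> m = \<zero>\<^bsub>M\<^esub>"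
  shows "m = \<zero>\<^bsub>M\<^esub>"
proof -
  \<comment> \<open>The length is a parameter so that the induction on \<open>rs\<close> can pass to
    the same cochain for a shorter list.\<close>
  define \<phi> where "\<phi> n bs = (if bs = replicate n False then m else \<zero>\<^bsub>M\<^esub>)" for n bs
  have "\<phi> (length rs) \<in> cochains M (length rs) j"
    using m assms(2) by (auto simp: \<phi>_def cochains_def)
  moreover have "koszul R M rs (\<phi> (length rs)) bs = \<zero>\<^bsub>M\<^esub>" for bs
    using assms(3) m(2)
  proof (induction rs arbitrary: bs)
    case (Cons r rs)
    have "(\<lambda>bs. \<phi> (length (r # rs)) (False # bs)) = \<phi> (length rs)"
      "(\<lambda>bs. \<phi> (length (r # rs)) (True # bs)) = (\<lambda>_. \<zero>\<^bsub>M\<^esub>)"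
      by (auto simp: \<phi>_def fun_eq_iff)
    moreover have "r \<odot>\<^bsub>M\<^esub> \<phi> (length (r # rs)) (False # bs) = \<zero>\<^bsub>M\<^esub>" for bs
      using Cons.prems by (auto simp: \<phi>_def)
    ultimately show ?case
      using Cons by (auto simp: koszul_zero split: list.split)
  qed simp
  ultimately obtain \<beta> where "\<And>bs. koszul R M rs \<beta> bs = \<phi> (length rs) bs"
    using assms(1) unfolding depth_ge_def by blast
  then show ?thesis
    using koszul_replicate_False[of rs \<beta>] by (simp add: \<phi>_def)
qed

end

section \<open>Koszul depth under homomorphisms, quotients and retracts\<close>

lemma koszul_hom:
  assumes "Module.module R M" "g \<in> mod_hom R M N" "Module.module R N"
    and "set rs \<subseteq> carrier R" "\<And>bs. \<phi> bs \<in> carrier M"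
  shows "g (koszul R M rs \<phi> bs) = koszul R N rs (\<lambda>bs. g (\<phi> bs)) bs"
proof -
  interpret M: Module.module R M by fact
  interpret N: Module.module R N by fact
  show ?thesis
    using assms(4,5)
    by (induction rs arbitrary: \<phi> bs)
      (auto split: list.split simp: mod_hom_zero[OF assms(1,3,2)] mod_homD[OF assms(2)] M.koszul_closed)
qed

lemma cochains_hom:
  assumes "Module.module R M" "Module.module R N" "g \<in> mod_hom R M N" "\<phi> \<in> cochains M n j"
  shows "(\<lambda>bs. g (\<phi> bs)) \<in> cochains N n j"
  using assms(4) mod_hom_zero[OF assms(1-3)] mod_homD(1)[OF assms(3)] unfolding cochains_def by force

lemma depth_ge_zero: "carrier M = {\<zero>\<^bsub>M\<^esub>} \<Longrightarrow> Module.module R M \<Longrightarrow> set rs \<subseteq> carrier R \<Longrightarrow> depth_ge R rs M j"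
  using module.koszul_zero[of R M rs]
  by (auto simp: depth_ge_def cochains_def intro!: bexI[of _ "\<lambda>_. \<zero>\<^bsub>M\<^esub>"])

text \<open>The connecting homomorphism made explicit: a lift \<psi> of a cocycle \<phi> of C has
  its coboundary in the kernel A, in degrees at most \<open>j\<close>. Depth \<open>Suc j\<close> of
  A turns this coboundary into that of some \<alpha> in degrees below \<open>j\<close>. Then \<psi>
  - \<alpha> is a cocycle of B that still lifts \<phi>, and a primitive of it maps to a primitive of
  \<phi>.\<close>

lemma depth_ge_quotient:
  assumes B: "Module.module R B" and C: "Module.module R C" and p: "p \<in> mod_hom R B C"
    "p ` carrier B = carrier C" and rs: "set rs \<subseteq> carrier R"
    and dA: "depth_ge R rs (B\<lparr>carrier := {x \<in> carrier B. p x = \<zero>\<^bsub>C\<^esub>}\<rparr>) (Suc j)" (is "depth_ge _ _ ?A _")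
    and dB: "depth_ge R rs B j"
  shows "depth_ge R rs C j"
  unfolding depth_ge_def
proof (intro ballI impI)
  interpret B: Module.module R B by fact
  interpret C: Module.module R C by fact
  fix \<phi> assume \<phi>: "\<phi> \<in> cochains C (length rs) j" and cyc: "\<forall>bs. koszul R C rs \<phi> bs = \<zero>\<^bsub>C\<^esub>"
  have "\<exists>b\<in>carrier B. p b = \<phi> bs" for bs
  proof -
    have "\<phi> bs \<in> carrier C" using \<phi> by (simp add: cochains_def)
    then show ?thesis unfolding p(2)[symmetric] by auto
  qed
  then obtain f where f: "\<And>bs. f bs \<in> carrier B" "\<And>bs. p (f bs) = \<phi> bs"
    by metis
  \<comment> \<open>Lifting zero to zero keeps the support of \<phi>, and with it the degree
    bound.\<close>
  define \<psi> where "\<psi> bs = (if \<phi> bs = \<zero>\<^bsub>C\<^esub> then \<zero>\<^bsub>B\<^esub> else f bs)" for bs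
  have \<psi>: "\<psi> \<in> cochains B (length rs) j"
    using \<phi> f by (auto simp: cochains_def \<psi>_def)
  have p\<psi>: "p (\<psi> bs) = \<phi> bs" for bs
    using f mod_hom_zero[OF B C p(1)] by (auto simp: \<psi>_def)
  have \<psi>c: "\<psi> bs \<in> carrier B" for bs
    using \<psi> by (simp add: cochains_def)
  have "koszul R B rs \<psi> \<in> cochains ?A (length rs) (Suc j)"
    using B.koszul_cochains[OF rs \<psi>] koszul_hom[OF B p(1) C rs, of \<psi>] \<psi>c cyc by (simp add: cochains_def p\<psi>)
  moreover have "koszul R ?A rs (koszul R B rs \<psi>) bs = \<zero>\<^bsub>?A\<^esub>" for bs
    using B.koszul_koszul[OF rs, of \<psi>] \<psi>c by (simp add: koszul_restrict)
  ultimately obtain \<alpha> where \<alpha>: "\<alpha> \<in> cochains ?A (length rs) j" "\<And>bs. koszul R B rs \<alpha> bs = koszul R B rs \<psi> bs"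
    using dA unfolding depth_ge_def koszul_restrict by force
  have \<alpha>c: "\<alpha> bs \<in> carrier B" "p (\<alpha> bs) = \<zero>\<^bsub>C\<^esub>" for bs
    using \<alpha>(1) by (auto simp: cochains_def)
  define \<psi>' where "\<psi>' bs = \<psi> bs \<oplus>\<^bsub>B\<^esub> (\<ominus>\<^bsub>R\<^esub> \<one>\<^bsub>R\<^esub>) \<odot>\<^bsub>B\<^esub> \<alpha> bs" for bs
  have "\<psi>' \<in> cochains B (length rs) j"
  proof -
    have "\<psi>' bs = \<zero>\<^bsub>B\<^esub>" if "\<psi> bs = \<zero>\<^bsub>B\<^esub>" "\<alpha> bs = \<zero>\<^bsub>B\<^esub>" for bs
      using that by (simp add: \<psi>'_def)
    then show ?thesis
      using \<psi> \<alpha>(1) \<psi>c \<alpha>c by (auto simp: cochains_def) (simp_all add: \<psi>'_def)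
  qed
  moreover have "koszul R B rs \<psi>' bs = \<zero>\<^bsub>B\<^esub>" for bs
    unfolding \<psi>'_def using \<psi>c \<alpha>c rs
    by (simp add: B.koszul_add B.koszul_smult \<alpha>(2) B.add_neg_smult B.koszul_closed)
  ultimately obtain \<beta> where \<beta>: "\<beta> \<in> cochains B (length rs) (j - 1)" "\<And>bs. koszul R B rs \<beta> bs = \<psi>' bs"
    using dB unfolding depth_ge_def by blast
  have "koszul R C rs (\<lambda>bs. p (\<beta> bs)) bs = \<phi> bs" for bs
  proof -
    have "koszul R C rs (\<lambda>bs. p (\<beta> bs)) bs = p (\<psi>' bs)"
      using koszul_hom[OF B p(1) C rs, of \<beta> bs] \<beta> by (simp add: cochains_def)
    also have "\<dots> = \<phi> bs"
      using \<psi>c \<alpha>c \<phi> by (simp add: \<psi>'_def mod_homD[OF p(1)] p\<psi> cochains_def)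
    finally show ?thesis .
  qed
  then show "\<exists>\<beta>\<in>cochains C (length rs) (j - 1). \<forall>bs. koszul R C rs \<beta> bs = \<phi> bs"
    using cochains_hom[OF B C p(1) \<beta>(1)] by blast
qed

lemma depth_ge_retract:
  assumes P: "Module.module R P" and F: "Module.module R F" and s: "s \<in> mod_hom R P F"
    and t: "t \<in> mod_hom R F P" and ts: "\<And>x. x \<in> carrier P \<Longrightarrow> t (s x) = x"
    and rs: "set rs \<subseteq> carrier R" and d: "depth_ge R rs F j"
  shows "depth_ge R rs P j"
  unfolding depth_ge_def
proof (intro ballI impI)
  fix \<phi> assume \<phi>: "\<phi> \<in> cochains P (length rs) j" and cyc: "\<forall>bs. koszul R P rs \<phi> bs = \<zero>\<^bsub>P\<^esub>"
  have \<phi>c: "\<phi> bs \<in> carrier P" for bs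
    using \<phi> by (simp add: cochains_def)
  have "koszul R F rs (\<lambda>bs. s (\<phi> bs)) bs = \<zero>\<^bsub>F\<^esub>" for bs
    using koszul_hom[OF P s F rs, of \<phi> bs] \<phi>c cyc mod_hom_zero[OF P F s] by simp
  then obtain \<beta> where \<beta>: "\<beta> \<in> cochains F (length rs) (j - 1)" "\<And>bs. koszul R F rs \<beta> bs = s (\<phi> bs)"
    using d cochains_hom[OF P F s \<phi>] unfolding depth_ge_def by blast
  have "koszul R P rs (\<lambda>bs. t (\<beta> bs)) bs = \<phi> bs" for bs
    using koszul_hom[OF F t P rs, of \<beta> bs] \<beta> ts[OF \<phi>c] by (simp add: cochains_def)
  then show "\<exists>\<beta>\<in>cochains P (length rs) (j - 1). \<forall>bs. koszul R P rs \<beta> bs = \<phi> bs"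
    using cochains_hom[OF F P t \<beta>(1)] by blast
qed

section \<open>Koszul depth of free and projective modules\<close>

definition ring_module :: "('a, 'c) ring_scheme \<Rightarrow> ('a, 'a) module" where
  "ring_module R = \<lparr>carrier = carrier R, mult = mult R, one = one R, zero = zero R, add = add R,
     smult = mult R\<rparr>"

lemma ring_module_simps [simp]:
  "carrier (ring_module R) = carrier R" "zero (ring_module R) = zero R"
  "add (ring_module R) = add R" "smult (ring_module R) = mult R"
  by (simp_all add: ring_module_def)

lemma module_ring_module:
  assumes "cring R"
  shows "Module.module R (ring_module R)"
proof -
  interpret R: cring R by fact
  show ?thesis
    by (rule moduleI) (auto simp: ring_module_def R.l_distr R.r_distr R.m_assoc R.is_cring
      intro!: abelian_groupI R.a_assoc R.a_comm R.add.l_inv_ex)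
qed

lemma koszul_free_module_apply:
  "koszul R (free_module R B) rs \<phi> bs q = koszul R (ring_module R) rs (\<lambda>bs. \<phi> bs q) bs"
  by (induction rs arbitrary: \<phi> bs) (simp_all add: free_module_def split: list.split)

text \<open>The differential acts coordinatewise, so a primitive exists in each coordinate; the
  issue is finite support. Only finitely many Boolean lists have length \<open>length rs\<close>,
  hence only finitely many coordinates occur in \<phi>, and the primitive is set to zero in all
  others.\<close>

lemma depth_ge_free_module:
  assumes "cring R" and rs: "set rs \<subseteq> carrier R" and d: "depth_ge R rs (ring_module R) j"
  shows "depth_ge R rs (free_module R B) j"
  unfolding depth_ge_def
proof (intro ballI impI)
  let ?F = "free_module R B" and ?n = "length rs"
  fix \<phi> assume \<phi>: "\<phi> \<in> cochains ?F ?n j" and cyc: "\<forall>bs. koszul R ?F rs \<phi> bs = \<zero>\<^bsub>?F\<^esub>"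
  have "\<exists>\<beta>. \<beta> \<in> cochains (ring_module R) ?n (j - 1) \<and>
    (\<forall>bs. koszul R (ring_module R) rs \<beta> bs = \<phi> bs q)" for q
  proof -
    have "(\<lambda>bs. \<phi> bs q) \<in> cochains (ring_module R) ?n j"
      using \<phi> by (fastforce simp: cochains_def free_module_def)
    moreover have "koszul R (ring_module R) rs (\<lambda>bs. \<phi> bs q) bs = \<zero>\<^bsub>R\<^esub>" for bs
      using cyc koszul_free_module_apply[of R B rs \<phi> bs q] by (simp add: free_module_def)
    ultimately show ?thesis
      using d unfolding depth_ge_def by force
  qed
  then obtain b where b: "\<And>q. b q \<in> cochains (ring_module R) ?n (j - 1)"
    "\<And>q bs. koszul R (ring_module R) rs (b q) bs = \<phi> bs q"
    by metis
  let ?Q = "\<Union>bs\<in>{bs. length bs = ?n}. {q. \<phi> bs q \<noteq> \<zero>\<^bsub>R\<^esub>}"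
  define \<beta> where "\<beta> bs q = (if q \<in> ?Q then b q bs else \<zero>\<^bsub>R\<^esub>)" for bs q
  have finQ: "finite ?Q"
  proof (rule finite_UN_I)
    show "finite {bs :: bool list. length bs = ?n}"
      using finite_lists_length_eq[of "UNIV :: bool set" ?n] by simp
  qed (use \<phi> in \<open>simp add: cochains_def free_module_def\<close>)
  have QB: "?Q \<subseteq> B"
    using \<phi> by (auto simp: cochains_def free_module_def)
  interpret R: cring R by fact
  interpret RM: Module.module R "ring_module R" by (rule module_ring_module) fact
  have bc: "b q bs \<in> carrier R" for q bs
    using b(1)[of q] by (simp add: cochains_def)
  have "\<beta> \<in> cochains ?F ?n (j - 1)"
  proof -
    have "finite {q. \<beta> bs q \<noteq> \<zero>\<^bsub>R\<^esub>}" for bs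
      by (rule finite_subset[OF _ finQ]) (auto simp: \<beta>_def)
    then have "\<beta> bs \<in> carrier ?F" for bs
      using bc QB by (auto simp: free_module_def \<beta>_def)
    moreover have "\<beta> bs = \<zero>\<^bsub>?F\<^esub>" if "length bs \<noteq> ?n \<or> \<not> count_list bs True < j - 1" for bs
      using RM.cochains_zeroI[OF b(1)] that by (auto simp: \<beta>_def free_module_def fun_eq_iff)
    ultimately show ?thesis
      unfolding cochains_def by blast
  qed
  moreover have "koszul R ?F rs \<beta> bs q = \<phi> bs q" for bs q
  proof (cases "q \<in> ?Q")
    case True
    then have "(\<lambda>bs. \<beta> bs q) = b q" by (simp add: \<beta>_def)
    then show ?thesis by (simp add: koszul_free_module_apply b(2))
  next
    case False
    then have "(\<lambda>bs. \<beta> bs q) = (\<lambda>_. \<zero>\<^bsub>ring_module R\<^esub>)" by (simp add: \<beta>_def)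
    moreover have "\<phi> bs q = \<zero>\<^bsub>R\<^esub>"
    proof (cases "length bs = ?n")
      case False
      then have "\<phi> bs = \<zero>\<^bsub>?F\<^esub>"
        using \<phi> unfolding cochains_def by blast
      then show ?thesis by (simp add: free_module_def)
    qed (use False in auto)
    ultimately show ?thesis
      using RM.koszul_zero[OF rs] by (simp add: koszul_free_module_apply)
  qed
  ultimately show "\<exists>\<beta>\<in>cochains ?F ?n (j - 1). \<forall>bs. koszul R ?F rs \<beta> bs = \<phi> bs"
    by blast
qed

text \<open>Lifting the identity of P along the map from the free module on its own elements makes P
  a retract of that module.\<close>

lemma depth_ge_projective:
  assumes "cring R" "projective_module R P" and rs: "set rs \<subseteq> carrier R"
    and d: "depth_ge R rs (ring_module R) j"
  shows "depth_ge R rs P j"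
proof -
  have P: "Module.module R P"
    using assms(2) by (simp add: projective_module_def)
  let ?F = "free_module R (carrier P)"
  have F: "Module.module R ?F"
    by (rule module_free_module) fact
  have t: "lincomb R P id \<in> mod_hom R ?F P"
    by (rule lincomb_hom[OF P]) auto
  have "carrier P \<subseteq> lincomb R P id ` carrier ?F"
    using lincomb_unit[OF P, of id "carrier P"] by (force simp: image_iff)
  then have surj: "lincomb R P id ` carrier ?F = carrier P"
    using mod_homD(1)[OF t] by auto
  have "(\<lambda>x. x) \<in> mod_hom R P P"
    by (auto simp: mod_hom_def)
  then obtain s where "s \<in> mod_hom R P ?F" "\<And>x. x \<in> carrier P \<Longrightarrow> lincomb R P id (s x) = x"
    using projective_module_lift[OF assms(2) F P t surj, of "\<lambda>x. x"] by blast
  then show ?thesis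
    by (rule depth_ge_retract[OF P F _ t _ rs depth_ge_free_module[OF assms(1) rs d]])
qed

text \<open>
  In an exact sequence \<open>0 \<rightarrow> A \<rightarrow> B \<rightarrow> C \<rightarrow> 0\<close> the depth drops by at most one from \<open>A\<close> to \<open>C\<close>.
\<close>

lemma depth_ge_resolution:
  fixes M :: "('a, 'm) module" and P :: "nat \<Rightarrow> ('a, 'p) module"
  assumes R: "cring R" and M: "Module.module R M" and res: "projective_resolution R M P d \<epsilon>"
    and triv: "\<And>i. i > n \<Longrightarrow> carrier (P i) = {\<zero>\<^bsub>P i\<^esub>}" and n: "n \<le> c"
    and rs: "set rs \<subseteq> carrier R" and depth: "\<And>j. j \<le> c \<Longrightarrow> depth_ge R rs (ring_module R) j"
  shows "depth_ge R rs M (c - n)"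
proof -
  have proj: "projective_module R (P i)" and d: "d i \<in> mod_hom R (P (Suc i)) (P i)"
    and \<epsilon>: "\<epsilon> \<in> mod_hom R (P 0) M" "\<epsilon> ` carrier (P 0) = carrier M"
    and ex0: "d 0 ` carrier (P 1) = {x \<in> carrier (P 0). \<epsilon> x = \<zero>\<^bsub>M\<^esub>}"
    and ex: "d (Suc i) ` carrier (P (Suc (Suc i))) = {x \<in> carrier (P (Suc i)). d i x = \<zero>\<^bsub>P i\<^esub>}" for i
    using res unfolding projective_resolution_def by - (elim conjE, (assumption | erule spec))+
  have P: "Module.module R (P i)" for i
    using proj by (simp add: projective_module_def)
  \<comment> \<open>\<open>Z i\<close> is the syzygy inside \<open>P i\<close>: by exactness it is
    both the kernel of the map leaving \<open>P i\<close> and the image of the map entering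
    it.\<close>
  define Z where "Z i = (case i of 0 \<Rightarrow> {x \<in> carrier (P 0). \<epsilon> x = \<zero>\<^bsub>M\<^esub>}
    | Suc k \<Rightarrow> {x \<in> carrier (P (Suc k)). d k x = \<zero>\<^bsub>P k\<^esub>})" for i
  have img: "d i ` carrier (P (Suc i)) = Z i" for i
    using ex0 ex by (simp add: Z_def split: nat.split)
  have Z: "Module.module R ((P i)\<lparr>carrier := Z i\<rparr>)" for i
    using module_kernel[OF P M \<epsilon>(1)] module_kernel[OF P P d] by (simp add: Z_def split: nat.split)
  have dP: "depth_ge R rs (P i) j" if "j \<le> c" for i j
    by (rule depth_ge_projective[OF R proj rs depth[OF that]])
  \<comment> \<open>The zero module \<open>Z n\<close> has every depth and is started at
    \<open>Suc c\<close>, one above what the projective terms offer. Each exact sequence from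
    \<open>Z (k + 1)\<close> through \<open>P (k + 1)\<close> to \<open>Z k\<close> costs one, so
    \<open>Suc c - n\<close> remains at \<open>Z 0\<close>, and the augmentation leaves
    \<open>c - n\<close> for \<open>M\<close>.\<close>
  have "depth_ge R rs ((P (n - i))\<lparr>carrier := Z (n - i)\<rparr>) (Suc c - i)" if "i \<le> n" for i
    using that
  proof (induction i)
    case 0
    have "Z n = {\<zero>\<^bsub>P n\<^esub>}"
      using img[of n] triv[of "Suc n"] mod_hom_zero[OF P P d] by simp
    then show ?case
      by (intro depth_ge_zero[OF _ Z rs]) simp
  next
    case (Suc i)
    then obtain k where k: "n - i = Suc k" "n - Suc i = k"
      by (metis Suc_diff_Suc Suc_le_lessD)
    have "depth_ge R rs ((P k)\<lparr>carrier := Z k\<rparr>) (c - i)"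
    proof (rule depth_ge_quotient[OF P Z _ _ rs])
      show "d k \<in> mod_hom R (P (Suc k)) ((P k)\<lparr>carrier := Z k\<rparr>)"
        using d[of k] img[of k] by (auto simp: mod_hom_def)
      show "d k ` carrier (P (Suc k)) = carrier ((P k)\<lparr>carrier := Z k\<rparr>)"
        by (simp add: img)
      show "depth_ge R rs (P (Suc k)) (c - i)"
        by (rule dP) simp
      show "depth_ge R rs ((P (Suc k))\<lparr>carrier := {x \<in> carrier (P (Suc k)). d k x = \<zero>\<^bsub>(P k)\<lparr>carrier := Z k\<rparr>\<^esub>}\<rparr>) (Suc (c - i))"
        using Suc n k by (simp add: Z_def Suc_diff_le)
    qed
    then show ?case
      using k by simp
  qed
  from this[of n] have "depth_ge R rs ((P 0)\<lparr>carrier := Z 0\<rparr>) (Suc (c - n))"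
    using n by (simp add: Suc_diff_le)
  then show ?thesis
    using depth_ge_quotient[OF P M \<epsilon> rs _ dP] by (simp add: Z_def)
qed

text \<open>A resolution shorter than \<open>rs\<close> would leave \<open>M\<close> with positive
  depth, which is excluded by a nonzero element killed by all of \<open>rs\<close>.\<close>

lemma projdim_ge:
  fixes M :: "('a, 'm) module"
  assumes R: "cring R" and M: "Module.module R M" and rs: "set rs \<subseteq> carrier R"
    and depth: "\<And>j. j \<le> length rs \<Longrightarrow> depth_ge R rs (ring_module R) j"
    and m: "m \<in> carrier M" "m \<noteq> \<zero>\<^bsub>M\<^esub>" "\<And>r. r \<in> set rs \<Longrightarrow> r \<odot>\<^bsub>M\<^esub> m = \<zero>\<^bsub>M\<^esub>"
  shows "enat (length rs) \<le> projdim R M"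
  unfolding projdim_def
proof (rule Inf_greatest, clarify)
  fix n and P :: "nat \<Rightarrow> ('a, 'm \<times> nat \<Rightarrow> 'a) module" and d \<epsilon>
  assume res: "projective_resolution R M P d \<epsilon>" and triv: "\<forall>i>n. carrier (P i) = {\<zero>\<^bsub>P i\<^esub>}"
  interpret M: Module.module R M by fact
  show "enat (length rs) \<le> enat n"
  proof (rule ccontr)
    assume "\<not> enat (length rs) \<le> enat n"
    then have n: "n < length rs" by simp
    have "depth_ge R rs M (length rs - n)"
      by (rule depth_ge_resolution[OF R M res _ _ rs depth]) (use triv n in auto)
    then have "m = \<zero>\<^bsub>M\<^esub>"
      by (rule M.socle_zero) (use n rs m in auto)
    then show False
      using m(2) by simp
  qed
qed


declare split_paired_All [simp del] split_paired_Ex [simp del]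

section \<open>Finite free resolutions\<close>

definition scal :: "'p::comm_ring_1 \<Rightarrow> ('i \<Rightarrow> 'p) \<Rightarrow> 'i \<Rightarrow> 'p" where
  "scal r \<phi> = (\<lambda>q. r * \<phi> q)"

lemma scal_apply: "scal r \<phi> q = r * \<phi> q"
  by (simp add: scal_def)

lemmas fun_arith = fun_eq_iff scal_apply plus_fun_apply zero_fun_apply

lemma scal_simps [simp]:
  "scal r 0 = 0" "scal 0 \<phi> = 0" "scal 1 \<phi> = \<phi>" "scal (- 1) \<phi> = - \<phi>"
  "scal r (scal s \<phi>) = scal (r * s) \<phi>"
  by (simp_all add: fun_arith mult.assoc)

lemma scal_add: "scal r (\<phi> + \<psi>) = scal r \<phi> + scal r \<psi>"
  and scal_add_left: "scal (r + s) \<phi> = scal r \<phi> + scal s \<phi>"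
  by (simp_all add: fun_arith algebra_simps)

lemma scal_sum: "scal r (sum f S) = (\<Sum>t\<in>S. scal r (f t))"
  by (induction S rule: infinite_finite_induct) (simp_all add: scal_add)

definition unit_vec :: "'i \<Rightarrow> 'i \<Rightarrow> 'p::comm_ring_1" where
  "unit_vec q = (\<lambda>q'. if q' = q then 1 else 0)"

text \<open>
  Splitting the index type into two copies of itself keeps the direct sum of two modules of vectors
  within the same type.
\<close>

definition even_idx :: "'j \<times> nat \<Rightarrow> 'j \<times> nat" where "even_idx q = (fst q, 2 * snd q)"
definition odd_idx :: "'j \<times> nat \<Rightarrow> 'j \<times> nat" where "odd_idx q = (fst q, Suc (2 * snd q))"

definition join :: "('j \<times> nat \<Rightarrow> 'p) \<Rightarrow> ('j \<times> nat \<Rightarrow> 'p) \<Rightarrow> 'j \<times> nat \<Rightarrow> 'p" where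
  "join \<phi> \<psi> q = (if even (snd q) then \<phi> (fst q, snd q div 2) else \<psi> (fst q, snd q div 2))"

lemma join_even_idx [simp]: "join \<phi> \<psi> (even_idx q) = \<phi> q" and join_odd_idx [simp]: "join \<phi> \<psi> (odd_idx q) = \<psi> q"
  by (simp_all add: join_def even_idx_def odd_idx_def)

lemma join_comp_even_idx [simp]: "join \<phi> \<psi> \<circ> even_idx = \<phi>" and join_comp_odd_idx [simp]: "join \<phi> \<psi> \<circ> odd_idx = \<psi>"
  by (simp_all add: fun_eq_iff)

lemma even_idx_or_odd_idx: obtains r where "q = even_idx r" | r where "q = odd_idx r"
proof (cases "even (snd q)")
  case True
  then have "q = even_idx (fst q, snd q div 2)" by (simp add: even_idx_def)
  then show ?thesis using that by blast
next
  case False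
  then have "q = odd_idx (fst q, snd q div 2)" by (simp add: odd_idx_def prod_eq_iff)
  then show ?thesis using that by blast
qed

lemma even_idx_odd_idx_inject [simp]:
  "even_idx q = even_idx r \<longleftrightarrow> q = r" "odd_idx q = odd_idx r \<longleftrightarrow> q = r" "even_idx q \<noteq> odd_idx r" "odd_idx r \<noteq> even_idx q"
proof -
  show "even_idx q = even_idx r \<longleftrightarrow> q = r" "odd_idx q = odd_idx r \<longleftrightarrow> q = r"
    by (auto simp: even_idx_def odd_idx_def prod_eq_iff)
  show "even_idx q \<noteq> odd_idx r" "odd_idx r \<noteq> even_idx q"
    by (auto simp: even_idx_def odd_idx_def prod_eq_iff) presburger+
qed

lemma join_eqI:
  assumes "\<theta> \<circ> even_idx = \<phi>" "\<theta> \<circ> odd_idx = \<psi>"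
  shows "\<theta> = join \<phi> \<psi>"
proof
  fix q show "\<theta> q = join \<phi> \<psi> q"
    by (rule even_idx_or_odd_idx[of q]) (use assms in auto)
qed

lemma join_eq_iff: "\<theta> = join \<phi> \<psi> \<longleftrightarrow> \<theta> \<circ> even_idx = \<phi> \<and> \<theta> \<circ> odd_idx = \<psi>"
  using join_eqI by fastforce

lemma add_comp: "(\<phi> + \<psi>) \<circ> f = (\<phi> \<circ> f) + (\<psi> \<circ> f)"
  and scal_comp: "scal r \<phi> \<circ> f = scal r (\<phi> \<circ> f)"
  and zero_comp: "0 \<circ> f = 0"
  by (simp_all add: fun_arith)

lemma join_add: "join (\<phi> + \<phi>') (\<psi> + \<psi>') = join \<phi> \<psi> + join \<phi>' \<psi>'"
  and join_scal: "join (scal r \<phi>) (scal r \<psi>) = scal r (join \<phi> \<psi>)"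
  by (rule join_eqI[symmetric]; simp add: add_comp scal_comp)+

lemma join_zero_iff: "join \<phi> \<psi> = 0 \<longleftrightarrow> \<phi> = 0 \<and> \<psi> = 0"
  using join_eq_iff[of 0 \<phi> \<psi>] by (auto simp: zero_comp)


text \<open>The ring is a subset of a type with class arithmetic, so polynomial rings in different
  sets of variables share one type and vectors can be added without record operations.\<close>

locale coeff_ring =
  fixes A :: "'p::comm_ring_1 set"
  assumes zero_A [simp]: "0 \<in> A" and one_A [simp]: "1 \<in> A"
    and add_A [simp]: "a \<in> A \<Longrightarrow> b \<in> A \<Longrightarrow> a + b \<in> A"
    and mult_A [simp]: "a \<in> A \<Longrightarrow> b \<in> A \<Longrightarrow> a * b \<in> A"
    and uminus_A [simp]: "a \<in> A \<Longrightarrow> - a \<in> A"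
begin

lemma minus_A [simp]: "a \<in> A \<Longrightarrow> b \<in> A \<Longrightarrow> a - b \<in> A"
  using add_A[of a "- b"] by simp

lemma sum_A: "(\<And>t. t \<in> S \<Longrightarrow> f t \<in> A) \<Longrightarrow> sum f S \<in> A"
  by (induction S rule: infinite_finite_induct) auto

definition submod :: "('i \<Rightarrow> 'p) set \<Rightarrow> bool" where
  "submod K \<longleftrightarrow> 0 \<in> K \<and> (\<forall>\<phi>\<in>K. \<forall>\<psi>\<in>K. \<phi> + \<psi> \<in> K) \<and> (\<forall>r\<in>A. \<forall>\<phi>\<in>K. scal r \<phi> \<in> K)"

definition linear_on :: "('i \<Rightarrow> 'p) set \<Rightarrow> (('i \<Rightarrow> 'p) \<Rightarrow> 'l \<Rightarrow> 'p) \<Rightarrow> bool" where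
  "linear_on K f \<longleftrightarrow> (\<forall>\<phi>\<in>K. \<forall>\<psi>\<in>K. f (\<phi> + \<psi>) = f \<phi> + f \<psi>) \<and> (\<forall>r\<in>A. \<forall>\<phi>\<in>K. f (scal r \<phi>) = scal r (f \<phi>))"

definition free_vecs :: "'i set \<Rightarrow> ('i \<Rightarrow> 'p) set" where
  "free_vecs S = {\<phi>. (\<forall>q. \<phi> q \<in> A) \<and> (\<forall>q. q \<notin> S \<longrightarrow> \<phi> q = 0)}"

lemma submodD:
  assumes "submod K"
  shows "0 \<in> K" "\<phi> \<in> K \<Longrightarrow> \<psi> \<in> K \<Longrightarrow> \<phi> + \<psi> \<in> K" "r \<in> A \<Longrightarrow> \<phi> \<in> K \<Longrightarrow> scal r \<phi> \<in> K"
  using assms by (auto simp: submod_def)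

lemma submod_uminus: "submod K \<Longrightarrow> \<phi> \<in> K \<Longrightarrow> - \<phi> \<in> K"
  using submodD(3)[of K "- 1" \<phi>] by simp

lemma submod_minus: "submod K \<Longrightarrow> \<phi> \<in> K \<Longrightarrow> \<psi> \<in> K \<Longrightarrow> \<phi> - \<psi> \<in> K"
  using submodD(2)[of K \<phi> "- \<psi>"] submod_uminus[of K \<psi>] by simp

lemma submod_sum: "submod K \<Longrightarrow> (\<And>t. t \<in> S \<Longrightarrow> f t \<in> K) \<Longrightarrow> sum f S \<in> K"
  by (induction S rule: infinite_finite_induct) (auto intro: submodD)

lemma linear_onD:
  assumes "linear_on K f"
  shows "\<phi> \<in> K \<Longrightarrow> \<psi> \<in> K \<Longrightarrow> f (\<phi> + \<psi>) = f \<phi> + f \<psi>" "r \<in> A \<Longrightarrow> \<phi> \<in> K \<Longrightarrow> f (scal r \<phi>) = scal r (f \<phi>)"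
  using assms by (auto simp: linear_on_def)

lemma linear_on_zero: "submod K \<Longrightarrow> linear_on K f \<Longrightarrow> f 0 = 0"
  using linear_onD(2)[of K f 0 0] submodD(1) by fastforce

lemma linear_on_uminus: "linear_on K f \<Longrightarrow> \<phi> \<in> K \<Longrightarrow> f (- \<phi>) = - f \<phi>"
  using linear_onD(2)[of K f "- 1" \<phi>] by simp

lemma linear_on_minus: "submod K \<Longrightarrow> linear_on K f \<Longrightarrow> \<phi> \<in> K \<Longrightarrow> \<psi> \<in> K \<Longrightarrow> f (\<phi> - \<psi>) = f \<phi> - f \<psi>"
  using linear_onD(1)[of K f \<phi> "- \<psi>"] linear_on_uminus[of K f \<psi>] submod_uminus[of K \<psi>] by simp

lemma linear_on_sum:
  assumes "submod K" "linear_on K f"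
  shows "(\<And>t. t \<in> S \<Longrightarrow> g t \<in> K) \<Longrightarrow> f (sum g S) = (\<Sum>t\<in>S. f (g t))"
  by (induction S rule: infinite_finite_induct)
    (auto simp: linear_onD[OF assms(2)] submod_sum[OF assms(1)] linear_on_zero[OF assms])

lemma linear_on_subset: "linear_on K f \<Longrightarrow> K' \<subseteq> K \<Longrightarrow> linear_on K' f"
  unfolding linear_on_def by blast

lemma linear_on_compose: "linear_on K f \<Longrightarrow> f ` K \<subseteq> L \<Longrightarrow> linear_on L g \<Longrightarrow> linear_on K (\<lambda>\<phi>. g (f \<phi>))"
  unfolding linear_on_def by (simp add: image_subset_iff)

lemma submod_free_vecs: "submod (free_vecs S)"
  by (auto simp: submod_def free_vecs_def fun_arith)

lemma submod_kernel: "submod K \<Longrightarrow> linear_on K f \<Longrightarrow> submod {\<phi> \<in> K. f \<phi> = 0}"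
  using linear_on_zero[of K f] by (auto simp: submod_def linear_onD)

lemma submod_image: "submod K \<Longrightarrow> linear_on K f \<Longrightarrow> submod (f ` K)"
  using linear_on_zero[of K f] unfolding submod_def
  by (auto simp: linear_onD(1,2)[symmetric] intro: image_eqI[of _ f])

lemma unit_vec_free_vecs: "q \<in> S \<Longrightarrow> unit_vec q \<in> free_vecs S"
  by (auto simp: free_vecs_def unit_vec_def)

lemma free_vecs_expansion:
  assumes "finite S" "\<phi> \<in> free_vecs S"
  shows "\<phi> = (\<Sum>t\<in>S. scal (\<phi> t) (unit_vec t))"
proof
  have sum_apply: "(sum f T) q = (\<Sum>t\<in>T. f t q)" for f :: "'i \<Rightarrow> 'i \<Rightarrow> 'p" and T q
    by (induction T rule: infinite_finite_induct) (auto simp: fun_arith)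
  fix q
  have "(\<Sum>t\<in>S. scal (\<phi> t) (unit_vec t) q) = (\<Sum>t\<in>S. if t = q then \<phi> q else 0)"
    by (rule sum.cong) (auto simp: unit_vec_def scal_apply)
  also have "\<dots> = \<phi> q"
    using assms by (auto simp: free_vecs_def)
  finally show "\<phi> q = (\<Sum>t\<in>S. scal (\<phi> t) (unit_vec t)) q"
    by (simp add: sum_apply)
qed

text \<open>Preimages are chosen only for the finitely many unit vectors and extended
  linearly.\<close>

lemma free_lift:
  assumes S: "finite S" and K: "submod K" and p: "linear_on K p" and g: "linear_on (free_vecs S) g" "g ` free_vecs S \<subseteq> p ` K"
  obtains k where "linear_on (free_vecs S) k" "k ` free_vecs S \<subseteq> K" "\<And>\<psi>. \<psi> \<in> free_vecs S \<Longrightarrow> p (k \<psi>) = g \<psi>"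
proof -
  have "\<forall>t\<in>S. \<exists>v\<in>K. p v = g (unit_vec t)"
    using g(2) unit_vec_free_vecs by (fastforce simp: image_subset_iff)
  then obtain v where v: "\<And>t. t \<in> S \<Longrightarrow> v t \<in> K" "\<And>t. t \<in> S \<Longrightarrow> p (v t) = g (unit_vec t)"
    by metis
  define k where "k \<psi> = (\<Sum>t\<in>S. scal (\<psi> t) (v t))" for \<psi>
  have kK: "k \<psi> \<in> K" if "\<psi> \<in> free_vecs S" for \<psi>
    unfolding k_def by (rule submod_sum[OF K]) (use that v submodD[OF K] in \<open>auto simp: free_vecs_def\<close>)
  have "p (k \<psi>) = g \<psi>" if \<psi>: "\<psi> \<in> free_vecs S" for \<psi>
  proof -
    have in_A: "\<psi> t \<in> A" for t using \<psi> by (auto simp: free_vecs_def)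
    have "p (k \<psi>) = (\<Sum>t\<in>S. scal (\<psi> t) (g (unit_vec t)))"
      unfolding k_def by (subst linear_on_sum[OF K p]) (auto simp: v submodD[OF K] in_A linear_onD[OF p])
    also have "\<dots> = g (\<Sum>t\<in>S. scal (\<psi> t) (unit_vec t))"
      by (subst linear_on_sum[OF submod_free_vecs g(1)])
        (auto simp: unit_vec_free_vecs submodD[OF submod_free_vecs] in_A linear_onD[OF g(1)])
    also have "\<dots> = g \<psi>"
      using free_vecs_expansion[OF S \<psi>] by simp
    finally show ?thesis .
  qed
  moreover have "linear_on (free_vecs S) k"
    by (auto simp: linear_on_def k_def scal_add_left sum.distrib scal_sum scal_apply plus_fun_apply)
  ultimately show ?thesis
    using that kK by blast
qed

text \<open>
  The number \<open>n\<close> counts the free modules, so it is one more than the length of the resolution.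
\<close>

primrec has_free_res :: "nat \<Rightarrow> ('j \<times> nat \<Rightarrow> 'p) set \<Rightarrow> bool" where
  "has_free_res 0 K \<longleftrightarrow> K = {0}"
| "has_free_res (Suc n) K \<longleftrightarrow> (\<exists>(S :: ('j \<times> nat) set) f. finite S \<and> linear_on (free_vecs S) f \<and> f ` free_vecs S = K \<and>
     has_free_res n {\<phi> \<in> free_vecs S. f \<phi> = 0})"

lemma has_free_res_SucE:
  fixes K :: "('j \<times> nat \<Rightarrow> 'p) set"
  assumes "has_free_res (Suc n) K"
  obtains S :: "('j \<times> nat) set" and f where "finite S" "linear_on (free_vecs S) f" "f ` free_vecs S = K" "has_free_res n {\<phi> \<in> free_vecs S. f \<phi> = 0}"
  using assms unfolding has_free_res.simps by (elim exE conjE) (rule that)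

lemma has_free_res_SucI:
  fixes K :: "('j \<times> nat \<Rightarrow> 'p) set" and S :: "('j \<times> nat) set"
  assumes "finite S" "linear_on (free_vecs S) f" "f ` free_vecs S = K" "has_free_res n {\<phi> \<in> free_vecs S. f \<phi> = 0}"
  shows "has_free_res (Suc n) K"
  using assms unfolding has_free_res.simps by (intro exI[of _ S] exI[of _ f] conjI)

lemma has_free_res_submod: "has_free_res n K \<Longrightarrow> submod K"
  by (cases n) (auto simp: submod_def[of "{0}"] intro!: submod_image submod_free_vecs)

lemma has_free_res_Suc: "has_free_res n K \<Longrightarrow> has_free_res (Suc n) K"
proof (induction n arbitrary: K)
  case 0
  have "free_vecs {} = {0}" by (auto simp: free_vecs_def fun_arith)
  with 0 show ?case
    by (intro has_free_res_SucI[of "{}" "\<lambda>_. 0"]) (auto simp: linear_on_def)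
next
  case (Suc n)
  from Suc.prems show ?case
    by (rule has_free_res_SucE) (rule has_free_res_SucI, assumption+, rule Suc.IH)
qed

lemma has_free_res_mono: "has_free_res n K \<Longrightarrow> n \<le> m \<Longrightarrow> has_free_res m K"
  by (induction m) (auto simp: le_Suc_eq intro: has_free_res_Suc simp del: has_free_res.simps)

lemma has_free_res_zero: "has_free_res n {0}"
  by (rule has_free_res_mono[of 0]) auto

text \<open>A free cover of the middle term is the cover \<open>f\<close> of the submodule together
  with a lift \<open>k\<close> of the cover \<open>g\<close> of the quotient, on disjoint even and
  odd copies of the two bases. The kernels of \<open>f\<close>, of the combined map \<open>h\<close>
  and of \<open>g\<close> form an exact sequence of the same shape, so the induction hypothesis
  applies to them.\<close>

lemma horseshoe:
  fixes K L :: "('j \<times> nat \<Rightarrow> 'p) set" and p :: "('j \<times> nat \<Rightarrow> 'p) \<Rightarrow> 'j \<times> nat \<Rightarrow> 'p"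
  assumes "has_free_res n L" "has_free_res n (p ` K)" "submod K" "linear_on K p" "linear_on L i"
    and "\<And>\<phi>. \<phi> \<in> L \<Longrightarrow> i \<phi> = 0 \<Longrightarrow> \<phi> = 0" "{\<phi> \<in> K. p \<phi> = 0} = i ` L"
  shows "has_free_res n K"
  using assms
proof (induction n arbitrary: L K p i)
  case 0
  have L: "L = {0}" and pK: "p ` K = {0}"
    using 0(1,2) by simp_all
  have "i 0 = 0"
    using linear_on_zero[of L i] has_free_res_submod 0(1,5) by blast
  moreover have "K \<subseteq> {\<phi> \<in> K. p \<phi> = 0}"
    using pK by blast
  ultimately have "K \<subseteq> {0}"
    unfolding 0(7) L by simp
  then show ?case
    using submodD(1)[OF 0(3)] by auto
next
  case (Suc n)
  note K = \<open>submod K\<close> and p = \<open>linear_on K p\<close> and i = \<open>linear_on L i\<close>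
  have L: "submod L" using Suc.prems(1) by (rule has_free_res_submod)
  obtain S :: "('j \<times> nat) set" and f where S: "finite S" "linear_on (free_vecs S) f" "f ` free_vecs S = L" and fS: "has_free_res n {\<phi> \<in> free_vecs S. f \<phi> = 0}"
    using Suc.prems(1) by (rule has_free_res_SucE)
  obtain T :: "('j \<times> nat) set" and g where T: "finite T" "linear_on (free_vecs T) g" "g ` free_vecs T = p ` K" and gT: "has_free_res n {\<psi> \<in> free_vecs T. g \<psi> = 0}"
    using Suc.prems(2) by (rule has_free_res_SucE)
  obtain k where k: "linear_on (free_vecs T) k" "k ` free_vecs T \<subseteq> K" "\<And>\<psi>. \<psi> \<in> free_vecs T \<Longrightarrow> p (k \<psi>) = g \<psi>"
    using free_lift[OF T(1) K p T(2)] T(3) by (metis order_refl)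
  let ?U = "even_idx ` S \<union> odd_idx ` T"
  have U1: "\<theta> \<circ> even_idx \<in> free_vecs S" "\<theta> \<circ> odd_idx \<in> free_vecs T" if "\<theta> \<in> free_vecs ?U" for \<theta>
  proof -
    have "even_idx q \<in> even_idx ` S \<longleftrightarrow> q \<in> S" "even_idx q \<notin> odd_idx ` T" "odd_idx q \<in> odd_idx ` T \<longleftrightarrow> q \<in> T" "odd_idx q \<notin> even_idx ` S" for q
      by auto
    then show "\<theta> \<circ> even_idx \<in> free_vecs S" "\<theta> \<circ> odd_idx \<in> free_vecs T"
      using that by (simp_all add: free_vecs_def)
  qed
  have U2: "join \<phi> \<psi> \<in> free_vecs ?U" if \<phi>: "\<phi> \<in> free_vecs S" and \<psi>: "\<psi> \<in> free_vecs T" for \<phi> \<psi>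
    unfolding free_vecs_def
  proof (intro CollectI conjI allI impI)
    fix q
    show "join \<phi> \<psi> q \<in> A"
      using \<phi> \<psi> by (simp add: join_def free_vecs_def)
    assume q: "q \<notin> even_idx ` S \<union> odd_idx ` T"
    show "join \<phi> \<psi> q = 0"
      by (rule even_idx_or_odd_idx[of q]) (use q \<phi> \<psi> in \<open>auto simp: free_vecs_def\<close>)
  qed
  define h where "h \<theta> = i (f (\<theta> \<circ> even_idx)) + k (\<theta> \<circ> odd_idx)" for \<theta>
  have iL: "i \<phi> \<in> K" "p (i \<phi>) = 0" if "\<phi> \<in> L" for \<phi>
    using Suc.prems(7) that by auto
  have fL: "f \<phi> \<in> L" if "\<phi> \<in> free_vecs S" for \<phi>
    using S(3) that by auto
  have kK: "k \<psi> \<in> K" if "\<psi> \<in> free_vecs T" for \<psi>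
    using k(2) that by auto
  have h: "linear_on (free_vecs ?U) h"
    unfolding linear_on_def h_def add_comp scal_comp
    by (auto simp: linear_onD[OF i] linear_onD[OF S(2)] linear_onD[OF k(1)] U1 fL scal_add)
  have hK: "h \<theta> \<in> K" "p (h \<theta>) = g (\<theta> \<circ> odd_idx)" if "\<theta> \<in> free_vecs ?U" for \<theta>
    using U1[OF that] by (simp_all add: h_def submodD[OF K] iL fL kK linear_onD[OF p] k(3))
  have "y \<in> h ` free_vecs ?U" if y: "y \<in> K" for y
  proof -
    obtain \<psi> where \<psi>: "\<psi> \<in> free_vecs T" "p y = g \<psi>"
      using imageI[OF y, of p] unfolding T(3)[symmetric] by blast
    have "p (y - k \<psi>) = 0"
      using \<psi> by (simp add: linear_on_minus[OF K p y kK[OF \<psi>(1)]] k(3))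
    then have "y - k \<psi> \<in> i ` L"
      using Suc.prems(7) submod_minus[OF K y kK[OF \<psi>(1)]] by blast
    then obtain \<phi> where \<phi>: "\<phi> \<in> free_vecs S" "y - k \<psi> = i (f \<phi>)"
      using S(3) by blast
    have "y = h (join \<phi> \<psi>)"
      using \<phi>(2) by (simp add: h_def algebra_simps)
    then show ?thesis
      using U2[OF \<phi>(1) \<psi>(1)] by blast
  qed
  then have "h ` free_vecs ?U = K"
    using hK by blast
  moreover have "has_free_res n {\<theta> \<in> free_vecs ?U. h \<theta> = 0}"
  proof (rule Suc.IH[of "{\<phi> \<in> free_vecs S. f \<phi> = 0}" "\<lambda>\<theta>. \<theta> \<circ> odd_idx" _ "\<lambda>\<phi>. join \<phi> 0"])
    show "submod {\<theta> \<in> free_vecs ?U. h \<theta> = 0}"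
      by (rule submod_kernel[OF submod_free_vecs h])
    have z: "i 0 = 0" "f 0 = 0" "k 0 = 0" "p 0 = 0"
      by (rule linear_on_zero; fact submod_free_vecs K L i S k p)+
    have "\<exists>\<theta>\<in>free_vecs ?U. h \<theta> = 0 \<and> \<theta> \<circ> odd_idx = \<psi>" if \<psi>: "\<psi> \<in> free_vecs T" "g \<psi> = 0" for \<psi>
    proof -
      have "p (k \<psi>) = 0"
        using k(3) \<psi> by simp
      then have "k \<psi> \<in> i ` L"
        using Suc.prems(7) kK[OF \<psi>(1)] by blast
      then obtain \<phi> where \<phi>: "\<phi> \<in> free_vecs S" "k \<psi> = i (f \<phi>)"
        using S(3) by blast
      \<comment> \<open>Surjectivity onto the kernel of \<open>g\<close>: the lift \<open>k\<close>
        of \<psi> need not vanish, but it lies in the submodule and is cancelled by the even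
        half.\<close>
      have "h (join (- \<phi>) \<psi>) = 0"
        using \<phi> by (simp add: h_def linear_on_uminus[OF S(2)] linear_on_uminus[OF i fL])
      then show ?thesis
        using U2[OF submod_uminus[OF submod_free_vecs \<phi>(1)] \<psi>(1)] by (intro bexI) auto
    qed
    moreover have "g (\<theta> \<circ> odd_idx) = 0" if "\<theta> \<in> free_vecs ?U" "h \<theta> = 0" for \<theta>
      using hK(2)[OF that(1)] that(2) z by simp
    ultimately have "(\<lambda>\<theta>. \<theta> \<circ> odd_idx) ` {\<theta> \<in> free_vecs ?U. h \<theta> = 0} = {\<psi> \<in> free_vecs T. g \<psi> = 0}"
      using U1 by (auto simp: image_iff)
    then show "has_free_res n ((\<lambda>\<theta>. \<theta> \<circ> odd_idx) ` {\<theta> \<in> free_vecs ?U. h \<theta> = 0})"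
      using gT by simp
    show "{\<theta> \<in> {\<theta> \<in> free_vecs ?U. h \<theta> = 0}. \<theta> \<circ> odd_idx = 0} = (\<lambda>\<phi>. join \<phi> 0) ` {\<phi> \<in> free_vecs S. f \<phi> = 0}"
    proof (intro equalityI subsetI)
      fix \<theta> assume "\<theta> \<in> {\<theta> \<in> {\<theta> \<in> free_vecs ?U. h \<theta> = 0}. \<theta> \<circ> odd_idx = 0}"
      then have \<theta>: "\<theta> \<in> free_vecs ?U" "h \<theta> = 0" "\<theta> \<circ> odd_idx = 0" by auto
      have "i (f (\<theta> \<circ> even_idx)) = 0"
        using \<theta> z by (simp add: h_def)
      then have "f (\<theta> \<circ> even_idx) = 0"
        using Suc.prems(6) fL U1(1)[OF \<theta>(1)] by blast
      moreover have "\<theta> = join (\<theta> \<circ> even_idx) 0"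
        by (rule join_eqI) (auto simp: \<theta>)
      ultimately show "\<theta> \<in> (\<lambda>\<phi>. join \<phi> 0) ` {\<phi> \<in> free_vecs S. f \<phi> = 0}"
        using U1(1)[OF \<theta>(1)] by blast
    next
      fix \<theta> assume "\<theta> \<in> (\<lambda>\<phi>. join \<phi> 0) ` {\<phi> \<in> free_vecs S. f \<phi> = 0}"
      then show "\<theta> \<in> {\<theta> \<in> {\<theta> \<in> free_vecs ?U. h \<theta> = 0}. \<theta> \<circ> odd_idx = 0}"
        using U2[OF _ submodD(1)[OF submod_free_vecs]] by (auto simp: h_def z)
    qed
    show "linear_on {\<phi> \<in> free_vecs S. f \<phi> = 0} (\<lambda>\<phi>. join \<phi> 0)"
      using join_add[of _ _ 0 0] join_scal[of _ _ 0] by (auto simp: linear_on_def)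
    show "linear_on {\<theta> \<in> free_vecs ?U. h \<theta> = 0} (\<lambda>\<theta>. \<theta> \<circ> odd_idx)"
      by (auto simp: linear_on_def fun_arith)
  qed (auto simp: join_zero_iff fS)
  ultimately show ?case
    using h S(1) T(1) by (intro has_free_res_SucI[of ?U h]) auto
qed

text \<open>An isomorphic copy of \<open>K\<close> is the middle term of an exact sequence with sub
  \<open>K\<close> and quotient zero, so this is a degenerate horseshoe.\<close>

lemma has_free_res_image:
  fixes K :: "('j \<times> nat \<Rightarrow> 'p) set" and i :: "('j \<times> nat \<Rightarrow> 'p) \<Rightarrow> 'j \<times> nat \<Rightarrow> 'p"
  assumes "has_free_res n K" "linear_on K i" "\<And>\<phi>. \<phi> \<in> K \<Longrightarrow> i \<phi> = 0 \<Longrightarrow> \<phi> = 0"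
  shows "has_free_res n (i ` K)"
proof (rule horseshoe[of n K "\<lambda>_. 0" _ i])
  have "submod (i ` K)"
    by (rule submod_image[OF has_free_res_submod]) fact+
  then have "(\<lambda>_. 0) ` i ` K = {0}"
    using submodD(1) by blast
  then show "has_free_res n ((\<lambda>_. 0) ` i ` K)"
    using has_free_res_zero by metis
qed (use assms submod_image[OF has_free_res_submod] in \<open>auto simp: linear_on_def\<close>)

text \<open>The free cover of \<open>K\<close> followed by \<open>p\<close> covers the quotient. The
  kernel of the composite is an extension of the kernel of \<open>p\<close>, a copy of
  \<open>L\<close>, by the kernel of the cover; both have resolutions with \<open>n\<close> terms,
  so the horseshoe finishes without any comparison map or mapping cone.\<close>

lemma has_free_res_quotient:
  fixes K L :: "('j \<times> nat \<Rightarrow> 'p) set" and p :: "('j \<times> nat \<Rightarrow> 'p) \<Rightarrow> 'j \<times> nat \<Rightarrow> 'p"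
  assumes "has_free_res n L" "has_free_res (Suc n) K" "linear_on K p" "linear_on L i"
    and "\<And>\<phi>. \<phi> \<in> L \<Longrightarrow> i \<phi> = 0 \<Longrightarrow> \<phi> = 0" "{\<phi> \<in> K. p \<phi> = 0} = i ` L"
  shows "has_free_res (Suc n) (p ` K)"
proof -
  obtain S :: "('j \<times> nat) set" and f where S: "finite S" "linear_on (free_vecs S) f" "f ` free_vecs S = K"
    and fS: "has_free_res n {\<phi> \<in> free_vecs S. f \<phi> = 0}"
    using assms(2) by (rule has_free_res_SucE)
  have K: "submod K" using assms(2) by (rule has_free_res_submod)
  have pf: "linear_on (free_vecs S) (\<lambda>\<phi>. p (f \<phi>))"
    using linear_on_compose[OF S(2) _ assms(3)] S(3) by auto
  have "has_free_res n {\<phi> \<in> free_vecs S. p (f \<phi>) = 0}"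
  proof (rule horseshoe[of n "{\<phi> \<in> free_vecs S. f \<phi> = 0}" f _ "\<lambda>\<phi>. \<phi>"])
    have "f ` {\<phi> \<in> free_vecs S. p (f \<phi>) = 0} = {\<phi> \<in> K. p \<phi> = 0}"
      using S(3) by auto
    then show "has_free_res n (f ` {\<phi> \<in> free_vecs S. p (f \<phi>) = 0})"
      using has_free_res_image[OF assms(1,4,5)] assms(6) by simp
    show "submod {\<phi> \<in> free_vecs S. p (f \<phi>) = 0}"
      by (rule submod_kernel[OF submod_free_vecs pf])
    show "linear_on {\<phi> \<in> free_vecs S. p (f \<phi>) = 0} f"
      by (rule linear_on_subset[OF S(2)]) auto
  qed (use fS linear_on_zero[OF K assms(3)] in \<open>auto simp: linear_on_def\<close>)
  then show ?thesis
    using S pf by (intro has_free_res_SucI[of S "\<lambda>\<phi>. p (f \<phi>)"]) (auto simp flip: S(3))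
qed

definition dsum :: "('j \<times> nat \<Rightarrow> 'p) set \<Rightarrow> ('j \<times> nat \<Rightarrow> 'p) set \<Rightarrow> ('j \<times> nat \<Rightarrow> 'p) set" where
  "dsum K L = {\<theta>. \<theta> \<circ> even_idx \<in> K \<and> \<theta> \<circ> odd_idx \<in> L}"

lemma has_free_res_dsum:
  assumes "has_free_res n K" "has_free_res n L"
  shows "has_free_res n (dsum K L)"
proof (rule horseshoe[of n K "\<lambda>\<theta>. \<theta> \<circ> odd_idx" _ "\<lambda>\<phi>. join \<phi> 0"])
  have K: "submod K" and L: "submod L" using assms by (auto intro: has_free_res_submod)
  show "submod (dsum K L)"
    using submodD[OF K] submodD[OF L] by (auto simp: submod_def dsum_def add_comp scal_comp zero_comp)
  have "L \<subseteq> (\<lambda>\<theta>. \<theta> \<circ> odd_idx) ` dsum K L"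
    using submodD(1)[OF K] by (force simp: dsum_def image_iff intro!: exI[of _ "join 0 _"])
  then have "(\<lambda>\<theta>. \<theta> \<circ> odd_idx) ` dsum K L = L"
    by (auto simp: dsum_def)
  then show "has_free_res n ((\<lambda>\<theta>. \<theta> \<circ> odd_idx) ` dsum K L)"
    using assms(2) by simp
  show "linear_on K (\<lambda>\<phi>. join \<phi> 0)"
    using join_add[of _ _ 0 0] join_scal[of _ _ 0] by (auto simp: linear_on_def)
  show "{\<theta> \<in> dsum K L. \<theta> \<circ> odd_idx = 0} = (\<lambda>\<phi>. join \<phi> 0) ` K"
    using submodD(1)[OF L] by (auto simp: dsum_def image_iff join_eq_iff)
qed (use assms in \<open>auto simp: linear_on_def add_comp scal_comp join_zero_iff\<close>)

text \<open>An ideal is turned into a module of vectors by placing it in the single coordinate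
  \<open>q\<close>, so that \<open>has_free_res\<close> can speak about it.\<close>

definition ideal_vecs :: "'i \<Rightarrow> 'p set \<Rightarrow> ('i \<Rightarrow> 'p) set" where
  "ideal_vecs q I = {\<phi>. \<phi> q \<in> I \<and> (\<forall>q'. q' \<noteq> q \<longrightarrow> \<phi> q' = 0)}"

lemma ideal_vecs_eq: "ideal_vecs q I = (\<lambda>a. scal a (unit_vec q)) ` I"
proof (intro equalityI subsetI)
  fix \<phi> assume "\<phi> \<in> ideal_vecs q I"
  then show "\<phi> \<in> (\<lambda>a. scal a (unit_vec q)) ` I"
    by (intro image_eqI[of _ _ "\<phi> q"]) (auto simp: ideal_vecs_def unit_vec_def fun_arith)
qed (auto simp: ideal_vecs_def unit_vec_def scal_apply)

lemma has_free_res_ideal_vecs_ring: "has_free_res (Suc n) (ideal_vecs q A)"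
proof -
  have "free_vecs {q} = ideal_vecs q A"
    unfolding free_vecs_def ideal_vecs_def using zero_A by (metis singleton_iff)
  moreover have "{\<phi> \<in> free_vecs {q}. \<phi> = 0} = {0}"
    using submodD(1)[OF submod_free_vecs] by blast
  ultimately show ?thesis
    using has_free_res_zero[of n] by (intro has_free_res_SucI[of "{q}" "\<lambda>\<phi>. \<phi>"]) (auto simp: linear_on_def)
qed

text \<open>
  The sum \<open>J + x L\<close> is the cokernel of \<open>J \<rightarrow> J \<oplus> L\<close>, \<open>b \<mapsto> (- x b, b)\<close>.
\<close>

lemma has_free_res_ideal_sum:
  assumes J: "has_free_res n (ideal_vecs q J)" and L: "has_free_res (Suc n) (ideal_vecs q L)" and x: "x \<in> A"
    and "J \<subseteq> L" "L \<subseteq> A" "\<And>a. a \<in> A \<Longrightarrow> x * a \<in> J \<Longrightarrow> a \<in> J"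
  shows "has_free_res (Suc n) (ideal_vecs q {a + x * b | a b. a \<in> J \<and> b \<in> L})"
proof -
  let ?J = "ideal_vecs q J" and ?L = "ideal_vecs q L"
  let ?I = "{a + x * b | a b. a \<in> J \<and> b \<in> L}"
  let ?p = "\<lambda>\<theta>. (\<theta> \<circ> even_idx) + scal x (\<theta> \<circ> odd_idx)" and ?i = "\<lambda>\<phi>. join (scal (- x) \<phi>) \<phi>"
  have sJ: "submod ?J" using J by (rule has_free_res_submod)
  have "has_free_res (Suc n) (?p ` dsum ?J ?L)"
  proof (rule has_free_res_quotient[OF J has_free_res_dsum[OF has_free_res_Suc[OF J] L], of ?p ?i])
    show "{\<phi> \<in> dsum ?J ?L. ?p \<phi> = 0} = ?i ` ?J"
    proof (intro equalityI subsetI)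
      fix \<theta> assume \<theta>: "\<theta> \<in> {\<phi> \<in> dsum ?J ?L. ?p \<phi> = 0}"
      then have eq: "\<theta> \<circ> even_idx = scal (- x) (\<theta> \<circ> odd_idx)"
        by (auto simp: fun_arith add_eq_0_iff2 scal_apply)
      \<comment> \<open>For a pair (a, b) in the kernel, a = - x b, so x b lies in J. The last
        hypothesis, that x is a nonzerodivisor modulo J, then puts b in J.\<close>
      have "(- 1) * (\<theta> \<circ> even_idx) q \<in> J"
        using \<theta> submodD(3)[OF sJ, of "- 1" "\<theta> \<circ> even_idx"] by (auto simp: fun_arith dsum_def ideal_vecs_def)
      then have "x * (\<theta> \<circ> odd_idx) q \<in> J"
        using eq by (simp add: scal_apply)
      then have "(\<theta> \<circ> odd_idx) q \<in> J"
        using assms(5,6) \<theta> by (auto simp: dsum_def ideal_vecs_def)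
      then have "\<theta> \<circ> odd_idx \<in> ?J"
        using \<theta> by (auto simp: dsum_def ideal_vecs_def)
      moreover have "\<theta> = ?i (\<theta> \<circ> odd_idx)"
        by (rule join_eqI) (use eq in auto)
      ultimately show "\<theta> \<in> ?i ` ?J" by blast
    next
      fix \<theta> assume "\<theta> \<in> ?i ` ?J"
      then obtain \<phi> where "\<phi> \<in> ?J" "\<theta> = ?i \<phi>" by blast
      then show "\<theta> \<in> {\<phi> \<in> dsum ?J ?L. ?p \<phi> = 0}"
        using submodD(3)[OF sJ, of "- x" \<phi>] x assms(4)
        by (auto simp: scal_apply dsum_def ideal_vecs_def) (auto simp: fun_arith)
    qed
    show "linear_on (dsum ?J ?L) ?p"
      by (auto simp: linear_on_def add_comp scal_comp scal_add ac_simps)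
    show "linear_on ?J ?i"
      by (auto simp: linear_on_def join_add[symmetric] join_scal[symmetric] scal_add mult.commute)
  qed (auto simp: join_zero_iff)
  moreover have "?p ` dsum ?J ?L = ideal_vecs q ?I"
  proof (intro equalityI subsetI)
    fix \<phi> assume "\<phi> \<in> ideal_vecs q ?I"
    then obtain a b where ab: "a \<in> J" "b \<in> L" "\<phi> = scal (a + x * b) (unit_vec q)"
      by (auto simp: ideal_vecs_eq)
    then have "\<phi> = ?p (join (scal a (unit_vec q)) (scal b (unit_vec q)))"
      by (simp add: scal_add_left)
    moreover have "join (scal a (unit_vec q)) (scal b (unit_vec q)) \<in> dsum ?J ?L"
      using ab by (auto simp: scal_comp dsum_def ideal_vecs_eq)
    ultimately show "\<phi> \<in> ?p ` dsum ?J ?L" by blast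
  qed (auto simp: fun_arith dsum_def ideal_vecs_def, blast)
  ultimately show ?thesis by simp
qed

end


section \<open>Resolutions of quotient modules\<close>

definition ring_of :: "'p::comm_ring_1 set \<Rightarrow> 'p ring" where
  "ring_of A = \<lparr>carrier = A, mult = (*), one = 1, zero = 0, add = (+)\<rparr>"

lemma ring_of_simps [simp]:
  "carrier (ring_of A) = A" "mult (ring_of A) = (*)" "one (ring_of A) = 1"
  "zero (ring_of A) = 0" "add (ring_of A) = (+)"
  by (simp_all add: ring_of_def)

lemma finsum_free_apply:
  assumes "cring R" "finite T" "g \<in> T \<rightarrow> carrier (free_module R B)"
  shows "finsum (free_module R B) g T q = finsum R (\<lambda>p. g p q) T"
proof -
  interpret R: cring R by fact
  interpret F: Module.module R "free_module R B" by (rule module_free_module) fact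
  show ?thesis
    using assms(2,3)
  proof (induction rule: finite_induct)
    case (insert t T)
    then have "g t q \<in> carrier R" "(\<lambda>p. g p q) \<in> T \<rightarrow> carrier R" for q
      by (auto simp: free_module_def image_subset_iff Pi_iff)
    moreover have "finsum (free_module R B) g (insert t T) = g t \<oplus>\<^bsub>free_module R B\<^esub> finsum (free_module R B) g T"
      using insert by (intro F.finsum_insert) auto
    ultimately show ?case
      using insert by (simp add: R.finsum_insert) (simp add: free_module_def)
  qed (simp, simp add: free_module_def)
qed

lemma lincomb_unit_vectors:
  assumes "cring R" and \<phi>: "\<phi> \<in> carrier (free_module R B)"
  shows "lincomb R (free_module R B) (\<lambda>p q. if q = p then \<one>\<^bsub>R\<^esub> else \<zero>\<^bsub>R\<^esub>) \<phi> = \<phi>"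
proof
  fix q
  interpret R: cring R by fact
  let ?F = "free_module R B"
  interpret F: Module.module R ?F by (rule module_free_module) fact
  let ?e = "\<lambda>p q. if q = p then \<one>\<^bsub>R\<^esub> else \<zero>\<^bsub>R\<^esub>"
  let ?T = "{p. \<phi> p \<noteq> \<zero>\<^bsub>R\<^esub>}"
  have \<phi>': "\<phi> p \<in> carrier R" "?T \<subseteq> B" "finite ?T" for p
    using \<phi> by (auto simp: free_module_def)
  have e: "?e p \<in> carrier ?F" if "p \<in> B" for p
    using lincomb_unit(1)[OF F.module_axioms, of ?e B p] that lincomb_unit(1)[OF F.module_axioms, of "\<lambda>_. \<zero>\<^bsub>?F\<^esub>" B p] by auto
  have "lincomb R ?F ?e \<phi> q = finsum R (\<lambda>p. (\<phi> p \<odot>\<^bsub>?F\<^esub> ?e p) q) ?T"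
    unfolding lincomb_def
    by (rule finsum_free_apply[OF assms(1) \<phi>'(3)]) (use \<phi>' e in blast)
  also have "\<dots> = finsum R (\<lambda>p. if q = p then \<phi> p else \<zero>\<^bsub>R\<^esub>) ?T"
    by (rule R.finsum_cong') (use \<phi>' in \<open>auto simp: free_module_def\<close>)
  also have "\<dots> = \<phi> q"
  proof (cases "q \<in> ?T")
    case True
    then show ?thesis
      using \<phi>' by (simp add: R.add.finprod_singleton[of q ?T \<phi>])
  next
    case False
    have "finsum R (\<lambda>p. if q = p then \<phi> p else \<zero>\<^bsub>R\<^esub>) ?T = finsum R (\<lambda>p. \<zero>\<^bsub>R\<^esub>) ?T"
      by (rule R.finsum_cong') (use False in auto)
    then show ?thesis using False by simp
  qed
  finally show "lincomb R ?F ?e \<phi> q = \<phi> q" .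
qed

text \<open>An element is the combination of unit vectors with its own values as coefficients, so
  preimages of the images of the unit vectors determine a lift.\<close>

lemma projective_free_module:
  fixes R :: "('a, 'c) ring_scheme" and B :: "'b set"
  assumes "cring R"
  shows "projective_module R (free_module R B)"
  unfolding projective_module_def
proof (intro conjI allI impI)
  let ?F = "free_module R B"
  show F: "Module.module R ?F"
    by (rule module_free_module) fact
  let ?e = "\<lambda>p q. if q = p then \<one>\<^bsub>R\<^esub> else \<zero>\<^bsub>R\<^esub>"
  \<comment> \<open>Membership of the unit vectors comes out of \<open>lincomb_unit\<close> for any
    family; the zero family only instantiates it.\<close>
  have e: "?e \<in> B \<rightarrow> carrier ?F"
    using lincomb_unit(1)[OF F, of "\<lambda>_. \<zero>\<^bsub>?F\<^esub>" B] Module.module.axioms(2)[OF F]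
    by (auto simp: abelian_group_def abelian_monoid.zero_closed)
  fix M :: "('a, ('b \<Rightarrow> 'a) \<Rightarrow> 'a) module" and N :: "('a, 'b \<Rightarrow> 'a) module" and g f
  assume "Module.module R M \<and> Module.module R N \<and> g \<in> mod_hom R M N \<and>
    g ` carrier M = carrier N \<and> f \<in> mod_hom R ?F N"
  then have M: "Module.module R M" and N: "Module.module R N" and g: "g \<in> mod_hom R M N"
    "g ` carrier M = carrier N" and f: "f \<in> mod_hom R ?F N"
    by auto
  interpret N: Module.module R N by (rule N)
  have "\<forall>p\<in>B. \<exists>m\<in>carrier M. g m = f (?e p)"
  proof
    fix p assume "p \<in> B"
    then have "?e p \<in> carrier ?F"
      using e by blast
    then have "f (?e p) \<in> g ` carrier M"
      using f unfolding g(2) mod_hom_def by blast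
    then show "\<exists>m\<in>carrier M. g m = f (?e p)" by auto
  qed
  then obtain v where v: "\<And>p. p \<in> B \<Longrightarrow> v p \<in> carrier M" "\<And>p. p \<in> B \<Longrightarrow> g (v p) = f (?e p)"
    by metis
  have "g (lincomb R M v \<phi>) = f \<phi>" if \<phi>: "\<phi> \<in> carrier ?F" for \<phi>
  proof -
    have "g (lincomb R M v \<phi>) = lincomb R N (\<lambda>p. g (v p)) \<phi>"
      by (rule lincomb_apply_hom[OF M N g(1) _ \<phi>]) (use v in auto)
    also have "\<dots> = lincomb R N (\<lambda>p. f (?e p)) \<phi>"
      unfolding lincomb_def
    proof (rule N.finsum_cong')
      have "f (?e p) \<in> carrier N" if "p \<in> B" for p
        using f e that unfolding mod_hom_def by blast
      then have "\<phi> p \<odot>\<^bsub>N\<^esub> f (?e p) \<in> carrier N" if "\<phi> p \<noteq> \<zero>\<^bsub>R\<^esub>" for p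
        using \<phi> that by (intro N.smult_closed) (auto simp: free_module_def)
      then show "(\<lambda>p. \<phi> p \<odot>\<^bsub>N\<^esub> f (?e p)) \<in> {p. \<phi> p \<noteq> \<zero>\<^bsub>R\<^esub>} \<rightarrow> carrier N"
        by blast
    next
      fix p assume "p \<in> {p. \<phi> p \<noteq> \<zero>\<^bsub>R\<^esub>}"
      then have "p \<in> B" using \<phi> by (auto simp: free_module_def)
      then show "\<phi> p \<odot>\<^bsub>N\<^esub> g (v p) = \<phi> p \<odot>\<^bsub>N\<^esub> f (?e p)" by (simp add: v(2))
    qed simp
    also have "\<dots> = f (lincomb R ?F ?e \<phi>)"
      using lincomb_apply_hom[OF F N f e \<phi>] by simp
    finally show ?thesis
      using lincomb_unit_vectors[OF assms \<phi>] by simp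
  qed
  moreover have "lincomb R M v \<in> mod_hom R ?F M"
    by (rule lincomb_hom[OF M]) (use v in auto)
  ultimately show "\<exists>h\<in>mod_hom R ?F M. \<forall>x\<in>carrier ?F. g (h x) = f x"
    by blast
qed

context coeff_ring
begin

lemma cring_ring_of: "cring (ring_of A)"
proof (rule cringI)
  show "abelian_group (ring_of A)"
    by (rule abelian_groupI) (auto simp: ac_simps intro: bexI[of _ "- _"])
  show "Group.comm_monoid (ring_of A)"
    by (rule comm_monoidI) (auto simp: ac_simps)
qed (auto simp: distrib_right)

lemma carrier_free_module_ring_of:
  fixes S :: "'i set"
  assumes "finite S"
  shows "carrier (free_module (ring_of A) S) = free_vecs S"
proof -
  have "finite {p. \<phi> p \<noteq> 0}" if "\<forall>p. p \<notin> S \<longrightarrow> \<phi> p = 0" for \<phi> :: "'i \<Rightarrow> 'p"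
    by (rule finite_subset[OF _ assms]) (use that in auto)
  then show ?thesis
    by (auto simp: free_module_def free_vecs_def)
qed

lemma linear_on_mod_hom:
  assumes "finite S" "finite T" "linear_on (free_vecs S) f" "f ` free_vecs S \<subseteq> free_vecs T"
  shows "f \<in> mod_hom (ring_of A) (free_module (ring_of A) S) (free_module (ring_of A) T)"
proof -
  have ops: "add (free_module (ring_of A) S) = (+)" "smult (free_module (ring_of A) S) = scal"
    "add (free_module (ring_of A) T) = (+)" "smult (free_module (ring_of A) T) = scal" 
    for S :: "'i set" and T :: "'l set"
    by (simp_all add: free_module_def fun_arith)
  show ?thesis
    using assms unfolding mod_hom_def ops carrier_free_module_ring_of[OF assms(1)] carrier_free_module_ring_of[OF assms(2)]
    by (auto simp: linear_on_def)
qed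

text \<open>The recursion is unrolled into sequences, \<open>case_nat\<close> prepending the new
  cover. Here \<open>d i\<close> starts at the i-th free module, whereas in
  \<open>projective_resolution\<close> it starts at the module with index \<open>Suc i\<close>;
  prepending one more module later absorbs this shift.\<close>

lemma has_free_res_resolution:
  fixes K :: "('j \<times> nat \<Rightarrow> 'p) set"
  assumes "has_free_res n K"
  shows "\<exists>(S :: nat \<Rightarrow> ('j \<times> nat) set) d. (\<forall>i. finite (S i)) \<and> (\<forall>i. linear_on (free_vecs (S i)) (d i)) \<and>
    d 0 ` free_vecs (S 0) = K \<and> (\<forall>i. d (Suc i) ` free_vecs (S (Suc i)) = {\<phi> \<in> free_vecs (S i). d i \<phi> = 0}) \<and>
    (\<forall>i\<ge>n. S i = {})"
  using assms
proof (induction n arbitrary: K)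
  case 0
  have "free_vecs {} = {0}" by (auto simp: free_vecs_def fun_arith)
  with 0 show ?case
    by (intro exI[of _ "\<lambda>_. {}"] exI[of _ "\<lambda>_ _. 0"]) (auto simp: linear_on_def)
next
  case (Suc n)
  obtain T :: "('j \<times> nat) set" and f where T: "finite T" "linear_on (free_vecs T) f" "f ` free_vecs T = K"
    and K: "has_free_res n {\<phi> \<in> free_vecs T. f \<phi> = 0}"
    using Suc.prems by (rule has_free_res_SucE)
  obtain S :: "nat \<Rightarrow> ('j \<times> nat) set" and d where "\<forall>i. finite (S i)" "\<forall>i. linear_on (free_vecs (S i)) (d i)"
    "d 0 ` free_vecs (S 0) = {\<phi> \<in> free_vecs T. f \<phi> = 0}"
    "\<forall>i. d (Suc i) ` free_vecs (S (Suc i)) = {\<phi> \<in> free_vecs (S i). d i \<phi> = 0}" "\<forall>i\<ge>n. S i = {}"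
    using Suc.IH[OF K] by (elim exE conjE) (rule that)
  then show ?case
    using T by (intro exI[of _ "case_nat T S"] exI[of _ "case_nat f d"])
      (auto split: nat.splits simp: Suc_le_eq)
qed

text \<open>The elements of the quotient module are cosets, so \<open>projdim\<close> asks for
  resolving modules of functions on pairs of a coset and a number; this dictates the type of the
  index \<open>q\<close>.\<close>

lemma projdim_le:
  fixes I :: "'p set" and q :: "'p set \<times> nat"
  assumes I: "ideal I (ring_of A)" and res: "has_free_res n (ideal_vecs q I)"
  shows "projdim (ring_of A) (quot_module (ring_of A) I) \<le> enat n"
proof -
  let ?R = "ring_of A" and ?M = "quot_module (ring_of A) I"
  interpret R: cring ?R by (rule cring_ring_of)
  interpret I: ideal I ?R by fact
  interpret h: ring_hom_ring ?R "?R Quot I" "(+>\<^bsub>?R\<^esub>) I" by (rule I.rcos_ring_hom_ring)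
  obtain S :: "nat \<Rightarrow> ('p set \<times> nat) set" and d where *: "\<forall>i. finite (S i)" "\<forall>i. linear_on (free_vecs (S i)) (d i)"
    "d 0 ` free_vecs (S 0) = ideal_vecs q I"
    "\<forall>i. d (Suc i) ` free_vecs (S (Suc i)) = {\<phi> \<in> free_vecs (S i). d i \<phi> = 0}" "\<forall>i\<ge>n. S i = {}"
    using has_free_res_resolution[OF res] by (elim exE conjE) (rule that)
  note S = *(1,2)[rule_format] *(3) *(4,5)[rule_format]
  \<comment> \<open>The free module on \<open>{q}\<close> is the ring itself, mapped onto the
    quotient with kernel the copy of \<open>I\<close>. Prepending it turns the number
    \<open>n\<close> of free modules in the resolution of \<open>I\<close> into the length of the
    resolution of the quotient.\<close>
  define T where "T = case_nat {q} S"
  define \<epsilon> where "\<epsilon> \<phi> = I +>\<^bsub>?R\<^esub> \<phi> q" for \<phi> :: "'p set \<times> nat \<Rightarrow> 'p"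
  define P where "P i = free_module ?R (T i)" for i
  have T: "finite (T i)" for i
    using S(1) by (auto simp: T_def split: nat.split)
  have P: "carrier (P i) = free_vecs (T i)" "\<zero>\<^bsub>P i\<^esub> = 0" for i
    using carrier_free_module_ring_of[OF T] by (simp_all add: P_def) (simp add: free_module_def fun_arith)
  have qA: "\<phi> q \<in> A" if "\<phi> \<in> free_vecs {q}" for \<phi>
    using that by (auto simp: free_vecs_def)
  have IA: "I \<subseteq> A"
    using I.a_subset by simp
  have ideal_free_vecs: "ideal_vecs q I \<subseteq> free_vecs {q}"
  proof
    fix \<phi> assume \<phi>: "\<phi> \<in> ideal_vecs q I"
    have "\<phi> q' \<in> A" for q'
      using \<phi> IA by (cases "q' = q") (auto simp: ideal_vecs_def)
    then show "\<phi> \<in> free_vecs {q}"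
      using \<phi> by (auto simp: ideal_vecs_def free_vecs_def)
  qed
  have ker: "{\<phi> \<in> free_vecs {q}. \<epsilon> \<phi> = \<zero>\<^bsub>?M\<^esub>} = ideal_vecs q I"
  proof -
    have "\<epsilon> \<phi> = I \<longleftrightarrow> \<phi> q \<in> I" if "\<phi> \<in> free_vecs {q}" for \<phi>
      using I.rcos_const_imp_mem[of "\<phi> q"] R.a_rcos_zero[OF I, of "\<phi> q"] qA[OF that]
      unfolding \<epsilon>_def ring_of_simps by blast
    moreover have "\<zero>\<^bsub>?M\<^esub> = I"
      by (simp add: quot_module_def FactRing_def)
    ultimately have "{\<phi> \<in> free_vecs {q}. \<epsilon> \<phi> = \<zero>\<^bsub>?M\<^esub>} = {\<phi> \<in> free_vecs {q}. \<phi> q \<in> I}"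
      by auto
    also have "\<dots> = ideal_vecs q I"
      using ideal_free_vecs by (auto simp: ideal_vecs_def free_vecs_def)
    finally show ?thesis .
  qed
  have "projective_resolution ?R ?M P d \<epsilon>"
    unfolding projective_resolution_def
  proof (intro conjI allI)
    show "projective_module ?R (P i)" for i
      unfolding P_def by (rule projective_free_module[OF cring_ring_of])
    have "d i ` free_vecs (S i) \<subseteq> free_vecs (T i)" for i
    proof (cases i)
      case 0
      then show ?thesis
        using S(3) ideal_free_vecs by (simp add: T_def)
    qed (use S(4) in \<open>auto simp: T_def\<close>)
    then show "d i \<in> mod_hom ?R (P (Suc i)) (P i)" for i
      using linear_on_mod_hom[OF T T, of "Suc i" "d i" i] S(2) by (simp add: P_def) (simp add: T_def)
    show "\<epsilon> \<in> mod_hom ?R (P 0) ?M"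
    proof -
      have ops: "\<phi> \<oplus>\<^bsub>P 0\<^esub> \<psi> = \<phi> + \<psi>" "r \<odot>\<^bsub>P 0\<^esub> \<phi> = scal r \<phi>" for r \<phi> \<psi>
        by (simp_all add: P_def free_module_def fun_arith)
      have "\<epsilon> (\<phi> + \<psi>) = \<epsilon> \<phi> \<oplus>\<^bsub>?R Quot I\<^esub> \<epsilon> \<psi>" "\<epsilon> \<phi> \<in> carrier (?R Quot I)"
        if "\<phi> \<in> free_vecs {q}" "\<psi> \<in> free_vecs {q}" for \<phi> \<psi>
        using h.hom_add[of "\<phi> q" "\<psi> q"] h.hom_closed[of "\<phi> q"] qA that
        by (simp_all add: \<epsilon>_def plus_fun_apply)
      moreover have "\<epsilon> (scal r \<phi>) = (I +>\<^bsub>?R\<^esub> r) \<otimes>\<^bsub>?R Quot I\<^esub> \<epsilon> \<phi>"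
        if "\<phi> \<in> free_vecs {q}" "r \<in> A" for \<phi> r
        using h.hom_mult[of r "\<phi> q"] qA that by (simp add: \<epsilon>_def scal_apply)
      ultimately show ?thesis
        unfolding mod_hom_def P ops by (simp add: T_def quot_module_def)
    qed
    show "\<epsilon> ` carrier (P 0) = carrier ?M"
    proof -
      have "\<exists>\<phi>\<in>free_vecs {q}. \<epsilon> \<phi> = X" if X: "X \<in> carrier (?R Quot I)" for X
      proof -
        obtain a where "a \<in> A" "X = I +>\<^bsub>?R\<^esub> a"
          using X by (auto simp: FactRing_def A_RCOSETS_def')
        then show ?thesis
          using submodD(3)[OF submod_free_vecs _ unit_vec_free_vecs, of a q "{q}"]
          by (intro bexI[of _ "scal a (unit_vec q)"]) (simp_all add: \<epsilon>_def scal_apply unit_vec_def)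
      qed
      moreover have "\<epsilon> \<phi> \<in> carrier (?R Quot I)" if "\<phi> \<in> free_vecs {q}" for \<phi>
        using h.hom_closed[of "\<phi> q"] qA[OF that] by (simp add: \<epsilon>_def)
      ultimately show ?thesis
        unfolding P by (auto simp: T_def quot_module_def image_iff)
    qed
    show "d 0 ` carrier (P 1) = {x \<in> carrier (P 0). \<epsilon> x = \<zero>\<^bsub>?M\<^esub>}"
      using ker S(3) unfolding P by (simp add: T_def)
    show "d (Suc i) ` carrier (P (Suc (Suc i))) = {x \<in> carrier (P (Suc i)). d i x = \<zero>\<^bsub>P i\<^esub>}" for i
      using S(4)[of i] unfolding P by (simp add: T_def)
  qed
  moreover have "carrier (P i) = {\<zero>\<^bsub>P i\<^esub>}" if "i > n" for i
    unfolding P using that S(5) by (auto simp: T_def free_vecs_def fun_arith split: nat.splits)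
  ultimately show ?thesis
    unfolding projdim_def by (intro Inf_lower) blast
qed

end

declare plus_fun_apply [simp] zero_fun_apply [simp] split_paired_All [simp] split_paired_Ex [simp]


declare One_nat_def [simp del]

section \<open>Polynomials and monomial ideals\<close>

abbreviation (input) keys where "keys \<equiv> Poly_Mapping.keys"
abbreviation (input) lookup where "lookup \<equiv> Poly_Mapping.lookup"
abbreviation (input) X :: "'v \<Rightarrow> 'v \<Rightarrow>\<^sub>0 nat" where "X v \<equiv> Poly_Mapping.single v 1"

definition polys :: "'v set \<Rightarrow> (('v \<Rightarrow>\<^sub>0 nat) \<Rightarrow>\<^sub>0 'k::comm_ring_1) set" where
  "polys V = {p. \<forall>m\<in>keys p. keys m \<subseteq> V}"

lemma poly_ring_eq: "poly_ring V = ring_of (polys V)"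
  by (simp add: poly_ring_def ring_of_def polys_def)

lemma keys_add_nat: "keys (a + b :: 'v \<Rightarrow>\<^sub>0 nat) = keys a \<union> keys b"
  by (auto simp: in_keys_iff lookup_add)

interpretation polys: coeff_ring "polys V :: (('v \<Rightarrow>\<^sub>0 nat) \<Rightarrow>\<^sub>0 'k::comm_ring_1) set"
proof
  fix p q :: "('v \<Rightarrow>\<^sub>0 nat) \<Rightarrow>\<^sub>0 'k"
  show "0 \<in> polys V" "1 \<in> polys V"
    by (auto simp: polys_def)
  assume p: "p \<in> polys V"
  then show "- p \<in> polys V"
    by (simp add: polys_def in_keys_iff)
  assume q: "q \<in> polys V"
  show "p + q \<in> polys V"
    using keys_add[of p q] p q by (auto simp: polys_def)
  show "p * q \<in> polys V"
    unfolding polys_def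
  proof safe
    fix m v assume "m \<in> keys (p * q)" and v: "v \<in> keys m"
    then obtain a b where "m = a + b" "a \<in> keys p" "b \<in> keys q"
      using keys_mult[of p q] by blast
    with v p q show "v \<in> V"
      by (auto simp: polys_def keys_add_nat)
  qed
qed

lemma lookup_var_mult_add:
  "lookup (var x * p) (m + X x) = lookup p m"
proof -
  have "lookup (var x * p) (m + X x) = (\<Sum>l. lookup (var x) l * (\<Sum>q. lookup p q when m + X x = l + q))"
    by (simp add: lookup_mult)
  also have "\<dots> = (\<Sum>l. (\<Sum>q. lookup p q when m = q) when l = X x)"
    by (rule Sum_any.cong) (auto simp: var_def lookup_single when_def add.commute)
  finally show ?thesis by simp
qed

lemma mon_of_split:
  assumes "x \<in> keys m"
  obtains m' where "m = m' + X x"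
proof -
  have "m = (m - X x) + X x"
    by (rule poly_mapping_eqI) (use assms in \<open>auto simp: lookup_add lookup_minus lookup_single when_def in_keys_iff\<close>)
  then show ?thesis by (rule that)
qed

lemma keys_var_mult: "keys (var x * p) = (\<lambda>m. m + X x) ` keys p"
proof (intro equalityI subsetI)
  fix m assume m: "m \<in> keys (var x * p)"
  then have "x \<in> keys m"
    using keys_mult[of "var x" p] by (auto simp: var_def keys_add_nat split: if_splits)
  then obtain m' where "m = m' + X x" by (rule mon_of_split)
  moreover from this have "m' \<in> keys p"
    using m lookup_var_mult_add[of x p m'] by (simp add: in_keys_iff)
  ultimately show "m \<in> (\<lambda>m. m + X x) ` keys p"
    by blast
next
  fix m assume "m \<in> (\<lambda>m. m + X x) ` keys p"
  then obtain m' where m': "m = m' + X x" "m' \<in> keys p"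
    by blast
  then show "m \<in> keys (var x * p)"
    using lookup_var_mult_add[of x p m'] by (simp add: in_keys_iff)
qed

definition filter_mons :: "('m \<Rightarrow> bool) \<Rightarrow> ('m \<Rightarrow>\<^sub>0 'k::zero) \<Rightarrow> 'm \<Rightarrow>\<^sub>0 'k" where
  "filter_mons Q p = Poly_Mapping.mapp (\<lambda>m c. if Q m then c else 0) p"

lemma lookup_filter_mons: "lookup (filter_mons Q p) m = (if Q m then lookup p m else 0)"
  by (auto simp: filter_mons_def lookup_mapp when_def in_keys_iff)

lemma keys_filter_mons: "keys (filter_mons Q p) = {m \<in> keys p. Q m}"
  by (auto simp: in_keys_iff lookup_filter_mons split: if_splits)

lemma filter_mons_add: "filter_mons Q p + filter_mons (\<lambda>m. \<not> Q m) p = (p :: 'm \<Rightarrow>\<^sub>0 'k::comm_monoid_add)"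
  by (rule poly_mapping_eqI) (simp add: lookup_add lookup_filter_mons)

lemma var_mult_exists:
  assumes "\<And>m. m \<in> keys p \<Longrightarrow> x \<in> keys m"
  shows "\<exists>q. p = var x * q"
proof
  \<comment> \<open>Reading \<open>p\<close> along the injective shift of exponents by
    \<open>X x\<close> divides it by the variable.\<close>
  let ?q = "Poly_Mapping.map_key (\<lambda>m. m + X x) p"
  have q: "lookup ?q m = lookup p (m + X x)" for m
    by (simp add: map_key.rep_eq inj_def)
  show "p = var x * ?q"
  proof (rule poly_mapping_eqI)
    fix m
    show "lookup p m = lookup (var x * ?q) m"
    proof (cases "x \<in> keys m")
      case True
      then obtain m' where "m = m' + X x" by (rule mon_of_split)
      then show ?thesis using lookup_var_mult_add[of x ?q m'] q by simp
    next
      case False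
      then have "m \<notin> keys p" "m \<notin> keys (var x * ?q)"
        using assms by (auto simp: keys_var_mult keys_add_nat)
      then show ?thesis by (simp add: in_keys_iff)
    qed
  qed
qed

text \<open>The ideal generated by the squarefree monomials with supports in \<open>E\<close>,
  described by its elements: membership is decided monomial by monomial and looks only at supports.
  Singletons in \<open>E\<close> stand for variables, and the empty set gives the whole
  ring.\<close>

definition mono_ideal :: "'v set \<Rightarrow> 'v set set \<Rightarrow> (('v \<Rightarrow>\<^sub>0 nat) \<Rightarrow>\<^sub>0 'k::comm_ring_1) set" where
  "mono_ideal V E = {p \<in> polys V. \<forall>m\<in>keys p. \<exists>e\<in>E. e \<subseteq> keys m}"

lemma mono_ideal_subset: "mono_ideal V E \<subseteq> polys V"
  by (auto simp: mono_ideal_def)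

lemma zero_mono_ideal: "0 \<in> mono_ideal V E"
  by (simp add: mono_ideal_def)

lemma add_mono_ideal: "p \<in> mono_ideal V E \<Longrightarrow> q \<in> mono_ideal V E \<Longrightarrow> p + q \<in> mono_ideal V E"
  using keys_add[of p q] by (auto simp: mono_ideal_def)

lemma mult_mono_ideal: 
  assumes "p \<in> polys V" "q \<in> mono_ideal V E"
  shows "p * q \<in> mono_ideal V E"
proof -
  have "\<exists>e\<in>E. e \<subseteq> keys m" if m: "m \<in> keys (p * q)" for m
  proof -
    obtain a b where "m = a + b" "b \<in> keys q"
      using keys_mult[of p q] m by blast
    moreover from this obtain e where "e \<in> E" "e \<subseteq> keys b"
      using assms(2) by (auto simp: mono_ideal_def)
    ultimately show ?thesis
      by (intro bexI[of _ e]) (simp_all add: keys_add_nat le_supI2)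
  qed
  then show ?thesis
    using assms by (auto simp: mono_ideal_def)
qed

lemma ideal_ring_ofI:
  assumes "coeff_ring A" "I \<subseteq> A" "0 \<in> I" "\<And>a b. a \<in> I \<Longrightarrow> b \<in> I \<Longrightarrow> a + b \<in> I"
    and "\<And>a b. a \<in> A \<Longrightarrow> b \<in> I \<Longrightarrow> a * b \<in> I"
  shows "ideal I (ring_of A)"
proof -
  interpret coeff_ring A by fact
  interpret R: cring "ring_of A" by (rule cring_ring_of)
  have inv: "\<ominus>\<^bsub>ring_of A\<^esub> a = - a" if "a \<in> A" for a
    by (rule R.minus_equality) (use that in auto)
  have uminus: "- a \<in> I" if "a \<in> I" for a
    using assms(5)[of "- 1" a] that by simp
  have "a * x \<in> I" if "a \<in> I" "x \<in> A" for a x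
    using assms(5)[OF that(2,1)] by (simp add: mult.commute)
  then show ?thesis
  proof (intro idealI[OF R.ring_axioms])
    show "subgroup I (add_monoid (ring_of A))"
    proof (rule subgroup.intro)
      show "inv\<^bsub>add_monoid (ring_of A)\<^esub> a \<in> I" if "a \<in> I" for a
        using inv[unfolded a_inv_def] uminus[OF that] that assms(2) by (metis subsetD)
    qed (use assms in auto)
  qed (use assms in auto)
qed

lemma ideal_ring_ofD:
  assumes "ideal I (ring_of A)"
  shows "I \<subseteq> A" "0 \<in> I" "a \<in> I \<Longrightarrow> b \<in> I \<Longrightarrow> a + b \<in> I" "a \<in> A \<Longrightarrow> b \<in> I \<Longrightarrow> a * b \<in> I"
  using additive_subgroup.a_subset[OF ideal.axioms(1)[OF assms]]
    additive_subgroup.zero_closed[OF ideal.axioms(1)[OF assms]]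
    additive_subgroup.a_closed[OF ideal.axioms(1)[OF assms], of a b]
    ideal.I_l_closed[OF assms, of b a] by auto

lemma ideal_mono_ideal: "ideal (mono_ideal V E) (ring_of (polys V))"
  by (rule ideal_ring_ofI[OF polys.coeff_ring_axioms mono_ideal_subset zero_mono_ideal
        add_mono_ideal mult_mono_ideal])

lemma uminus_mono_ideal: "p \<in> mono_ideal V E \<Longrightarrow> - p \<in> mono_ideal V E"
  using mult_mono_ideal[of "- 1" V p E] by simp

lemma var_in_polys [simp]: "v \<in> V \<Longrightarrow> var v \<in> polys V"
  by (simp add: var_def polys_def)

lemma var_mult_polys_iff: "x \<in> V \<Longrightarrow> var x * q \<in> polys V \<longleftrightarrow> q \<in> polys V"
  by (auto simp: polys_def keys_var_mult keys_add_nat)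

lemma var_mult_mono_ideal_iff:
  assumes "x \<in> V"
  shows "var x * q \<in> mono_ideal V E \<longleftrightarrow> q \<in> polys V \<and> (\<forall>m\<in>keys q. \<exists>e\<in>E. e \<subseteq> insert x (keys m))"
  using assms by (auto simp: mono_ideal_def var_mult_polys_iff keys_var_mult keys_add_nat)

lemma filter_mons_polys: "p \<in> polys V \<Longrightarrow> filter_mons Q p \<in> polys V"
  by (auto simp: polys_def keys_filter_mons)

text \<open>The monomials of \<open>p\<close> in the ideal of \<open>E\<close> form
  \<open>a\<close>; all others contain \<open>x\<close> and are divided by it. The premise removes
  \<open>x\<close> from the support because it may be absent after the division.\<close>

lemma mono_ideal_split:
  assumes x: "x \<in> V" and p: "p \<in> polys V" and E: "\<And>m. m \<in> keys p \<Longrightarrow>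
      (\<exists>e\<in>E. e \<subseteq> keys m) \<or> x \<in> keys m \<and> (\<exists>e\<in>L. e \<subseteq> keys m - {x})"
  obtains a b where "p = a + var x * b" "a \<in> mono_ideal V E" "b \<in> mono_ideal V L"
proof -
  let ?Q = "\<lambda>m. \<exists>e\<in>E. e \<subseteq> keys m"
  let ?r = "filter_mons (\<lambda>m. \<not> ?Q m) p"
  have "\<exists>b. ?r = var x * b"
    by (rule var_mult_exists) (use E in \<open>auto simp: keys_filter_mons\<close>)
  then obtain b where b: "?r = var x * b"
    by blast
  have "\<exists>e\<in>L. e \<subseteq> keys m" if "m \<in> keys b" for m
  proof -
    have "m + X x \<in> keys ?r"
      using that unfolding b keys_var_mult by blast
    then have "\<exists>e\<in>L. e \<subseteq> keys (m + X x) - {x}"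
      using E[of "m + X x"] by (auto simp: keys_filter_mons)
    then show ?thesis
      by (auto simp: keys_add_nat)
  qed
  moreover have "b \<in> polys V"
    using filter_mons_polys[OF p, of "\<lambda>m. \<not> ?Q m"] unfolding b var_mult_polys_iff[OF x] .
  ultimately have L: "b \<in> mono_ideal V L"
    by (simp add: mono_ideal_def)
  have "p = filter_mons ?Q p + var x * b"
    using filter_mons_add[of ?Q p] b by simp
  moreover have "filter_mons ?Q p \<in> mono_ideal V E"
    using filter_mons_polys[OF p] by (auto simp: mono_ideal_def keys_filter_mons)
  ultimately show ?thesis using L by (rule that)
qed


section \<open>Depth of the polynomial ring\<close>

text \<open>The same complex for ring coefficients in class notation, where ordinary ring arithmetic
  applies; \<open>koszul_ring_of\<close> identifies the two.\<close>

primrec koszul_ring :: "'p::comm_ring_1 list \<Rightarrow> (bool list \<Rightarrow> 'p) \<Rightarrow> bool list \<Rightarrow> 'p" where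
  "koszul_ring [] \<phi> bs = 0"
| "koszul_ring (r # rs) \<phi> bs = (case bs of [] \<Rightarrow> 0 | b # bs \<Rightarrow>
     if b then r * \<phi> (False # bs) - koszul_ring rs (\<lambda>bs. \<phi> (True # bs)) bs
     else koszul_ring rs (\<lambda>bs. \<phi> (False # bs)) bs)"

lemma (in coeff_ring) koszul_ring_of: "koszul (ring_of A) (ring_module (ring_of A)) rs \<phi> = koszul_ring rs \<phi>"
proof (rule ext)
  fix bs
  interpret R: cring "ring_of A" by (rule cring_ring_of)
  have "\<ominus>\<^bsub>ring_of A\<^esub> 1 = - 1"
    by (rule R.minus_equality) auto
  then show "koszul (ring_of A) (ring_module (ring_of A)) rs \<phi> bs = koszul_ring rs \<phi> bs"
    by (induction rs arbitrary: \<phi> bs) (auto split: list.split)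
qed

lemma koszul_ring_minus: "koszul_ring rs (\<lambda>bs. \<phi> bs - \<psi> bs) bs = koszul_ring rs \<phi> bs - koszul_ring rs \<psi> bs"
  and koszul_ring_add: "koszul_ring rs (\<lambda>bs. \<phi> bs + \<psi> bs) bs = koszul_ring rs \<phi> bs + koszul_ring rs \<psi> bs"
  and koszul_ring_mult: "koszul_ring rs (\<lambda>bs. s * \<phi> bs) bs = s * koszul_ring rs \<phi> bs"
  and koszul_ring_uminus: "koszul_ring rs (\<lambda>bs. - \<phi> bs) bs = - koszul_ring rs \<phi> bs"
  by (induction rs arbitrary: \<phi> \<psi> bs) (auto split: list.split simp: algebra_simps)

definition ring_cochains :: "'p::comm_ring_1 set \<Rightarrow> nat \<Rightarrow> nat \<Rightarrow> (bool list \<Rightarrow> 'p) set" where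
  "ring_cochains A n j = {\<phi>. \<forall>bs. \<phi> bs \<in> A \<and> (\<phi> bs \<noteq> 0 \<longrightarrow> length bs = n \<and> count_list bs True < j)}"

text \<open>Together with \<open>koszul_ring_top_exists\<close> this computes the top cohomology of
  the Koszul complex on variables: the quotient of the ring by the ideal they generate.\<close>

lemma koszul_ring_top:
  assumes "set vs \<subseteq> V" "\<And>bs. \<phi> bs \<in> polys V"
  shows "koszul_ring (map var vs) \<phi> (replicate (length vs) True) \<in> mono_ideal V ((\<lambda>v. {v}) ` set vs)"
  using assms
proof (induction vs arbitrary: \<phi>)
  case (Cons v vs)
  let ?E = "(\<lambda>v. {v}) ` set (v # vs)"
  have "koszul_ring (map var vs) (\<lambda>bs. \<phi> (True # bs)) (replicate (length vs) True) \<in> mono_ideal V ?E"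
    using Cons.IH[of "\<lambda>bs. \<phi> (True # bs)"] Cons.prems by (auto simp: mono_ideal_def)
  moreover have "var v * \<phi> bs \<in> mono_ideal V ?E" for bs
    using Cons.prems by (simp add: var_mult_mono_ideal_iff)
  ultimately have "var v * \<phi> (False # replicate (length vs) True) +
      - koszul_ring (map var vs) (\<lambda>bs. \<phi> (True # bs)) (replicate (length vs) True) \<in> mono_ideal V ?E"
    by (intro add_mono_ideal uminus_mono_ideal)
  then show ?case by simp
qed (simp add: zero_mono_ideal)

lemma koszul_ring_top_exists:
  assumes "set vs \<subseteq> V" "p \<in> mono_ideal V ((\<lambda>v. {v}) ` set vs)"
  shows "\<exists>\<beta>\<in>ring_cochains (polys V) (length vs) (length vs).
    koszul_ring (map var vs) \<beta> (replicate (length vs) True) = p"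
  using assms
proof (induction vs arbitrary: p)
  case Nil
  then have "p = 0"
    by (auto simp: mono_ideal_def)
  then show ?case
    by (auto simp: ring_cochains_def intro!: exI[of _ "\<lambda>_. 0"])
next
  case (Cons v vs)
  let ?n = "length vs"
  obtain r q where rq: "p = r + var v * q" "r \<in> mono_ideal V ((\<lambda>v. {v}) ` set vs)" "q \<in> mono_ideal V {{}}"
  proof (rule mono_ideal_split[of v V p "(\<lambda>v. {v}) ` set vs" "{{}}"])
    show "v \<in> V" "p \<in> polys V" using Cons.prems by (auto simp: mono_ideal_def)
    show "(\<exists>e\<in>(\<lambda>v. {v}) ` set vs. e \<subseteq> keys m) \<or> v \<in> keys m \<and> (\<exists>e\<in>{{}}. e \<subseteq> keys m - {v})"
      if "m \<in> keys p" for m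
      using Cons.prems that by (auto simp: mono_ideal_def)
  qed
  obtain \<beta> where \<beta>: "\<beta> \<in> ring_cochains (polys V) ?n ?n" "koszul_ring (map var vs) \<beta> (replicate ?n True) = r"
    using Cons rq(2) by auto
  \<comment> \<open>The cofactor \<open>q\<close> meets \<open>v\<close>, and the sign on \<beta>
    cancels the one in the differential, so the top value becomes v q + r.\<close>
  define \<gamma> where "\<gamma> cs = (case cs of [] \<Rightarrow> 0 | b # bs \<Rightarrow>
    if b then - \<beta> bs else if bs = replicate ?n True then q else 0)" for cs
  have "count_list (replicate n True) True = n" for n
    by (induction n) auto
  then have "\<gamma> \<in> ring_cochains (polys V) (Suc ?n) (Suc ?n)"
    using \<beta>(1) rq(3) by (auto simp: ring_cochains_def \<gamma>_def mono_ideal_def split: list.split)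
  moreover have "koszul_ring (map var (v # vs)) \<gamma> (True # replicate ?n True) = p"
    using \<beta>(2) by (simp add: \<gamma>_def koszul_ring_uminus rq(1))
  ultimately show ?case by auto
qed

lemma count_True_eq_length: "count_list bs True = length bs \<longleftrightarrow> bs = replicate (length bs) True"
proof (induction bs)
  case (Cons b bs)
  then show ?case using count_le_length[of bs True] by (cases b) auto
qed simp

lemma koszul_ring_cochains:
  assumes vs: "set vs \<subseteq> V" and "\<phi> \<in> ring_cochains (polys V) (length vs) j"
  shows "koszul_ring (map var vs) \<phi> \<in> ring_cochains (polys V) (length vs) (Suc j)"
proof -
  let ?R = "ring_of (polys V)"
  interpret M: Module.module ?R "ring_module ?R"
    by (rule module_ring_module[OF polys.cring_ring_of])
  have "set (map var vs) \<subseteq> carrier ?R"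
    using vs by auto
  from M.koszul_cochains[OF this, of \<phi> j] show ?thesis
    using assms by (simp add: cochains_def ring_cochains_def polys.koszul_ring_of)
qed

lemma koszul_ring_koszul_ring:
  assumes vs: "set vs \<subseteq> V" and "\<And>bs. \<phi> bs \<in> polys V"
  shows "koszul_ring (map var vs) (koszul_ring (map var vs) \<phi>) bs = 0"
proof -
  let ?R = "ring_of (polys V)"
  interpret M: Module.module ?R "ring_module ?R"
    by (rule module_ring_module[OF polys.cring_ring_of])
  have "set (map var vs) \<subseteq> carrier ?R"
    using vs by auto
  from M.koszul_koszul[OF this, of \<phi> bs] show ?thesis
    using assms by (simp add: polys.koszul_ring_of)
qed

text \<open>A cocycle for \<open>v # vs\<close> is a pair (a, b) where a is a cocycle for
  \<open>vs\<close> and v a is the coboundary of b. Below top degree a has a primitive a' by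
  induction. In top degree its class lies in the quotient by the variables \<open>vs\<close>, where
  \<open>v\<close> acts injectively and kills it. What remains, b - v a', is again a cocycle for
  \<open>vs\<close>.\<close>

lemma koszul_ring_exact:
  assumes "distinct vs" "set vs \<subseteq> V" "j \<le> length vs" "\<phi> \<in> ring_cochains (polys V) (length vs) j"
    and "\<And>bs. koszul_ring (map var vs) \<phi> bs = 0"
  shows "\<exists>\<beta>\<in>ring_cochains (polys V) (length vs) (j - 1). \<forall>bs. koszul_ring (map var vs) \<beta> bs = \<phi> bs"
  using assms
proof (induction vs arbitrary: j \<phi>)
  case Nil
  then show ?case
    by (auto simp: ring_cochains_def intro!: exI[of _ "\<lambda>_. 0"])
next
  case (Cons v vs)
  let ?n = "length vs" and ?rs = "map var vs :: (('a \<Rightarrow>\<^sub>0 nat) \<Rightarrow>\<^sub>0 'b) list"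
  define a where "a = (\<lambda>bs. \<phi> (False # bs))"
  define b where "b = (\<lambda>bs. \<phi> (True # bs))"
  have vs: "distinct vs" "set vs \<subseteq> V" "v \<in> V" "v \<notin> set vs"
    using Cons.prems by auto
  have a: "a \<in> ring_cochains (polys V) ?n j" and b: "b \<in> ring_cochains (polys V) ?n (j - 1)"
    using Cons.prems(4) by (fastforce simp: ring_cochains_def a_def b_def)+
  have polys: "a bs \<in> polys V" "b bs \<in> polys V" for bs
    using a b by (auto simp: ring_cochains_def)
  have ka: "koszul_ring ?rs a bs = 0" for bs
    using Cons.prems(5)[of "False # bs"] by (simp add: a_def)
  have kb: "koszul_ring ?rs b bs = var v * a bs" for bs
    using Cons.prems(5)[of "True # bs"] by (simp add: a_def b_def)
  have "\<exists>a'\<in>ring_cochains (polys V) ?n (j - 1). \<forall>bs. koszul_ring ?rs a' bs = a bs"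
  proof (cases "j \<le> ?n")
    case True
    then show ?thesis
      using Cons.IH[OF vs(1,2) _ a ka] by blast
  next
    \<comment> \<open>Here \<open>j\<close> exceeds what the induction hypothesis allows, because
      \<open>a\<close> may have a component in top degree. Subtracting the coboundary of \<gamma>
      removes it.\<close>
    case False
    then have j: "j = Suc ?n" using Cons.prems(3) by simp
    have "var v * a (replicate ?n True) \<in> mono_ideal V ((\<lambda>v. {v}) ` set vs)"
      using koszul_ring_top[OF vs(2), of b] polys by (simp add: kb)
    \<comment> \<open>Since \<open>v\<close> is not among \<open>vs\<close>, a multiple of
      \<open>v\<close> lies in the ideal of \<open>vs\<close> only if the cofactor does.\<close>
    then have "a (replicate ?n True) \<in> mono_ideal V ((\<lambda>v. {v}) ` set vs)"
      using vs(4) by (auto simp: var_mult_mono_ideal_iff[OF vs(3)]) (auto simp: mono_ideal_def)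
    then obtain \<gamma> where \<gamma>: "\<gamma> \<in> ring_cochains (polys V) ?n ?n"
      "koszul_ring ?rs \<gamma> (replicate ?n True) = a (replicate ?n True)"
      using koszul_ring_top_exists[OF vs(2)] by blast
    let ?d = "\<lambda>bs. a bs - koszul_ring ?rs \<gamma> bs"
    have k\<gamma>: "koszul_ring ?rs \<gamma> \<in> ring_cochains (polys V) ?n (Suc ?n)"
      by (rule koszul_ring_cochains[OF vs(2) \<gamma>(1)])
    have "?d \<in> ring_cochains (polys V) ?n ?n"
      unfolding ring_cochains_def
    proof (intro CollectI allI conjI impI)
      fix bs
      show "?d bs \<in> polys V"
        using polys k\<gamma> by (auto simp: ring_cochains_def)
      assume "?d bs \<noteq> 0"
      then have "a bs \<noteq> 0 \<or> koszul_ring ?rs \<gamma> bs \<noteq> 0" "bs \<noteq> replicate ?n True"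
        using \<gamma>(2) by auto
      then have *: "length bs = ?n" "count_list bs True < Suc ?n"
        using a k\<gamma> unfolding j ring_cochains_def by blast+
      show "length bs = ?n" by fact
      show "count_list bs True < ?n"
        using count_True_eq_length[of bs] * \<open>bs \<noteq> _\<close> by auto
    qed
    moreover have "koszul_ring ?rs ?d bs = 0" for bs
      using koszul_ring_koszul_ring[OF vs(2), of \<gamma> bs] \<gamma>(1) by (simp add: koszul_ring_minus ka ring_cochains_def)
    ultimately obtain \<delta> where \<delta>: "\<delta> \<in> ring_cochains (polys V) ?n (?n - 1)" "\<And>bs. koszul_ring ?rs \<delta> bs = ?d bs"
      using Cons.IH[OF vs(1,2) order_refl, of ?d] by blast
    have "(\<lambda>bs. \<gamma> bs + \<delta> bs) \<in> ring_cochains (polys V) ?n ?n"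
    proof -
      have "length bs = ?n \<and> count_list bs True < ?n" if "\<gamma> bs + \<delta> bs \<noteq> 0" for bs
      proof -
        have "\<gamma> bs \<noteq> 0 \<or> \<delta> bs \<noteq> 0" using that by auto
        then show ?thesis
          using \<gamma>(1) \<delta>(1) unfolding ring_cochains_def by fastforce
      qed
      then show ?thesis
        using \<gamma>(1) \<delta>(1) by (auto simp: ring_cochains_def)
    qed
    then show ?thesis
      using j \<delta>(2) by (intro bexI[of _ "\<lambda>bs. \<gamma> bs + \<delta> bs"]) (auto simp: koszul_ring_add)
  qed
  then obtain a' where a': "a' \<in> ring_cochains (polys V) ?n (j - 1)" "\<And>bs. koszul_ring ?rs a' bs = a bs"
    by blast
  let ?c = "\<lambda>bs. b bs - var v * a' bs"
  have "?c \<in> ring_cochains (polys V) ?n (j - 1)"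
  proof -
    have "length bs = ?n \<and> count_list bs True < j - 1" if "?c bs \<noteq> 0" for bs
    proof -
      have "b bs \<noteq> 0 \<or> a' bs \<noteq> 0" using that by auto
      then show ?thesis
        using a'(1) b unfolding ring_cochains_def by blast
    qed
    then show ?thesis
      using a'(1) b vs(3) by (auto simp: ring_cochains_def)
  qed
  moreover have "koszul_ring ?rs ?c bs = 0" for bs
    by (simp add: koszul_ring_minus koszul_ring_mult kb a'(2))
  moreover have "j - 1 \<le> ?n"
    using Cons.prems(3) by simp
  ultimately obtain d where d: "d \<in> ring_cochains (polys V) ?n (j - 1 - 1)" "\<And>bs. koszul_ring ?rs d bs = ?c bs"
    using Cons.IH[OF vs(1,2), of "j - 1" ?c] by blast
  \<comment> \<open>With \<partial> the differential for \<open>vs\<close>, the pair (a', - d) goes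
    to (\<partial> a', v a' + \<partial> d), which is (a, b).\<close>
  define \<beta> where "\<beta> cs = (case cs of [] \<Rightarrow> 0 | b # bs \<Rightarrow> if b then - d bs else a' bs)" for cs
  have "\<beta> \<in> ring_cochains (polys V) (Suc ?n) (j - 1)"
    using a'(1) d(1) by (fastforce simp: ring_cochains_def \<beta>_def split: list.split)
  moreover have "koszul_ring (map var (v # vs)) \<beta> bs = \<phi> bs" for bs
  proof (cases bs)
    case Nil
    then show ?thesis
      using Cons.prems(4) by (auto simp: ring_cochains_def)
  next
    case bs: (Cons t cs)
    then show ?thesis
      using a'(2) d(2) by (cases t) (simp_all add: \<beta>_def koszul_ring_uminus a_def b_def)
  qed
  ultimately show ?case by auto
qed

lemma depth_ge_polys:
  assumes "distinct vs" "set vs \<subseteq> V" "j \<le> length vs"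
  shows "depth_ge (ring_of (polys V :: (('v \<Rightarrow>\<^sub>0 nat) \<Rightarrow>\<^sub>0 'k::comm_ring_1) set)) (map var vs)
    (ring_module (ring_of (polys V))) j"
proof -
  have "cochains (ring_module (ring_of (polys V :: (('v \<Rightarrow>\<^sub>0 nat) \<Rightarrow>\<^sub>0 'k) set))) n j =
    ring_cochains (polys V) n j" for n j
    by (simp add: cochains_def ring_cochains_def)
  then show ?thesis
    unfolding depth_ge_def polys.koszul_ring_of length_map
    by (intro ballI impI) (simp add: koszul_ring_exact[OF assms])
qed


section \<open>Maximal independent sets and bouquets\<close>

definition cover_number :: "'v sgraph \<Rightarrow> nat" where
  "cover_number G = Max {card (verts G - S) | S. max_independent G S}"

lemma edge_ne:
  assumes "simple_graph G" "{v, w} \<in> edges G"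
  shows "v \<noteq> w" "v \<in> verts G" "w \<in> verts G"
proof -
  have "card {v, w} = 2" "{v, w} \<subseteq> verts G"
    using assms unfolding simple_graph_def by blast+
  then show "v \<noteq> w" "v \<in> verts G" "w \<in> verts G" by auto
qed

lemma edgeE:
  assumes "simple_graph G" "e \<in> edges G" "v \<in> e"
  obtains w where "e = {v, w}" "w \<noteq> v"
proof -
  have "card e = 2" using assms by (auto simp: simple_graph_def)
  then obtain a b where "e = {a, b}" "a \<noteq> b" by (auto simp: card_2_iff)
  then show ?thesis using assms(3) that by (cases "v = a") (auto simp: insert_commute)
qed

lemma independentI:
  assumes "simple_graph G" "S \<subseteq> verts G" "\<And>v w. v \<in> S \<Longrightarrow> w \<in> S \<Longrightarrow> {v, w} \<notin> edges G"
  shows "independent G S"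
  unfolding independent_def
proof (intro conjI ballI notI)
  fix e assume e: "e \<in> edges G" "e \<subseteq> S"
  then have "card e = 2" using assms(1) by (auto simp: simple_graph_def)
  then obtain a b where "e = {a, b}" by (auto simp: card_2_iff)
  then show False using e assms(3) by blast
qed fact

lemma max_independent_iff:
  assumes G: "simple_graph G"
  shows "max_independent G S \<longleftrightarrow> independent G S \<and> (\<forall>v\<in>verts G - S. \<exists>w\<in>S. {v, w} \<in> edges G)"
    (is "_ \<longleftrightarrow> _ \<and> ?dom")
proof (intro iffI conjI)
  assume S: "max_independent G S"
  then show ind: "independent G S" by (simp add: max_independent_def)
  show ?dom
  proof
    fix v assume v: "v \<in> verts G - S"
    then have "\<not> independent G (insert v S)"
      using S by (force simp: max_independent_def)
    then obtain e where e: "e \<in> edges G" "e \<subseteq> insert v S"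
      using v ind by (auto simp: independent_def)
    then have "v \<in> e" using ind by (auto simp: independent_def)
    then obtain w where "e = {v, w}" "w \<noteq> v" using edgeE[OF G e(1)] by blast
    then show "\<exists>w\<in>S. {v, w} \<in> edges G" using e by auto
  qed
next
  assume *: "independent G S \<and> ?dom"
  show "max_independent G S"
    unfolding max_independent_def
  proof (intro conjI allI impI)
    fix T assume T: "independent G T \<and> S \<subseteq> T"
    show "T = S"
    proof (rule ccontr)
      assume "T \<noteq> S"
      then obtain v where v: "v \<in> T" "v \<notin> S" using T by blast
      then have "v \<in> verts G - S"
        using T by (auto simp: independent_def)
      then obtain w where "w \<in> S" "{v, w} \<in> edges G"
        using * by blast
      then show False using T v by (auto simp: independent_def)
    qed
  qed (use * in blast)
qed

lemma max_independent_extend: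
  assumes "simple_graph G" "independent G S"
  obtains T where "max_independent G T" "S \<subseteq> T"
proof -
  have "finite {T. independent G T}"
    by (rule finite_subset[of _ "Pow (verts G)"])
      (use assms in \<open>auto simp: independent_def simple_graph_def\<close>)
  then obtain T where "independent G T" "S \<subseteq> T" "\<And>U. independent G U \<Longrightarrow> T \<subseteq> U \<Longrightarrow> T = U"
    using finite_has_maximal2[of "{T. independent G T}" S] assms(2) by auto
  then show ?thesis
    by (intro that[of T]) (auto simp: max_independent_def)
qed

lemma finite_cover_cards:
  assumes "simple_graph G"
  shows "finite {card (verts G - S) | S. max_independent G S}"
  by (rule finite_subset[of _ "{..card (verts G)}"])
    (use assms in \<open>auto simp: simple_graph_def intro!: card_mono\<close>)

lemma cover_number_ge:
  "simple_graph G \<Longrightarrow> max_independent G S \<Longrightarrow> card (verts G - S) \<le> cover_number G"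
  unfolding cover_number_def by (intro Max_ge finite_cover_cards) auto

lemma cover_number_attained:
  assumes "simple_graph G"
  obtains S where "max_independent G S" "cover_number G = card (verts G - S)"
proof -
  have "independent G {}"
    using assms by (force simp: independent_def simple_graph_def)
  then obtain T where "max_independent G T"
    by (rule max_independent_extend[OF assms])
  then have "cover_number G \<in> {card (verts G - S) | S. max_independent G S}"
    unfolding cover_number_def by (intro Max_in finite_cover_cards assms) auto
  then show ?thesis using that by blast
qed

lemma simple_graph_delete: "simple_graph G \<Longrightarrow> simple_graph (delete_verts G T)"
  by (auto simp: simple_graph_def delete_verts_def)

lemma edges_delete_iff: "{v, w} \<in> edges (delete_verts G T) \<longleftrightarrow> {v, w} \<in> edges G \<and> v \<notin> T \<and> w \<notin> T"
  by (auto simp: delete_verts_def)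

lemma neighbors_subset: "simple_graph G \<Longrightarrow> neighbors G x \<subseteq> verts G - {x}"
  using edge_ne[of G x] by (auto simp: neighbors_def)

text \<open>A maximal independent set of G - x without a neighbour of x would be independent in G -
  N[x], against the shedding condition. So an extremal one dominates x, stays maximal in G, and its
  complement gains x.\<close>

lemma cover_number_delete:
  assumes G: "simple_graph G" and x: "x \<in> verts G"
    and shed: "\<forall>S. independent (delete_verts G (closed_neighbors G x)) S
         \<longrightarrow> \<not> max_independent (delete_verts G {x}) S"
  shows "Suc (cover_number (delete_verts G {x})) \<le> cover_number G"
proof -
  let ?H = "delete_verts G {x}"
  have H: "simple_graph ?H" by (rule simple_graph_delete[OF G])
  obtain S where S: "max_independent ?H S" "cover_number ?H = card (verts ?H - S)"
    using cover_number_attained[OF H] .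
  have ind: "independent ?H S" and dom: "\<forall>v\<in>verts ?H - S. \<exists>w\<in>S. {v, w} \<in> edges ?H"
    using S(1) max_independent_iff[OF H] by blast+
  have S_sub: "S \<subseteq> verts G - {x}"
    using ind by (simp add: independent_def delete_verts_def)
  have "\<exists>w\<in>S. {x, w} \<in> edges G"
  proof (rule ccontr)
    assume "\<not> (\<exists>w\<in>S. {x, w} \<in> edges G)"
    then have "independent (delete_verts G (closed_neighbors G x)) S"
      using ind S_sub by (auto simp: independent_def delete_verts_def closed_neighbors_def neighbors_def)
    then show False using shed S(1) by blast
  qed
  moreover have "independent G S"
    using ind S_sub by (auto simp: independent_def delete_verts_def)
  moreover have "\<exists>w\<in>S. {v, w} \<in> edges G" if "v \<in> verts G - S" "v \<noteq> x" for v
    using dom that by (auto simp: delete_verts_def)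
  ultimately have "max_independent G S"
    unfolding max_independent_iff[OF G] by blast
  then have "card (verts G - S) \<le> cover_number G"
    by (rule cover_number_ge[OF G])
  moreover have "verts G - S = insert x (verts ?H - S)"
    using x S_sub by (auto simp: delete_verts_def)
  moreover have "finite (verts ?H)" "x \<notin> verts ?H"
    using G by (auto simp: simple_graph_def delete_verts_def)
  ultimately show ?thesis
    using S(2) by simp
qed

text \<open>Adding x to a maximal independent set of G - N[x] gives one of G, and the complement
  gains exactly the neighbours of x.\<close>

lemma cover_number_delete_closed_neighbors:
  assumes G: "simple_graph G" and x: "x \<in> verts G"
  shows "cover_number (delete_verts G (closed_neighbors G x)) + card (neighbors G x) \<le> cover_number G"
proof -
  let ?H = "delete_verts G (closed_neighbors G x)"
  have H: "simple_graph ?H" by (rule simple_graph_delete[OF G])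
  obtain S where S: "max_independent ?H S" "cover_number ?H = card (verts ?H - S)"
    using cover_number_attained[OF H] .
  have ind: "independent ?H S" and dom: "\<forall>v\<in>verts ?H - S. \<exists>w\<in>S. {v, w} \<in> edges ?H"
    using S(1) max_independent_iff[OF H] by blast+
  have S_sub: "S \<subseteq> verts G - closed_neighbors G x"
    using ind by (simp add: independent_def delete_verts_def)
  have N: "neighbors G x \<subseteq> verts G - {x}"
    by (rule neighbors_subset[OF G])
  have "independent G (insert x S)"
  proof (rule independentI[OF G])
    fix v w assume "v \<in> insert x S" "w \<in> insert x S"
    moreover have "{v, w} \<notin> edges G" if "v \<in> S" "w \<in> S" for v w
      using ind S_sub that edges_delete_iff[of v w G "closed_neighbors G x"]
      by (auto simp: independent_def)
    moreover have "{x, w} \<notin> edges G" if "w \<in> insert x S" for w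
      using that S_sub edge_ne(1)[OF G, of x w] by (auto simp: closed_neighbors_def neighbors_def)
    ultimately show "{v, w} \<notin> edges G"
      by (metis insert_commute insertE)
  qed (use S_sub x in auto)
  moreover have "\<exists>w\<in>insert x S. {v, w} \<in> edges G" if "v \<in> verts G - insert x S" for v
  proof (cases "v \<in> neighbors G x")
    case True
    then show ?thesis by (auto simp: neighbors_def insert_commute)
  next
    case False
    then have "v \<in> verts ?H - S"
      using that by (auto simp: delete_verts_def closed_neighbors_def)
    then show ?thesis using dom edges_delete_iff[of v _ G] by auto
  qed
  ultimately have "max_independent G (insert x S)"
    unfolding max_independent_iff[OF G] by blast
  then have "card (verts G - insert x S) \<le> cover_number G"
    by (rule cover_number_ge[OF G])
  moreover have "verts G - insert x S = (verts ?H - S) \<union> neighbors G x"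
    using x S_sub N by (auto simp: delete_verts_def closed_neighbors_def)
  moreover have "(verts ?H - S) \<inter> neighbors G x = {}" "finite (verts ?H)" "finite (neighbors G x)"
    using G N by (auto simp: simple_graph_def delete_verts_def closed_neighbors_def intro: finite_subset)
  ultimately show ?thesis
    using S(2) by (simp add: card_Un_disjoint)
qed

text \<open>
  Assigning to each vertex of a minimal vertex cover \<open>C\<close> one of its neighbours outside \<open>C\<close> splits
  \<open>C\<close> into the flower sets of a semi-strongly disjoint set of bouquets.
\<close>

lemma d_prime_eq_cover_number:
  assumes G: "simple_graph G"
  shows "d_prime G = cover_number G"
proof -
  have fin: "finite (verts G)" using G by (simp add: simple_graph_def)
  have fl: "flowers \<B> \<subseteq> verts G" if "semi_strongly_disjoint G \<B>" for \<B>
    using that by (auto simp: semi_strongly_disjoint_def is_bouquet_def flowers_def)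
  have le: "card (flowers \<B>) \<le> cover_number G" if \<B>: "semi_strongly_disjoint G \<B>" for \<B>
  proof -
    have "independent G (roots \<B>)"
      using \<B> by (simp add: semi_strongly_disjoint_def)
    then obtain T where T: "max_independent G T" "roots \<B> \<subseteq> T"
      by (rule max_independent_extend[OF G])
    have "w \<notin> T" if w: "w \<in> flowers \<B>" for w
    proof
      assume "w \<in> T"
      obtain B where "B \<in> \<B>" "w \<in> snd B"
        using w by (auto simp: flowers_def)
      then have "{fst B, w} \<in> edges G" "fst B \<in> T"
        using \<B> T(2) by (auto simp: semi_strongly_disjoint_def is_bouquet_def roots_def)
      with \<open>w \<in> T\<close> show False
        using T(1) by (auto simp: max_independent_def independent_def)
    qed
    then have "card (flowers \<B>) \<le> card (verts G - T)"
      using fl[OF \<B>] fin by (intro card_mono) auto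
    also have "\<dots> \<le> cover_number G"
      by (rule cover_number_ge[OF G T(1)])
    finally show ?thesis .
  qed
  obtain S where S: "max_independent G S" "cover_number G = card (verts G - S)"
    using cover_number_attained[OF G] .
  let ?C = "verts G - S"
  have ind: "independent G S" and "\<forall>v\<in>?C. \<exists>w\<in>S. {v, w} \<in> edges G"
    using S(1) max_independent_iff[OF G] by blast+
  then obtain f where f: "\<And>v. v \<in> ?C \<Longrightarrow> f v \<in> S" "\<And>v. v \<in> ?C \<Longrightarrow> {f v, v} \<in> edges G"
    by (metis insert_commute)
  let ?\<B> = "(\<lambda>z. (z, {v \<in> ?C. f v = z})) ` f ` ?C"
  have S_sub: "S \<subseteq> verts G" using ind by (simp add: independent_def)
  have "semi_strongly_disjoint G ?\<B>"
    unfolding semi_strongly_disjoint_def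
  proof (intro conjI ballI impI)
    have "{f v, w} \<in> edges G" if "w \<in> ?C" "f w = f v" for v w
      using f(2)[OF that(1)] that(2) by simp
    then show "is_bouquet G B" if "B \<in> ?\<B>" for B
      using that f(1) S_sub by (auto simp: is_bouquet_def)
    show "bouquet_verts B \<inter> bouquet_verts C = {}" if "B \<in> ?\<B>" "C \<in> ?\<B>" "B \<noteq> C" for B C
      using that f(1) by (auto simp: bouquet_verts_def)
    have "roots ?\<B> \<subseteq> S"
      using f(1) by (auto simp: roots_def)
    then show "independent G (roots ?\<B>)"
      using ind unfolding independent_def by blast
  qed
  moreover have "flowers ?\<B> = ?C"
    by (auto simp: flowers_def)
  ultimately have "cover_number G \<in> {card (flowers \<B>) | \<B>. semi_strongly_disjoint G \<B>}"
    using S(2) by (intro CollectI exI[of _ ?\<B>]) simp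
  moreover have "finite {card (flowers \<B>) | \<B>. semi_strongly_disjoint G \<B>}"
    by (rule finite_subset[of _ "{..cover_number G}"]) (use le in auto)
  ultimately show ?thesis
    unfolding d_prime_def by (intro Max_eqI) (use le in auto)
qed


section \<open>Edge ideals and their resolutions\<close>

definition mon_of :: "'v set \<Rightarrow> 'v \<Rightarrow>\<^sub>0 nat" where
  "mon_of e = (\<Sum>v\<in>e. X v)"

lemma keys_mon_of: "finite e \<Longrightarrow> keys (mon_of e) = e"
proof (induction e rule: finite_induct)
  case (insert v e)
  then show ?case by (simp add: mon_of_def keys_add_nat)
qed (simp add: mon_of_def)

lemma mon_of_factor:
  assumes "finite e" "e \<subseteq> keys m"
  obtains m' where "m = m' + mon_of e"
  using assms
proof (induction e arbitrary: m thesis rule: finite_induct)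
  case empty
  then show ?case by (metis add.right_neutral mon_of_def sum.empty)
next
  case (insert v e)
  then obtain k where k: "m = k + mon_of e"
    by (metis insert_subset)
  have "v \<in> keys k"
    using insert.prems(2) insert.hyps by (auto simp: k keys_add_nat keys_mon_of)
  then obtain l where "k = l + X v" by (rule mon_of_split)
  then have "m = l + mon_of (insert v e)"
    using insert.hyps by (simp add: k mon_of_def ac_simps)
  then show ?case by (rule insert.prems(1))
qed

lemma single_mon_of_insert: 
  assumes "finite e" "v \<notin> e"
  shows "Poly_Mapping.single (mon_of (insert v e)) 1 = var v * Poly_Mapping.single (mon_of e) 1"
  using assms by (simp add: mon_of_def var_def mult_single)

lemma single_mon_of_polys: "finite e \<Longrightarrow> e \<subseteq> V \<Longrightarrow> Poly_Mapping.single (mon_of e) c \<in> polys V"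
  by (auto simp: polys_def keys_mon_of)

lemma single_mon_of_mono_ideal_iff:
  assumes "finite e" "e \<subseteq> V"
  shows "(Poly_Mapping.single (mon_of e) 1 :: ('v \<Rightarrow>\<^sub>0 nat) \<Rightarrow>\<^sub>0 'k::comm_ring_1) \<in> mono_ideal V E \<longleftrightarrow> (\<exists>e'\<in>E. e' \<subseteq> e)"
  using assms single_mon_of_polys[of e V "1 :: 'k"] by (simp add: mono_ideal_def keys_mon_of)

lemma poly_eq_sum_single: "p = (\<Sum>m\<in>keys p. Poly_Mapping.single m (lookup p m))"
  by (rule poly_mapping_eqI) (simp add: lookup_sum lookup_single when_def in_keys_iff)

text \<open>Every term of \<open>p\<close> is a multiple of a generating monomial. This is the
  minimality needed to recognise \<open>mono_ideal\<close> as the ideal generated by these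
  monomials.\<close>

lemma mono_ideal_le:
  fixes I :: "(('v \<Rightarrow>\<^sub>0 nat) \<Rightarrow>\<^sub>0 'k::comm_ring_1) set"
  assumes I: "ideal I (ring_of (polys V))"
    and E: "\<And>e. e \<in> E \<Longrightarrow> finite e" "\<And>e. e \<in> E \<Longrightarrow> Poly_Mapping.single (mon_of e) 1 \<in> I"
  shows "mono_ideal V E \<subseteq> I"
proof
  fix p :: "('v \<Rightarrow>\<^sub>0 nat) \<Rightarrow>\<^sub>0 'k"
  assume p: "p \<in> mono_ideal V E"
  have single_in: "Poly_Mapping.single m (lookup p m) \<in> I" if m: "m \<in> keys p" for m
  proof -
    obtain e where e: "e \<in> E" "e \<subseteq> keys m"
      using p m by (auto simp: mono_ideal_def)
    then obtain m' where m': "m = m' + mon_of e"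
      using mon_of_factor[OF E(1)[OF e(1)]] by blast
    have "keys m \<subseteq> V"
      using p m by (auto simp: mono_ideal_def polys_def)
    then have "Poly_Mapping.single m' (lookup p m) \<in> polys V"
      by (auto simp: polys_def m' keys_add_nat)
    from ideal_ring_ofD(4)[OF I this E(2)[OF e(1)]] show ?thesis
      by (simp add: mult_single m')
  qed
  have "(\<Sum>m\<in>M. Poly_Mapping.single m (lookup p m)) \<in> I" if "M \<subseteq> keys p" for M
    using finite_subset[OF that finite_keys] that
    by (induction M rule: finite_induct) (auto intro!: ideal_ring_ofD(2,3)[OF I] single_in)
  then show "p \<in> I"
    using poly_eq_sum_single[of p] by (metis order_refl)
qed

lemma var_mult_var: "v \<noteq> w \<Longrightarrow> var v * var w = Poly_Mapping.single (mon_of {v, w}) 1"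
  by (simp add: var_def mult_single mon_of_def)

lemma var_eq: "var v = Poly_Mapping.single (mon_of {v}) 1"
  by (simp add: var_def mon_of_def)

lemma finite_edge: "simple_graph G \<Longrightarrow> e \<in> edges G \<Longrightarrow> finite e"
  by (metis card.infinite simple_graph_def zero_neq_numeral)

lemma edge_ideal_subset:
  fixes I :: "(('v \<Rightarrow>\<^sub>0 nat) \<Rightarrow>\<^sub>0 'k::comm_ring_1) set"
  assumes "simple_graph G" "ideal I (ring_of (polys (verts G)))"
  shows "mono_ideal (verts G) (edges G) \<subseteq> I \<longleftrightarrow> (\<forall>v w. {v, w} \<in> edges G \<longrightarrow> var v * var w \<in> I)"
proof
  assume L: "mono_ideal (verts G) (edges G) \<subseteq> I"
  show "\<forall>v w. {v, w} \<in> edges G \<longrightarrow> var v * var w \<in> I"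
  proof (intro allI impI)
    fix v w assume e: "{v, w} \<in> edges G"
    note vw = edge_ne[OF assms(1) e]
    have "(Poly_Mapping.single (mon_of {v, w}) 1 :: ('v \<Rightarrow>\<^sub>0 nat) \<Rightarrow>\<^sub>0 'k) \<in> mono_ideal (verts G) (edges G)"
      using e vw by (subst single_mon_of_mono_ideal_iff) auto
    then show "var v * var w \<in> I"
      using L vw(1) by (auto simp: var_mult_var)
  qed
next
  assume R: "\<forall>v w. {v, w} \<in> edges G \<longrightarrow> var v * var w \<in> I"
  show "mono_ideal (verts G) (edges G) \<subseteq> I"
  proof (rule mono_ideal_le[OF assms(2)])
    fix e assume e: "e \<in> edges G"
    then show "finite e" by (rule finite_edge[OF assms(1)])
    have "card e = 2" using assms(1) e by (auto simp: simple_graph_def)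
    then obtain v w where "e = {v, w}" "v \<noteq> w" by (auto simp: card_2_iff)
    then show "Poly_Mapping.single (mon_of e) 1 \<in> I"
      using R e var_mult_var[of v w] by metis
  qed
qed

text \<open>\<open>genideal\<close> is an intersection of ideals, and the edge products and the
  monomial description are contained in the same ideals.\<close>

lemma edge_ideal_eq:
  assumes "simple_graph G"
  shows "edge_ideal G = (mono_ideal (verts G) (edges G) :: (('v \<Rightarrow>\<^sub>0 nat) \<Rightarrow>\<^sub>0 'k::comm_ring_1) set)"
proof -
  let ?M = "mono_ideal (verts G) (edges G) :: (('v \<Rightarrow>\<^sub>0 nat) \<Rightarrow>\<^sub>0 'k) set"
  let ?S = "{var v * var w | v w. {v, w} \<in> edges G}"
  have sub: "?S \<subseteq> I \<longleftrightarrow> ?M \<subseteq> I" if "ideal I (ring_of (polys (verts G)))" for I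
    unfolding edge_ideal_subset[OF assms that] by blast
  have "ideal ?M (ring_of (polys (verts G)))"
    by (rule ideal_mono_ideal)
  then show ?thesis
    unfolding edge_ideal_def genideal_def poly_ring_eq using sub by blast
qed

section \<open>Resolving edge ideals along a shedding vertex\<close>

lemma mono_ideal_sum:
  assumes x: "x \<in> V"
    and "\<And>e. e \<in> E1 \<Longrightarrow> \<exists>e'\<in>E. e' \<subseteq> e" "\<And>e. e \<in> E2 \<Longrightarrow> \<exists>e'\<in>E. e' \<subseteq> insert x e"
    and E: "\<And>e. e \<in> E \<Longrightarrow> (\<exists>e'\<in>E1. e' \<subseteq> e) \<or> x \<in> e \<and> (\<exists>e'\<in>E2. e' \<subseteq> e - {x})"
  shows "{a + var x * b | a b. a \<in> mono_ideal V E1 \<and> b \<in> mono_ideal V E2} = mono_ideal V E"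
proof (intro equalityI subsetI)
  fix p assume p: "p \<in> mono_ideal V E"
  have "(\<exists>e\<in>E1. e \<subseteq> keys m) \<or> x \<in> keys m \<and> (\<exists>e\<in>E2. e \<subseteq> keys m - {x})" if m: "m \<in> keys p" for m
  proof -
    obtain e where "e \<in> E" "e \<subseteq> keys m"
      using p m by (auto simp: mono_ideal_def)
    then show ?thesis
      using E[of e] by blast
  qed
  moreover have "p \<in> polys V"
    using p by (simp add: mono_ideal_def)
  ultimately obtain a b where "p = a + var x * b" "a \<in> mono_ideal V E1" "b \<in> mono_ideal V E2"
    using mono_ideal_split[OF x] by metis
  then show "p \<in> {a + var x * b | a b. a \<in> mono_ideal V E1 \<and> b \<in> mono_ideal V E2}"
    by blast
next
  fix p assume "p \<in> {a + var x * b | a b. a \<in> mono_ideal V E1 \<and> b \<in> mono_ideal V E2}"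
  then obtain a b where p: "p = a + var x * b" and a: "a \<in> mono_ideal V E1" and b: "b \<in> mono_ideal V E2"
    by blast
  have "\<exists>e\<in>E. e \<subseteq> keys m" if m: "m \<in> keys a" for m
  proof -
    obtain e where "e \<in> E1" "e \<subseteq> keys m" using a m by (auto simp: mono_ideal_def)
    then show ?thesis using assms(2)[of e] by blast
  qed
  then have "a \<in> mono_ideal V E"
    using a by (simp add: mono_ideal_def)
  moreover have "\<exists>e\<in>E. e \<subseteq> insert x (keys m)" if m: "m \<in> keys b" for m
  proof -
    obtain e where "e \<in> E2" "e \<subseteq> keys m" using b m by (auto simp: mono_ideal_def)
    then show ?thesis using assms(3)[of e] by blast
  qed
  then have "var x * b \<in> mono_ideal V E"
    using b unfolding var_mult_mono_ideal_iff[OF x] by (simp add: mono_ideal_def)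
  ultimately show "p \<in> mono_ideal V E"
    unfolding p by (rule add_mono_ideal)
qed

text \<open>The exact sequence for J + x L in terms of generating sets: that \<open>x\<close> avoids
  the sets in \<open>E1\<close> makes it a nonzerodivisor modulo J, and \<open>E12\<close> gives the
  inclusion of J in L.\<close>

lemma has_free_res_mono_ideal_sum:
  fixes V :: "'v set" and q :: "'j \<times> nat" and E1 E2 :: "'v set set"
  defines "f \<equiv> \<lambda>n E. polys.has_free_res V n (polys.ideal_vecs q (mono_ideal V E :: (('v \<Rightarrow>\<^sub>0 nat) \<Rightarrow>\<^sub>0 'k::comm_ring_1) set))"
  assumes "f n E1" "f (Suc n) E2" and x: "x \<in> V" "\<And>e. e \<in> E1 \<Longrightarrow> x \<notin> e"
    and "\<And>e. e \<in> E1 \<Longrightarrow> \<exists>e'\<in>E. e' \<subseteq> e" "\<And>e. e \<in> E2 \<Longrightarrow> \<exists>e'\<in>E. e' \<subseteq> insert x e"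
    and "\<And>e. e \<in> E \<Longrightarrow> (\<exists>e'\<in>E1. e' \<subseteq> e) \<or> x \<in> e \<and> (\<exists>e'\<in>E2. e' \<subseteq> e - {x})"
    and E12: "\<And>e. e \<in> E1 \<Longrightarrow> \<exists>e'\<in>E2. e' \<subseteq> e"
  shows "f (Suc n) E"
proof -
  let ?J = "mono_ideal V E1 :: (('v \<Rightarrow>\<^sub>0 nat) \<Rightarrow>\<^sub>0 'k) set"
    and ?L = "mono_ideal V E2 :: (('v \<Rightarrow>\<^sub>0 nat) \<Rightarrow>\<^sub>0 'k) set"
  have JL: "?J \<subseteq> ?L"
  proof
    fix p :: "('v \<Rightarrow>\<^sub>0 nat) \<Rightarrow>\<^sub>0 'k" assume p: "p \<in> ?J"
    have "\<exists>e\<in>E2. e \<subseteq> keys m" if m: "m \<in> keys p" for m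
    proof -
      obtain e where "e \<in> E1" "e \<subseteq> keys m"
        using p m by (auto simp: mono_ideal_def)
      then show ?thesis using E12[of e] by blast
    qed
    then show "p \<in> ?L" using p by (simp add: mono_ideal_def)
  qed
  have J: "a \<in> ?J" if a: "a \<in> polys V" "var x * a \<in> ?J" for a
  proof -
    have "\<exists>e\<in>E1. e \<subseteq> keys m" if m: "m \<in> keys a" for m
    proof -
      obtain e where "e \<in> E1" "e \<subseteq> insert x (keys m)"
        using a(2) m by (auto simp: var_mult_mono_ideal_iff[OF x(1)])
      then show ?thesis using x(2)[of e] by blast
    qed
    then show ?thesis using a(1) by (simp add: mono_ideal_def)
  qed
  have "polys.has_free_res V (Suc n) (polys.ideal_vecs q {a + var x * b | a b. a \<in> ?J \<and> b \<in> ?L})"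
    by (rule polys.has_free_res_ideal_sum[OF assms(2,3)[unfolded f_def] var_in_polys[OF x(1)] JL
          mono_ideal_subset J])
  moreover have "{a + var x * b | a b. a \<in> ?J \<and> b \<in> ?L} = mono_ideal V E"
    by (rule mono_ideal_sum[OF x(1)]) fact+
  ultimately show ?thesis
    by (simp only: f_def)
qed

text \<open>Adjoining a fresh variable \<open>y\<close> is the case of J + y L where L is the whole
  ring, generated by \<open>{{}}\<close>; each variable costs one more term.\<close>

lemma has_free_res_mono_ideal_vars:
  fixes V :: "'v set" and q :: "'j \<times> nat" and E :: "'v set set"
  defines "f \<equiv> \<lambda>n E. polys.has_free_res V n (polys.ideal_vecs q (mono_ideal V E :: (('v \<Rightarrow>\<^sub>0 nat) \<Rightarrow>\<^sub>0 'k::comm_ring_1) set))"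
  assumes "f n E" "finite W" "W \<subseteq> V" "W \<inter> \<Union>E = {}"
  shows "f (n + card W) (E \<union> (\<lambda>v. {v}) ` W)"
  using assms(3-5)
proof (induction W rule: finite_induct)
  case empty
  then show ?case using assms(2) by simp
next
  case (insert y W)
  have "f (Suc (n + card W)) (insert {y} (E \<union> (\<lambda>v. {v}) ` W))"
    unfolding f_def
  proof (rule has_free_res_mono_ideal_sum[of V _ q "E \<union> (\<lambda>v. {v}) ` W" "{{}}" y])
    show "polys.has_free_res V (n + card W) (polys.ideal_vecs q (mono_ideal V (E \<union> (\<lambda>v. {v}) ` W) :: (('v \<Rightarrow>\<^sub>0 nat) \<Rightarrow>\<^sub>0 'k) set))"
      using insert by (simp add: f_def)
    have "mono_ideal V {{}} = (polys V :: (('v \<Rightarrow>\<^sub>0 nat) \<Rightarrow>\<^sub>0 'k) set)"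
      by (simp add: mono_ideal_def)
    then show "polys.has_free_res V (Suc (n + card W)) (polys.ideal_vecs q (mono_ideal V {{}} :: (('v \<Rightarrow>\<^sub>0 nat) \<Rightarrow>\<^sub>0 'k) set))"
      by (simp only: polys.has_free_res_ideal_vecs_ring)
  qed (use insert in auto)
  then show ?case
    using insert by simp
qed

text \<open>The induction deletes vertices while all resolutions must stay over one ring, so the
  variables range over a fixed set \<open>V\<close> containing the vertices.\<close>

lemma has_free_res_vertex_decomposable:
  fixes V :: "'v set" and q :: "'j \<times> nat" and G :: "'v sgraph"
  defines "f \<equiv> \<lambda>n E. polys.has_free_res V n (polys.ideal_vecs q (mono_ideal V E :: (('v \<Rightarrow>\<^sub>0 nat) \<Rightarrow>\<^sub>0 'k::comm_ring_1) set))"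
  assumes "vertex_decomposable G" "simple_graph G" "verts G \<subseteq> V"
  shows "f (cover_number G) (edges G)"
  using assms(2-4)
proof (induction rule: vertex_decomposable.induct)
  case (no_edges G)
  have "(mono_ideal V {} :: (('v \<Rightarrow>\<^sub>0 nat) \<Rightarrow>\<^sub>0 'k) set) = {0}"
    by (auto simp: mono_ideal_def)
  moreover have "polys.ideal_vecs q {0} = {0 :: 'j \<times> nat \<Rightarrow> ('v \<Rightarrow>\<^sub>0 nat) \<Rightarrow>\<^sub>0 'k}"
    by (auto simp: polys.ideal_vecs_def fun_eq_iff) metis
  ultimately show ?case
    unfolding f_def no_edges(1) by (simp only: polys.has_free_res_zero)
next
  case (shedding x G)
  let ?G1 = "delete_verts G {x}" and ?G2 = "delete_verts G (closed_neighbors G x)"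
  let ?N = "neighbors G x"
  note G = \<open>simple_graph G\<close>
  have N: "?N \<subseteq> verts G - {x}"
    by (rule neighbors_subset[OF G])
  have finN: "finite ?N"
    using N G by (auto simp: simple_graph_def intro: finite_subset)
  \<comment> \<open>The strict drop of the cover number makes it positive for \<open>G\<close> and
    bounds it by the predecessor \<open>n\<close> for G - x. This is the gap of one that the sum
    requires between its two parts.\<close>
  obtain n where n: "cover_number G = Suc n" "cover_number ?G1 \<le> n"
    using cover_number_delete[OF G shedding(1,4)] by (cases "cover_number G") auto
  have sub: "verts (delete_verts G T) \<subseteq> V" for T
    using shedding.prems by (auto simp: delete_verts_def)
  have "f (cover_number ?G1) (edges ?G1)"
    by (rule shedding.IH(1)[OF simple_graph_delete[OF G] sub])
  then have 1: "f n (edges ?G1)"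
    unfolding f_def using n(2) by (rule polys.has_free_res_mono)
  have "f (cover_number ?G2) (edges ?G2)"
    by (rule shedding.IH(2)[OF simple_graph_delete[OF G] sub])
  then have "f (cover_number ?G2 + card ?N) (edges ?G2 \<union> (\<lambda>v. {v}) ` ?N)"
    unfolding f_def
    by (rule has_free_res_mono_ideal_vars[OF _ finN])
      (use N shedding.prems in \<open>auto simp: delete_verts_def closed_neighbors_def\<close>)
  then have 2: "f (Suc n) (edges ?G2 \<union> (\<lambda>v. {v}) ` ?N)"
    unfolding f_def by (rule polys.has_free_res_mono)
      (use cover_number_delete_closed_neighbors[OF G shedding(1)] n(1) in simp)
  have "f (Suc n) (edges G)"
    using 1 2 unfolding f_def
  proof (rule has_free_res_mono_ideal_sum[where x = x])
    show "x \<in> V" using shedding by auto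
    show "x \<notin> e" if "e \<in> edges ?G1" for e
      using that by (auto simp: delete_verts_def)
    show "\<exists>e'\<in>edges G. e' \<subseteq> e" if "e \<in> edges ?G1" for e
      using that by (auto simp: delete_verts_def)
    show "\<exists>e'\<in>edges G. e' \<subseteq> insert x e" if "e \<in> edges ?G2 \<union> (\<lambda>v. {v}) ` ?N" for e
      using that by (auto simp: delete_verts_def neighbors_def)
    show "(\<exists>e'\<in>edges ?G1. e' \<subseteq> e) \<or> x \<in> e \<and> (\<exists>e'\<in>edges ?G2 \<union> (\<lambda>v. {v}) ` ?N. e' \<subseteq> e - {x})"
      if e: "e \<in> edges G" for e
    proof (cases "x \<in> e")
      case True
      then obtain w where "e = {x, w}" "w \<noteq> x" using edgeE[OF G e] by blast
      then show ?thesis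
        using e by (auto simp: neighbors_def)
    next
      case False
      then have "e \<in> edges ?G1" using e by (auto simp: delete_verts_def)
      then show ?thesis by blast
    qed
    \<comment> \<open>An edge of G - x that meets the neighbourhood lies above the variable of a
      neighbour; every other one survives in G - N[x].\<close>
    show "\<exists>e'\<in>edges ?G2 \<union> (\<lambda>v. {v}) ` ?N. e' \<subseteq> e" if "e \<in> edges ?G1" for e
    proof (cases "e \<inter> ?N = {}")
      case True
      then have "e \<in> edges ?G2"
        using that by (auto simp: delete_verts_def closed_neighbors_def)
      then show ?thesis by blast
    qed blast
  qed
  then show ?case by (simp add: n(1))
qed


section \<open>Primes and heights\<close>

text \<open>
  The vertices carry no order, so this takes the place of the leading monomials of a term order.
\<close>

lemma unique_sum:
  fixes A B :: "('v \<Rightarrow>\<^sub>0 nat) set"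
  assumes "finite V" "finite A" "finite B" "A \<noteq> {}" "B \<noteq> {}"
    and "\<And>a a' v. a \<in> A \<Longrightarrow> a' \<in> A \<Longrightarrow> v \<notin> V \<Longrightarrow> lookup a v = lookup a' v"
    and "\<And>b b' v. b \<in> B \<Longrightarrow> b' \<in> B \<Longrightarrow> v \<notin> V \<Longrightarrow> lookup b v = lookup b' v"
  shows "\<exists>a\<in>A. \<exists>b\<in>B. \<forall>a'\<in>A. \<forall>b'\<in>B. a' + b' = a + b \<longrightarrow> a' = a \<and> b' = b"
  using assms
proof (induction V arbitrary: A B rule: finite_induct)
  case empty
  have "a = a'" if "a \<in> A" "a' \<in> A" for a a'
    by (rule poly_mapping_eqI, rule empty.prems(5)[OF that]) simp
  moreover have "b = b'" if "b \<in> B" "b' \<in> B" for b b'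
    by (rule poly_mapping_eqI, rule empty.prems(6)[OF that]) simp
  ultimately show ?case
    using empty by blast
next
  case (insert v V)
  \<comment> \<open>Keeping only the elements with the largest exponent of \<open>v\<close> makes
    each set constant there. A sum attains the sum of both maxima only through summands that attain
    them, so uniqueness among these elements extends to all of \<open>A\<close> and
    \<open>B\<close>.\<close>
  define top where "top C = {a \<in> C. \<forall>a'\<in>C. lookup a' v \<le> lookup a v}" for C :: "('v \<Rightarrow>\<^sub>0 nat) set"
  have top: "finite (top C)" "top C \<noteq> {}" if "finite C" "C \<noteq> {}" for C
  proof -
    let ?f = "\<lambda>a. lookup a v"
    have "Max (?f ` C) \<in> ?f ` C"
      using that by (intro Max_in) auto
    then obtain a where a: "Max (?f ` C) = ?f a" "a \<in> C"
      unfolding image_iff by blast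
    have "\<forall>a'\<in>C. ?f a' \<le> ?f a"
      unfolding a(1)[symmetric] using that(1) by auto
    then have "a \<in> top C"
      using a(2) unfolding top_def by blast
    then show "top C \<noteq> {}" by blast
    show "finite (top C)"
      unfolding top_def using that(1) by simp
  qed
  have agree: "lookup a u = lookup a' u"
    if C: "\<And>a a' v'. a \<in> C \<Longrightarrow> a' \<in> C \<Longrightarrow> v' \<notin> insert v V \<Longrightarrow> lookup a v' = lookup a' v'"
      and a: "a \<in> top C" "a' \<in> top C" "u \<notin> V" for C a a' u
  proof (cases "u = v")
    case True
    then show ?thesis using a unfolding top_def by (blast intro: antisym)
  next
    case False
    then show ?thesis by (intro C) (use a in \<open>auto simp: top_def\<close>)
  qed
  have "\<exists>a\<in>top A. \<exists>b\<in>top B. \<forall>a'\<in>top A. \<forall>b'\<in>top B. a' + b' = a + b \<longrightarrow> a' = a \<and> b' = b"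
  proof (rule insert.IH)
    show "lookup a u = lookup a' u" if "a \<in> top A" "a' \<in> top A" "u \<notin> V" for a a' u
      by (rule agree[OF insert.prems(5) that])
    show "lookup a u = lookup a' u" if "a \<in> top B" "a' \<in> top B" "u \<notin> V" for a a' u
      by (rule agree[OF insert.prems(6) that])
  qed (use top insert.prems(1-4) in simp_all)
  then obtain a b where ab: "a \<in> top A" "b \<in> top B"
    "\<And>a' b'. a' \<in> top A \<Longrightarrow> b' \<in> top B \<Longrightarrow> a' + b' = a + b \<Longrightarrow> a' = a \<and> b' = b"
    by blast
  have "a' = a \<and> b' = b" if "a' \<in> A" "b' \<in> B" "a' + b' = a + b" for a' b'
  proof -
    have "lookup a' v \<le> lookup a v" "lookup b' v \<le> lookup b v"
      using ab that by (auto simp: top_def)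
    moreover have "lookup a' v + lookup b' v = lookup a v + lookup b v"
      using that(3) by (metis lookup_add)
    ultimately have "lookup a' v = lookup a v" "lookup b' v = lookup b v" by auto
    then have "a' \<in> top A" "b' \<in> top B"
      using ab that by (auto simp: top_def)
    then show ?thesis using ab(3) that(3) by blast
  qed
  then show ?case
    using ab(1,2) unfolding top_def by blast
qed

abbreviation var_ideal :: "'v set \<Rightarrow> 'v set \<Rightarrow> (('v \<Rightarrow>\<^sub>0 nat) \<Rightarrow>\<^sub>0 'k::comm_ring_1) set" where
  "var_ideal V C \<equiv> mono_ideal V ((\<lambda>v. {v}) ` C)"

lemma var_ideal_iff: "p \<in> var_ideal V C \<longleftrightarrow> p \<in> polys V \<and> (\<forall>m\<in>keys p. keys m \<inter> C \<noteq> {})"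
  by (auto simp: mono_ideal_def)

lemma var_in_var_ideal_iff: "v \<in> V \<Longrightarrow> (var v :: ('v \<Rightarrow>\<^sub>0 nat) \<Rightarrow>\<^sub>0 'k::comm_ring_1) \<in> var_ideal V C \<longleftrightarrow> v \<in> C"
  using var_in_polys[of v V, where 'b = 'k] by (simp add: var_ideal_iff) (simp add: var_def)

text \<open>If both factors have monomials avoiding \<open>C\<close>, two of these have a sum that
  no other such pair attains. Any pair with that sum avoids \<open>C\<close> as well, so its
  coefficient in the product is a single nonzero product of field elements, and the product leaves
  the ideal.\<close>

lemma prime_var_ideal:
  fixes V :: "'v set"
  assumes "finite V"
  shows "primeideal (var_ideal V C) (ring_of (polys V :: (('v \<Rightarrow>\<^sub>0 nat) \<Rightarrow>\<^sub>0 'k::field) set))"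
proof (rule primeidealI[OF ideal_mono_ideal polys.cring_ring_of])
  let ?P = "var_ideal V C :: (('v \<Rightarrow>\<^sub>0 nat) \<Rightarrow>\<^sub>0 'k) set"
  have "(1 :: ('v \<Rightarrow>\<^sub>0 nat) \<Rightarrow>\<^sub>0 'k) \<notin> ?P"
    by (simp add: var_ideal_iff)
  then show "carrier (ring_of (polys V)) \<noteq> ?P"
    using polys.one_A[of V] by auto
  fix p q :: "('v \<Rightarrow>\<^sub>0 nat) \<Rightarrow>\<^sub>0 'k"
  assume "p \<in> carrier (ring_of (polys V))" "q \<in> carrier (ring_of (polys V))"
    and "p \<otimes>\<^bsub>ring_of (polys V)\<^esub> q \<in> ?P"
  then have p: "p \<in> polys V" and q: "q \<in> polys V" and pq: "p * q \<in> ?P"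
    by simp_all
  show "p \<in> ?P \<or> q \<in> ?P"
  proof (rule ccontr)
    assume neg: "\<not> (p \<in> ?P \<or> q \<in> ?P)"
    let ?A = "{m \<in> keys p. keys m \<inter> C = {}}" and ?B = "{m \<in> keys q. keys m \<inter> C = {}}"
    have ne: "?A \<noteq> {}" "?B \<noteq> {}"
      using neg p q by (auto simp: var_ideal_iff)
    have out: "lookup m v = 0" if "m \<in> keys p \<or> m \<in> keys q" "v \<notin> V" for m v
    proof -
      have "keys m \<subseteq> V" using p q that(1) by (auto simp: polys_def)
      then show ?thesis using that(2) by (metis in_keys_iff subsetD)
    qed
    have "\<exists>a\<in>?A. \<exists>b\<in>?B. \<forall>a'\<in>?A. \<forall>b'\<in>?B. a' + b' = a + b \<longrightarrow> a' = a \<and> b' = b"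
      by (rule unique_sum[OF assms _ _ ne]) (use out in auto)
    then obtain a b where ab: "a \<in> ?A" "b \<in> ?B"
      "\<And>a' b'. a' \<in> ?A \<Longrightarrow> b' \<in> ?B \<Longrightarrow> a' + b' = a + b \<Longrightarrow> a' = a \<and> b' = b"
      by blast
    have "lookup p l * (\<Sum>r. lookup q r when a + b = l + r) = (lookup p a * lookup q b when l = a)" for l
    proof (cases "l = a")
      case False
      have "lookup p l = 0 \<or> (lookup q r when a + b = l + r) = 0" for r
      proof (rule ccontr)
        assume "\<not> ?thesis"
        then have *: "l \<in> keys p" "r \<in> keys q" "l + r = a + b"
          by (auto simp: in_keys_iff)
        then have "keys l \<union> keys r = keys a \<union> keys b"
          by (metis keys_add_nat)
        then have "l \<in> ?A" "r \<in> ?B" using * ab(1,2) by auto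
        then show False using ab(3) * False by blast
      qed
      then have "lookup p l = 0 \<or> (\<forall>r. (lookup q r when a + b = l + r) = 0)"
        by blast
      then show ?thesis using False by auto
    qed simp
    then have "lookup (p * q) (a + b) = lookup p a * lookup q b"
      unfolding lookup_mult by simp
    then have "a + b \<in> keys (p * q)"
      using ab(1,2) by (simp add: in_keys_iff)
    then have "keys (a + b) \<inter> C \<noteq> {}"
      using pq unfolding var_ideal_iff by blast
    then show False
      using ab(1,2) by (auto simp: keys_add_nat Int_Un_distrib2)
  qed
qed

lemma primeideal_ring_ofD:
  assumes "primeideal P (ring_of A)"
  shows "ideal P (ring_of A)" "a \<in> A \<Longrightarrow> b \<in> A \<Longrightarrow> a * b \<in> P \<Longrightarrow> a \<in> P \<or> b \<in> P"
    and "1 \<notin> P"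
proof -
  interpret primeideal P "ring_of A" by fact
  show "ideal P (ring_of A)" by (rule is_ideal)
  show "a \<in> A \<Longrightarrow> b \<in> A \<Longrightarrow> a * b \<in> P \<Longrightarrow> a \<in> P \<or> b \<in> P"
    using I_prime[of a b] by simp
  show "1 \<notin> P"
    using I_notcarr one_imp_carrier by auto
qed

text \<open>The variables outside \<open>P\<close> form an independent set, since the product over
  an edge lies in the prime \<open>P\<close>. Extending this set to a maximal independent
  \<open>S\<close> leaves only variables of \<open>P\<close> in the complement.\<close>

lemma var_ideal_le_prime:
  fixes P :: "(('v \<Rightarrow>\<^sub>0 nat) \<Rightarrow>\<^sub>0 'k::field) set"
  assumes G: "simple_graph G" and P: "primeideal P (ring_of (polys (verts G)))"
    and sub: "mono_ideal (verts G) (edges G) \<subseteq> P"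
  obtains S where "max_independent G S" "var_ideal (verts G) (verts G - S) \<subseteq> P"
proof -
  let ?W = "{v \<in> verts G. var v \<notin> P}"
  note idl = primeideal_ring_ofD(1)[OF P]
  have "independent G ?W"
  proof (rule independentI[OF G])
    fix v w assume *: "v \<in> ?W" "w \<in> ?W"
    show "{v, w} \<notin> edges G"
    proof
      assume "{v, w} \<in> edges G"
      then have "var v * var w \<in> P"
        using edge_ideal_subset[OF G idl] sub by blast
      then show False
        using primeideal_ring_ofD(2)[OF P, of "var v" "var w"] * by auto
    qed
  qed auto
  then obtain S where S: "max_independent G S" "?W \<subseteq> S"
    by (rule max_independent_extend[OF G])
  have "var_ideal (verts G) (verts G - S) \<subseteq> P"
    by (rule mono_ideal_le[OF idl]) (use S(2) in \<open>auto simp flip: var_eq\<close>)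
  then show ?thesis using S(1) by (rule that[rotated])
qed

lemma edge_ideal_le_var_ideal:
  assumes G: "simple_graph G" and S: "independent G S"
  shows "mono_ideal (verts G) (edges G) \<subseteq>
    (var_ideal (verts G) (verts G - S) :: (('v \<Rightarrow>\<^sub>0 nat) \<Rightarrow>\<^sub>0 'k::comm_ring_1) set)"
proof
  fix p :: "('v \<Rightarrow>\<^sub>0 nat) \<Rightarrow>\<^sub>0 'k"
  assume p: "p \<in> mono_ideal (verts G) (edges G)"
  have "keys m \<inter> (verts G - S) \<noteq> {}" if m: "m \<in> keys p" for m
  proof -
    obtain e where "e \<in> edges G" "e \<subseteq> keys m"
      using p m by (auto simp: mono_ideal_def)
    moreover have "e \<subseteq> verts G" "\<not> e \<subseteq> S" if "e \<in> edges G"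
      using that G S by (auto simp: simple_graph_def independent_def)
    ultimately show ?thesis by blast
  qed
  moreover have "p \<in> polys (verts G)"
    using p by (simp add: mono_ideal_def)
  ultimately show "p \<in> var_ideal (verts G) (verts G - S)"
    unfolding var_ideal_iff by blast
qed

text \<open>Every prime over the ideal contains the variable ideal of some maximal independent set,
  so only these can be minimal. An inclusion between two of them reverses to one between maximal
  independent sets, hence is an equality.\<close>

lemma minimal_prime_iff:
  fixes P :: "(('v \<Rightarrow>\<^sub>0 nat) \<Rightarrow>\<^sub>0 'k::field) set"
  assumes G: "simple_graph G"
  shows "minimal_prime (ring_of (polys (verts G))) (mono_ideal (verts G) (edges G)) P \<longleftrightarrow>
    (\<exists>S. max_independent G S \<and> P = var_ideal (verts G) (verts G - S))"
proof
  let ?R = "ring_of (polys (verts G)) :: (('v \<Rightarrow>\<^sub>0 nat) \<Rightarrow>\<^sub>0 'k) ring" and ?I = "mono_ideal (verts G) (edges G)"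
  have fin: "finite (verts G)" using G by (simp add: simple_graph_def)
  have ind: "independent G S" if "max_independent G S" for S
    using that by (simp add: max_independent_def)
  {
    assume "minimal_prime ?R ?I P"
    then have P: "primeideal P ?R" "?I \<subseteq> P" and min: "\<And>Q. primeideal Q ?R \<Longrightarrow> ?I \<subseteq> Q \<Longrightarrow> Q \<subseteq> P \<Longrightarrow> Q = P"
      by (auto simp: minimal_prime_def)
    obtain S where S: "max_independent G S" "var_ideal (verts G) (verts G - S) \<subseteq> P"
      using var_ideal_le_prime[OF G P] .
    have "var_ideal (verts G) (verts G - S) = P"
      by (rule min[OF prime_var_ideal[OF fin] edge_ideal_le_var_ideal[OF G ind[OF S(1)]] S(2)])
    then show "\<exists>S. max_independent G S \<and> P = var_ideal (verts G) (verts G - S)"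
      using S(1) by blast
  next
    assume "\<exists>S. max_independent G S \<and> P = var_ideal (verts G) (verts G - S)"
    then obtain S where S: "max_independent G S" and P: "P = var_ideal (verts G) (verts G - S)"
      by blast
    have "Q = P" if Q: "primeideal Q ?R" "?I \<subseteq> Q" "Q \<subseteq> P" for Q
    proof -
      obtain T where T: "max_independent G T" "var_ideal (verts G) (verts G - T) \<subseteq> Q"
        using var_ideal_le_prime[OF G Q(1,2)] .
      have "v \<in> verts G - S" if v: "v \<in> verts G - T" for v
      proof -
        have "(var v :: ('v \<Rightarrow>\<^sub>0 nat) \<Rightarrow>\<^sub>0 'k) \<in> var_ideal (verts G) (verts G - T)"
          using v by (subst var_in_var_ideal_iff) auto
        then have "(var v :: ('v \<Rightarrow>\<^sub>0 nat) \<Rightarrow>\<^sub>0 'k) \<in> var_ideal (verts G) (verts G - S)"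
          using T(2) Q(3) P by blast
        then show ?thesis
          using v by (subst (asm) var_in_var_ideal_iff) auto
      qed
      then have "S \<subseteq> T"
        using ind[OF S] by (auto simp: independent_def)
      then have "T = S"
        using S ind[OF T(1)] by (auto simp: max_independent_def)
      then show "Q = P"
        using T(2) Q(3) P by blast
    qed
    then show "minimal_prime ?R ?I P"
      unfolding minimal_prime_def P
      using prime_var_ideal[OF fin] edge_ideal_le_var_ideal[OF G ind[OF S]] by blast
  }
qed

section \<open>Lengths of chains of prime ideals\<close>

lemma nontrivial_relation:
  fixes M :: "'i \<Rightarrow> 'x \<Rightarrow> 'k::field"
  assumes "finite T" "finite A" "card T < card A"
  shows "\<exists>c. (\<exists>a\<in>A. c a \<noteq> 0) \<and> (\<forall>x\<in>T. (\<Sum>a\<in>A. c a * M a x) = 0)"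
  using assms
proof (induction T arbitrary: A M rule: finite_induct)
  case empty
  then obtain a where "a \<in> A" by (metis card.empty ex_in_conv less_irrefl)
  then show ?case by (intro exI[of _ "\<lambda>_. 1"]) auto
next
  case (insert x T)
  show ?case
  proof (cases "\<forall>a\<in>A. M a x = 0")
    case True
    have "card T < card A" using insert by simp
    then obtain c where "\<exists>a\<in>A. c a \<noteq> 0" "\<forall>x\<in>T. (\<Sum>a\<in>A. c a * M a x) = 0"
      using insert.IH insert.prems by metis
    with True show ?thesis by (intro exI[of _ c]) auto
  next
    case False
    then obtain s where s: "s \<in> A" "M s x \<noteq> 0" by blast
    \<comment> \<open>\<open>?M\<close> is the matrix after the pivot row \<open>s\<close> has
      cleared column \<open>x\<close>. The coefficient given to \<open>s\<close> below converts a
      relation for \<open>?M\<close> back into one for \<open>M\<close>.\<close>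
    let ?A = "A - {s}" and ?M = "\<lambda>a y. M a y - M a x / M s x * M s y"
    have "card T < card ?A" using insert s by simp
    then obtain c where c: "\<exists>a\<in>?A. c a \<noteq> 0" "\<forall>y\<in>T. (\<Sum>a\<in>?A. c a * ?M a y) = 0"
      using insert.IH[of ?A ?M] insert.prems by auto
    let ?c = "c(s := - (\<Sum>a\<in>?A. c a * (M a x / M s x)))"
    have "(\<Sum>a\<in>A. ?c a * M a y) = (\<Sum>a\<in>?A. c a * ?M a y)" for y
    proof -
      have "(\<Sum>a\<in>A. ?c a * M a y) = ?c s * M s y + (\<Sum>a\<in>?A. ?c a * M a y)"
        by (rule sum.remove) (use insert s in auto)
      also have "(\<Sum>a\<in>?A. ?c a * M a y) = (\<Sum>a\<in>?A. c a * M a y)"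
        by (rule sum.cong) auto
      finally show ?thesis
        by (simp add: algebra_simps sum_subtractf sum_distrib_left sum_distrib_right)
    qed
    moreover have "(\<Sum>a\<in>?A. c a * ?M a x) = 0"
      using s by (intro sum.neutral) auto
    ultimately show ?thesis
      using c by (intro exI[of _ ?c]) auto
  qed
qed

text \<open>Exponents are bounded one by one instead of by total degree, so the admissible monomials
  form a box that is counted by a single power.\<close>

definition exps_le :: "nat \<Rightarrow> (('v \<Rightarrow>\<^sub>0 nat) \<Rightarrow>\<^sub>0 'k::zero) \<Rightarrow> bool" where
  "exps_le d p \<longleftrightarrow> (\<forall>m\<in>keys p. \<forall>v. lookup m v \<le> d)"

lemma exps_le_exists: "\<exists>d. exps_le d p"
proof -
  have "lookup m v \<le> (\<Sum>m\<in>keys p. \<Sum>v\<in>keys m. lookup m v)" if m: "m \<in> keys p" for m v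
  proof -
    have "lookup m v \<le> (\<Sum>v\<in>keys m. lookup m v)"
      by (cases "v \<in> keys m") (auto simp: in_keys_iff intro: member_le_sum)
    also have "\<dots> \<le> (\<Sum>m\<in>keys p. \<Sum>v\<in>keys m. lookup m v)"
      by (rule member_le_sum[OF m, of "\<lambda>m. \<Sum>v\<in>keys m. lookup m v"]) auto
    finally show ?thesis .
  qed
  then show ?thesis by (auto simp: exps_le_def)
qed

lemma exps_le_mono: "exps_le d p \<Longrightarrow> d \<le> d' \<Longrightarrow> exps_le d' p"
  by (auto simp: exps_le_def intro: order_trans)

lemma exps_le_one: "exps_le d 1"
  by (simp add: exps_le_def)

lemma exps_le_mult:
  assumes "exps_le d p" "exps_le d' q"
  shows "exps_le (d + d') (p * q)"
  unfolding exps_le_def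
proof (intro ballI allI)
  fix m v assume "m \<in> keys (p * q)"
  then obtain a b where "m = a + b" "a \<in> keys p" "b \<in> keys q"
    using keys_mult[of p q] by blast
  then show "lookup m v \<le> d + d'"
    using assms by (auto simp: exps_le_def lookup_add intro: add_mono)
qed

lemma exps_le_power: "exps_le d p \<Longrightarrow> exps_le (n * d) (p ^ n)"
  by (induction n) (auto simp: exps_le_one dest: exps_le_mult)

lemma card_exps_le:
  assumes "finite V"
  shows "finite {m. keys m \<subseteq> V \<and> (\<forall>v. lookup m v \<le> d)}" (is "finite ?B")
    and "card {m. keys m \<subseteq> V \<and> (\<forall>v. lookup m v \<le> d)} \<le> Suc d ^ card V"
proof -
  let ?f = "\<lambda>m :: 'a \<Rightarrow>\<^sub>0 nat. restrict (lookup m) V"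
  have inj: "inj_on ?f ?B"
  proof (rule inj_onI)
    fix m m' assume *: "m \<in> ?B" "m' \<in> ?B" "?f m = ?f m'"
    show "m = m'"
    proof (rule poly_mapping_eqI)
      fix v show "lookup m v = lookup m' v"
      proof (cases "v \<in> V")
        case True
        then show ?thesis using fun_cong[OF *(3), of v] by simp
      next
        case False
        then have "v \<notin> keys m" "v \<notin> keys m'" using *(1,2) by auto
        then show ?thesis by (simp add: in_keys_iff)
      qed
    qed
  qed
  have sub: "?f ` ?B \<subseteq> (\<Pi>\<^sub>E v\<in>V. {..d})"
    by auto
  have fin: "finite (\<Pi>\<^sub>E v\<in>V. {..d})"
    by (rule finite_PiE[OF assms]) auto
  show "finite ?B"
    by (rule finite_imageD[OF finite_subset[OF sub fin] inj])
  show "card ?B \<le> Suc d ^ card V"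
    using card_inj_on_le[OF inj sub fin] by (simp add: card_PiE[OF assms])
qed

fun power_prod :: "'p::comm_ring_1 list \<Rightarrow> nat list \<Rightarrow> 'p" where
  "power_prod (f # fs) (a # as) = f ^ a * power_prod fs as"
| "power_prod _ _ = 1"

lemma power_prod_polys: "set fs \<subseteq> polys V \<Longrightarrow> power_prod fs as \<in> polys V"
proof (induction fs as rule: power_prod.induct)
  case (1 f fs a as)
  have "f ^ a \<in> polys V"
    using 1 by (induction a) auto
  then show ?case using 1 by simp
qed auto

lemma exps_le_power_prod:
  assumes "\<And>f. f \<in> set fs \<Longrightarrow> exps_le d f" "set as \<subseteq> {..<N}"
  shows "exps_le (length fs * (N * d)) (power_prod fs as)"
  using assms
proof (induction fs as rule: power_prod.induct)
  case (1 f fs a as)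
  have "exps_le (N * d) (f ^ a)"
    using exps_le_mono[OF exps_le_power[of d f a]] 1 by (simp add: less_imp_le)
  from exps_le_mult[OF this 1(1)] 1(2-) show ?case by simp
qed (auto simp: exps_le_one)

abbreviation (input) const :: "'k \<Rightarrow> ('v \<Rightarrow>\<^sub>0 nat) \<Rightarrow>\<^sub>0 'k::comm_ring_1" where
  "const c \<equiv> Poly_Mapping.single 0 c"

lemma const_polys [simp]: "const c \<in> polys V"
  by (simp add: polys_def)

lemma lookup_const_mult: "lookup (const c * p) m = c * lookup p m"
  by (simp flip: mult_map_scale_conv_mult) (simp add: map.rep_eq when_def)

text \<open>Linear independence over the coefficients modulo \<open>Q\<close>. It is stated for a
  family, so equal values at different indices count separately and \<open>card A\<close> measures
  the dimension.\<close>

definition independent_mod ::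
  "'i set \<Rightarrow> ('i \<Rightarrow> ('v \<Rightarrow>\<^sub>0 nat) \<Rightarrow>\<^sub>0 'k::comm_ring_1) \<Rightarrow> (('v \<Rightarrow>\<^sub>0 nat) \<Rightarrow>\<^sub>0 'k) set \<Rightarrow> bool" where
  "independent_mod A b Q \<longleftrightarrow> (\<forall>c. (\<Sum>a\<in>A. const (c a) * b a) \<in> Q \<longrightarrow> (\<forall>a\<in>A. c a = 0))"

text \<open>More elements than monomials in the box satisfy a nontrivial linear relation, and its
  value 0 lies in \<open>Q\<close>.\<close>

lemma independent_mod_card:
  fixes b :: "'i \<Rightarrow> ('v \<Rightarrow>\<^sub>0 nat) \<Rightarrow>\<^sub>0 'k::field"
  assumes V: "finite V" and A: "finite A" and ind: "independent_mod A b Q" and Q: "0 \<in> Q"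
    and b: "\<And>a. a \<in> A \<Longrightarrow> b a \<in> polys V" "\<And>a. a \<in> A \<Longrightarrow> exps_le d (b a)"
  shows "card A \<le> Suc d ^ card V"
proof (rule ccontr)
  let ?B = "{m. keys m \<subseteq> V \<and> (\<forall>v. lookup m v \<le> d)}"
  assume "\<not> card A \<le> Suc d ^ card V"
  then have "card ?B < card A"
    using card_exps_le(2)[OF V, of d] by linarith
  then obtain c where c: "\<exists>a\<in>A. c a \<noteq> 0" "\<forall>m\<in>?B. (\<Sum>a\<in>A. c a * lookup (b a) m) = 0"
    using nontrivial_relation[OF card_exps_le(1)[OF V] A, of d "\<lambda>a. lookup (b a)"] by blast
  have "(\<Sum>a\<in>A. const (c a) * b a) = 0"
  proof (rule poly_mapping_eqI)
    fix m
    show "lookup (\<Sum>a\<in>A. const (c a) * b a) m = lookup 0 m"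
    proof (cases "m \<in> ?B")
      case True
      then show ?thesis using c(2) by (simp add: lookup_sum lookup_const_mult)
    next
      case False
      have "lookup (b a) m = 0" if a: "a \<in> A" for a
      proof (rule ccontr)
        assume "lookup (b a) m \<noteq> 0"
        then have "m \<in> keys (b a)" by (simp add: in_keys_iff)
        then have "m \<in> ?B"
          using b[OF a] unfolding polys_def exps_le_def by blast
        with False show False by blast
      qed
      then show ?thesis by (simp add: lookup_sum lookup_const_mult)
    qed
  qed
  then show False
    using ind Q c(1) unfolding independent_mod_def by metis
qed

text \<open>Modulo \<open>Q1\<close> every positive power of \<open>f\<close> vanishes, so the
  coefficients at \<open>f ^ 0\<close> are zero by independence there. The rest is \<open>f\<close>
  times a shorter sum of the same kind; as \<open>f\<close> lies outside the prime
  \<open>Q0\<close>, it can be cancelled and the argument repeated.\<close>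

lemma independent_mod_step:
  fixes b :: "'i \<Rightarrow> ('v \<Rightarrow>\<^sub>0 nat) \<Rightarrow>\<^sub>0 'k::comm_ring_1"
  assumes ind: "independent_mod A b Q1" and b: "\<And>a. a \<in> A \<Longrightarrow> b a \<in> polys V"
    and Q0: "primeideal Q0 (ring_of (polys V))" and Q1: "ideal Q1 (ring_of (polys V))"
    and "Q0 \<subseteq> Q1" "f \<in> Q1" "f \<notin> Q0"
    and "(\<Sum>j<N. f ^ j * (\<Sum>a\<in>A. const (c j a) * b a)) \<in> Q0" "j < N" "a \<in> A"
  shows "c j a = 0"
  using assms(8,9)
proof (induction N arbitrary: c j)
  case (Suc N)
  note Q0i = primeideal_ring_ofD(1)[OF Q0]
  let ?g = "\<lambda>j. \<Sum>a\<in>A. const (c j a) * b a"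
  let ?s = "\<Sum>j<N. f ^ j * ?g (Suc j)"
  have g: "?g j \<in> polys V" for j
    by (rule polys.sum_A) (use b in auto)
  have f: "f \<in> polys V" using ideal_ring_ofD(1)[OF Q1] assms(6) by blast
  have fp: "f ^ j \<in> polys V" for j
    using f by (induction j) auto
  have s: "?s \<in> polys V"
    by (rule polys.sum_A) (use fp g in auto)
  have eq: "(\<Sum>j<Suc N. f ^ j * ?g j) = ?g 0 + f * ?s"
    by (subst sum.lessThan_Suc_shift) (simp add: sum_distrib_left mult.assoc)
  have sf: "- ?s * f \<in> Q1"
    by (rule ideal_ring_ofD(4)[OF Q1 polys.uminus_A[OF s] assms(6)])
  have "?g 0 + f * ?s \<in> Q1"
    using Suc.prems(1) \<open>Q0 \<subseteq> Q1\<close> unfolding eq by blast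
  from ideal_ring_ofD(3)[OF Q1 this sf] have "?g 0 \<in> Q1"
    by (simp add: algebra_simps)
  then have c0: "\<forall>a\<in>A. c 0 a = 0"
    using ind by (simp add: independent_mod_def)
  then have "f * ?s \<in> Q0"
    using Suc.prems(1) unfolding eq by simp
  then have "?s \<in> Q0"
    using primeideal_ring_ofD(2)[OF Q0 f s] \<open>f \<notin> Q0\<close> by blast
  then have "c (Suc i) a = 0" if "i < N" for i
    using Suc.IH[of "\<lambda>j. c (Suc j)" i] that by blast
  then show ?case
    using c0 Suc.prems(2) \<open>a \<in> A\<close> by (cases j) auto
qed simp

text \<open>The induction descends the chain from its top, where the claim is that a proper ideal
  contains no nonzero constant. Each further element lies in one prime but not in the prime below,
  and contributes a factor with exponents less than \<open>N\<close>.\<close>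

lemma independent_mod_chain:
  fixes Q :: "nat \<Rightarrow> (('v \<Rightarrow>\<^sub>0 nat) \<Rightarrow>\<^sub>0 'k::field) set"
  assumes Q: "\<And>i. i \<le> n \<Longrightarrow> primeideal (Q i) (ring_of (polys V))" "\<And>i. i < n \<Longrightarrow> Q i \<subseteq> Q (Suc i)"
    and f: "\<And>i. i < n \<Longrightarrow> f i \<in> Q (Suc i)" "\<And>i. i < n \<Longrightarrow> f i \<notin> Q i" and "k \<le> n"
  shows "independent_mod {as. set as \<subseteq> {..<N} \<and> length as = k} (power_prod (map f [n - k..<n])) (Q (n - k))"
  using \<open>k \<le> n\<close>
proof (induction k)
  case 0
  have "c = 0" if "const c \<in> Q n" for c
  proof (rule ccontr)
    assume "c \<noteq> 0"
    then have "const (1 / c) * const c = (1 :: ('v \<Rightarrow>\<^sub>0 nat) \<Rightarrow>\<^sub>0 'k)"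
      by (simp add: mult_single)
    moreover have P: "primeideal (Q n) (ring_of (polys V))"
      by (rule Q(1)) simp
    ultimately show False
      using ideal_ring_ofD(4)[OF primeideal_ring_ofD(1)[OF P] const_polys that, of "1 / c"]
        primeideal_ring_ofD(3)[OF P] by simp
  qed
  moreover have "{as. set as \<subseteq> {..<N} \<and> length as = 0} = {[]}" by auto
  ultimately show ?case
    by (simp add: independent_mod_def)
next
  case (Suc k)
  obtain m where m: "n - Suc k = m" "n - k = Suc m" "m < n"
    using Suc.prems by (metis Suc_diff_Suc Suc_le_lessD diff_less_Suc less_Suc_eq_le le_less_trans diff_le_self not_less_eq)
  let ?A = "\<lambda>k. {as. set as \<subseteq> {..<N} \<and> length as = k}"
  let ?b = "power_prod (map f [Suc m..<n])"
  have ind: "independent_mod (?A k) ?b (Q (Suc m))"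
    using Suc m by simp
  have fs: "f i \<in> polys V" if "i < n" for i
    using ideal_ring_ofD(1)[OF primeideal_ring_ofD(1)[OF Q(1)[of "Suc i"]]] f(1)[OF that] that by auto
  have fin: "finite (?A k)" by (rule finite_lists_length_eq) simp
  have img: "?A (Suc k) = (\<lambda>(j, as). j # as) ` ({..<N} \<times> ?A k)"
    by (auto simp: image_iff length_Suc_conv)
  have inj: "inj_on (\<lambda>(j, as). j # as) ({..<N} \<times> ?A k)"
    by (auto simp: inj_on_def)
  have upt: "[m..<n] = m # [Suc m..<n]"
    using m(3) by (rule upt_conv_Cons)
  show ?case
    unfolding independent_mod_def m(1)
  proof (intro allI impI ballI)
    fix c as
    assume sum: "(\<Sum>as\<in>?A (Suc k). const (c as) * power_prod (map f [m..<n]) as) \<in> Q m"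
      and "as \<in> ?A (Suc k)"
    then obtain j bs where as: "as = j # bs" "j < N" "bs \<in> ?A k"
      unfolding img by auto
    have "(\<Sum>as\<in>?A (Suc k). const (c as) * power_prod (map f [m..<n]) as) =
        (\<Sum>(j, as)\<in>{..<N} \<times> ?A k. const (c (j # as)) * power_prod (map f [m..<n]) (j # as))"
      unfolding img by (subst sum.reindex[OF inj]) (auto intro: sum.cong)
    also have "\<dots> = (\<Sum>j<N. \<Sum>as\<in>?A k. const (c (j # as)) * power_prod (map f [m..<n]) (j # as))"
      by (simp add: sum.cartesian_product)
    also have "\<dots> = (\<Sum>j<N. f m ^ j * (\<Sum>as\<in>?A k. const (c (j # as)) * ?b as))"
      by (simp add: upt sum_distrib_left ac_simps)
    finally have *: "(\<Sum>j<N. f m ^ j * (\<Sum>as\<in>?A k. const (c (j # as)) * ?b as)) \<in> Q m"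
      using sum by simp
    have "c (j # bs) = 0"
    proof (rule independent_mod_step[OF ind _ _ _ _ _ _ *[unfolded] as(2,3)])
      show "?b as \<in> polys V" for as
        by (rule power_prod_polys) (use fs in auto)
      show "primeideal (Q m) (ring_of (polys V))" "Q m \<subseteq> Q (Suc m)" "f m \<in> Q (Suc m)" "f m \<notin> Q m"
        using Q f m(3) by simp_all
      show "ideal (Q (Suc m)) (ring_of (polys V))"
        by (rule primeideal_ring_ofD(1)[OF Q(1)]) (use m(3) in simp)
    qed
    then show "c as = 0" using as by simp
  qed
qed

text \<open>For each \<open>N\<close>, the N^n products of powers are independent modulo the lowest
  prime and have exponents at most n N d, with \<open>d\<close> bounding those of the chosen
  elements. If \<open>n\<close> exceeded \<open>card V\<close>, the number of products would outgrow
  the number of such monomials.\<close>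

lemma prime_chain_length:
  fixes Q :: "nat \<Rightarrow> (('v \<Rightarrow>\<^sub>0 nat) \<Rightarrow>\<^sub>0 'k::field) set"
  assumes V: "finite V" and Q: "\<And>i. i \<le> n \<Longrightarrow> primeideal (Q i) (ring_of (polys V))"
    "\<And>i. i < n \<Longrightarrow> Q i \<subset> Q (Suc i)"
  shows "n \<le> card V"
proof (rule ccontr)
  assume "\<not> n \<le> card V"
  then have n: "Suc (card V) \<le> n" by simp
  have "\<forall>i<n. \<exists>f. f \<in> Q (Suc i) \<and> f \<notin> Q i"
    using Q(2) by blast
  then obtain f where f: "\<And>i. i < n \<Longrightarrow> f i \<in> Q (Suc i)" "\<And>i. i < n \<Longrightarrow> f i \<notin> Q i"
    by metis
  obtain d0 where d0: "\<And>i. exps_le (d0 i) (f i)"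
    using choice[of "\<lambda>i d. exps_le d (f i)"] exps_le_exists by blast
  define d where "d = (\<Sum>i<n. d0 i)"
  have d: "exps_le d (f i)" if "i < n" for i
    unfolding d_def by (rule exps_le_mono[OF d0[of i]], rule member_le_sum) (use that in auto)
  have fs: "f i \<in> polys V" if "i < n" for i
    using ideal_ring_ofD(1)[OF primeideal_ring_ofD(1)[OF Q(1)[of "Suc i"]]] f(1)[OF that] that by auto
  have bound: "N ^ n \<le> Suc (n * (N * d)) ^ card V" for N
  proof -
    let ?A = "{as. set as \<subseteq> {..<N} \<and> length as = n}"
    have "independent_mod ?A (power_prod (map f [n - n..<n])) (Q (n - n))"
      by (rule independent_mod_chain[OF Q(1)]) (use Q(2) f in auto)
    then have ind: "independent_mod ?A (power_prod (map f [0..<n])) (Q 0)" by simp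
    have "card ?A \<le> Suc (n * (N * d)) ^ card V"
    proof (rule independent_mod_card[OF V _ ind])
      show "finite ?A" by (rule finite_lists_length_eq) simp
      show "0 \<in> Q 0" by (rule ideal_ring_ofD(2)[OF primeideal_ring_ofD(1)[OF Q(1)]]) simp
      show "power_prod (map f [0..<n]) as \<in> polys V" for as
        by (rule power_prod_polys) (use fs in auto)
      show "exps_le (n * (N * d)) (power_prod (map f [0..<n]) as)" if "as \<in> ?A" for as
      proof -
        have "exps_le (length (map f [0..<n]) * (N * d)) (power_prod (map f [0..<n]) as)"
          by (rule exps_le_power_prod) (use d that in auto)
        then show ?thesis by simp
      qed
    qed
    then show ?thesis by (simp add: card_lists_length_eq)
  qed
  \<comment> \<open>As 1 + n N d \<le> N (1 + n d), cancelling the power of \<open>N\<close> with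
    exponent \<open>card V\<close> leaves \<open>N\<close> at most (1 + n d)^(card V). The value is
    chosen one larger.\<close>
  define N where "N = Suc (Suc (n * d) ^ card V)"
  have "N ^ Suc (card V) \<le> N ^ n"
    by (rule power_increasing[OF n]) (simp add: N_def)
  also have "\<dots> \<le> Suc (n * (N * d)) ^ card V"
    by (rule bound)
  also have "\<dots> \<le> (N * Suc (n * d)) ^ card V"
    by (rule power_mono) (auto simp: N_def algebra_simps)
  finally have "N ^ card V * N \<le> N ^ card V * Suc (n * d) ^ card V"
    by (simp only: power_mult_distrib power_Suc mult.commute)
  moreover have "0 < N"
    by (simp add: N_def)
  ultimately have "N \<le> Suc (n * d) ^ card V"
    by (simp only: mult_le_cancel1) simp
  then show False by (simp add: N_def)
qed

section \<open>Heights of primes generated by variables\<close>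

lemma var_ideal_chain:
  fixes V :: "'v set"
  assumes "finite V" "C \<subseteq> D" "D \<subseteq> V"
  obtains Q :: "nat \<Rightarrow> (('v \<Rightarrow>\<^sub>0 nat) \<Rightarrow>\<^sub>0 'k::field) set"
  where "\<And>i. primeideal (Q i) (ring_of (polys V))" "\<And>i. i < card (D - C) \<Longrightarrow> Q i \<subset> Q (Suc i)"
    "Q 0 = var_ideal V C" "Q (card (D - C)) = var_ideal V D"
proof -
  have "finite (D - C)" using assms by (meson finite_Diff finite_subset)
  then obtain es where es: "set es = D - C" "distinct es" using finite_distinct_list by blast
  have len: "length es = card (D - C)" using es distinct_card by metis
  define Q where "Q i = (var_ideal V (C \<union> set (take i es)) :: (('v \<Rightarrow>\<^sub>0 nat) \<Rightarrow>\<^sub>0 'k) set)" for i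
  show ?thesis
  proof (rule that[of Q])
    show "primeideal (Q i) (ring_of (polys V))" for i
      unfolding Q_def by (rule prime_var_ideal[OF assms(1)])
    show "Q 0 = var_ideal V C" by (simp add: Q_def)
    show "Q (card (D - C)) = var_ideal V D"
      using es assms(2) by (simp add: Q_def flip: len) (simp add: Un_absorb1)
    fix i assume "i < card (D - C)"
    then have i: "i < length es" by (simp add: len)
    have take: "take (Suc i) es = take i es @ [es ! i]"
      by (rule take_Suc_conv_app_nth[OF i])
    have mem: "es ! i \<in> D - C" using es i nth_mem by metis
    have "es ! i \<notin> set (take i es)"
      using es(2) i by (auto simp: in_set_conv_nth nth_eq_iff_index_eq)
    then have "(var (es ! i) :: ('v \<Rightarrow>\<^sub>0 nat) \<Rightarrow>\<^sub>0 'k) \<notin> Q i" "(var (es ! i) :: ('v \<Rightarrow>\<^sub>0 nat) \<Rightarrow>\<^sub>0 'k) \<in> Q (Suc i)"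
      unfolding Q_def using mem assms(3) by (subst var_in_var_ideal_iff; auto simp: take)+
    moreover have "Q i \<subseteq> Q (Suc i)"
      unfolding Q_def mono_ideal_def by (auto simp: take)
    ultimately show "Q i \<subset> Q (Suc i)" by blast
  qed
qed

text \<open>A chain of length \<open>n\<close> ending at this prime can be continued by the
  \<open>card (V - C)\<close> remaining variables, so the bound on all chains gives
  \<open>n + card (V - C) \<le> card V\<close>. Adding the variables of \<open>C\<close> one by one
  to the zero ideal attains the height.\<close>

lemma prime_height_var_ideal:
  fixes V :: "'v set"
  assumes V: "finite V" and C: "C \<subseteq> V"
  shows "prime_height (ring_of (polys V)) (var_ideal V C :: (('v \<Rightarrow>\<^sub>0 nat) \<Rightarrow>\<^sub>0 'k::field) set) = enat (card C)"
proof (rule antisym)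
  let ?R = "ring_of (polys V) :: (('v \<Rightarrow>\<^sub>0 nat) \<Rightarrow>\<^sub>0 'k) ring"
  show "prime_height ?R (var_ideal V C) \<le> enat (card C)"
    unfolding prime_height_def
  proof (rule Sup_least, clarify)
    fix n and Q :: "nat \<Rightarrow> (('v \<Rightarrow>\<^sub>0 nat) \<Rightarrow>\<^sub>0 'k) set"
    assume Q: "\<forall>i\<le>n. primeideal (Q i) ?R" "\<forall>i<n. Q i \<subset> Q (Suc i)" "Q n = var_ideal V C"
    obtain Q' :: "nat \<Rightarrow> (('v \<Rightarrow>\<^sub>0 nat) \<Rightarrow>\<^sub>0 'k) set" where Q': "\<And>i. primeideal (Q' i) ?R"
      "\<And>i. i < card (V - C) \<Longrightarrow> Q' i \<subset> Q' (Suc i)" "Q' 0 = var_ideal V C"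
      by (rule var_ideal_chain[OF V C order_refl]) (rule that)
    \<comment> \<open>The two chains share the ideal at index \<open>n\<close>, so the step out of
      \<open>n\<close> is the first step of the upper chain.\<close>
    let ?Q = "\<lambda>i. if i \<le> n then Q i else Q' (i - n)"
    have "n + card (V - C) \<le> card V"
    proof (rule prime_chain_length[OF V, of _ ?Q])
      show "?Q i \<subset> ?Q (Suc i)" if "i < n + card (V - C)" for i
      proof (cases "i = n")
        case True
        then show ?thesis using Q'(2)[of 0] Q'(3) Q(3) that by simp
      next
        case False
        then consider "i < n" | "n < i" by linarith
        then show ?thesis
        proof cases
          case 1
          then show ?thesis using Q(2) by simp
        next
          case 2
          then show ?thesis
            using Q'(2)[of "i - n"] that by (simp add: Suc_diff_le)
        qed
      qed
    qed (use Q(1) Q'(1) in simp)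
    moreover have "card (V - C) = card V - card C" "card C \<le> card V"
      using V C by (auto intro: card_Diff_subset card_mono finite_subset)
    ultimately show "enat n \<le> enat (card C)" by simp
  qed
  obtain Q :: "nat \<Rightarrow> (('v \<Rightarrow>\<^sub>0 nat) \<Rightarrow>\<^sub>0 'k) set" where "\<And>i. primeideal (Q i) ?R"
    "\<And>i. i < card (C - {}) \<Longrightarrow> Q i \<subset> Q (Suc i)" "Q (card (C - {})) = var_ideal V C"
    by (rule var_ideal_chain[OF V empty_subsetI C]) (rule that)
  then show "enat (card C) \<le> prime_height ?R (var_ideal V C)"
    unfolding prime_height_def by (intro Sup_upper CollectI exI[of _ "card C"] exI[of _ Q] conjI) auto
qed

lemma bight_edge_ideal:
  fixes G :: "'v sgraph"
  assumes G: "simple_graph G"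
  shows "bight (ring_of (polys (verts G) :: (('v \<Rightarrow>\<^sub>0 nat) \<Rightarrow>\<^sub>0 'k::field) set))
    (mono_ideal (verts G) (edges G)) = enat (cover_number G)"
proof -
  have fin: "finite (verts G)" using G by (simp add: simple_graph_def)
  have ht: "prime_height (ring_of (polys (verts G)))
      (var_ideal (verts G) (verts G - S) :: (('v \<Rightarrow>\<^sub>0 nat) \<Rightarrow>\<^sub>0 'k) set) = enat (card (verts G - S))" for S
    by (rule prime_height_var_ideal[OF fin]) auto
  have eq: "bight (ring_of (polys (verts G) :: (('v \<Rightarrow>\<^sub>0 nat) \<Rightarrow>\<^sub>0 'k) set)) (mono_ideal (verts G) (edges G)) =
      Sup {enat (card (verts G - S)) | S. max_independent G S}"
    unfolding bight_def minimal_prime_iff[OF G]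
    by (intro arg_cong[of _ _ Sup] Collect_cong) (metis ht)
  obtain S where S: "max_independent G S" "cover_number G = card (verts G - S)"
    using cover_number_attained[OF G] .
  show ?thesis
    unfolding eq
  proof (rule antisym)
    show "Sup {enat (card (verts G - S)) | S. max_independent G S} \<le> enat (cover_number G)"
      by (rule Sup_least) (use cover_number_ge[OF G] in auto)
    show "enat (cover_number G) \<le> Sup {enat (card (verts G - S)) | S. max_independent G S}"
      by (rule Sup_upper) (use S in auto)
  qed
qed

lemma projdim_edge_ideal_ge:
  fixes G :: "'v sgraph"
  assumes G: "simple_graph G"
  shows "enat (cover_number G) \<le> projdim (ring_of (polys (verts G) :: (('v \<Rightarrow>\<^sub>0 nat) \<Rightarrow>\<^sub>0 'k::field) set))
    (quot_module (ring_of (polys (verts G))) (mono_ideal (verts G) (edges G)))"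
proof -
  let ?R = "ring_of (polys (verts G)) :: (('v \<Rightarrow>\<^sub>0 nat) \<Rightarrow>\<^sub>0 'k) ring"
  let ?I = "mono_ideal (verts G) (edges G) :: (('v \<Rightarrow>\<^sub>0 nat) \<Rightarrow>\<^sub>0 'k) set"
  have fin: "finite (verts G)" using G by (simp add: simple_graph_def)
  obtain S where S: "max_independent G S" "cover_number G = card (verts G - S)"
    using cover_number_attained[OF G] .
  have ind: "independent G S" and dom: "\<forall>v\<in>verts G - S. \<exists>w\<in>S. {v, w} \<in> edges G"
    using S(1) max_independent_iff[OF G] by blast+
  have S_sub: "S \<subseteq> verts G" "finite S"
    using ind fin by (auto simp: independent_def intro: finite_subset)
  obtain vs where vs: "set vs = verts G - S" "distinct vs"
    using finite_distinct_list[of "verts G - S"] fin by auto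
  let ?u = "Poly_Mapping.single (mon_of S) 1 :: ('v \<Rightarrow>\<^sub>0 nat) \<Rightarrow>\<^sub>0 'k"
  interpret R: cring ?R by (rule polys.cring_ring_of)
  interpret I: ideal ?I ?R by (rule ideal_mono_ideal)
  interpret h: ring_hom_ring ?R "?R Quot ?I" "(+>\<^bsub>?R\<^esub>) ?I" by (rule I.rcos_ring_hom_ring)
  let ?M = "quot_module ?R ?I"
  have u: "?u \<in> polys (verts G)" by (rule single_mon_of_polys[OF S_sub(2,1)])
  have u_notin: "?u \<notin> ?I"
    unfolding single_mon_of_mono_ideal_iff[OF S_sub(2,1)] using ind by (auto simp: independent_def)
  have "enat (length (map var vs :: (('v \<Rightarrow>\<^sub>0 nat) \<Rightarrow>\<^sub>0 'k) list)) \<le> projdim ?R ?M"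
  proof (rule projdim_ge[OF polys.cring_ring_of module_quot_module[OF polys.cring_ring_of ideal_mono_ideal]])
    show "set (map var vs) \<subseteq> carrier ?R"
      using vs by auto
    show "depth_ge ?R (map var vs) (ring_module ?R) j" if "j \<le> length (map var vs :: (('v \<Rightarrow>\<^sub>0 nat) \<Rightarrow>\<^sub>0 'k) list)" for j
      by (rule depth_ge_polys) (use vs that in auto)
    show "?I +>\<^bsub>?R\<^esub> ?u \<in> carrier ?M"
      using h.hom_closed[of ?u] u by (simp add: quot_module_def)
    show "?I +>\<^bsub>?R\<^esub> ?u \<noteq> \<zero>\<^bsub>?M\<^esub>"
      using I.rcos_const_imp_mem[of ?u] u u_notin by (auto simp: quot_module_def FactRing_def)
    fix r :: "('v \<Rightarrow>\<^sub>0 nat) \<Rightarrow>\<^sub>0 'k" assume "r \<in> set (map var vs)"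
    then obtain v where v: "r = var v" "v \<in> verts G" "v \<notin> S" using vs by auto
    then obtain w where w: "w \<in> S" "{v, w} \<in> edges G" using dom by blast
    \<comment> \<open>By maximality \<open>v\<close> has a neighbour \<open>w\<close> in
      \<open>S\<close>, and the monomial of that edge divides the product.\<close>
    have "r * ?u \<in> ?I"
      unfolding v(1) single_mon_of_insert[OF S_sub(2) v(3), symmetric]
      by (subst single_mon_of_mono_ideal_iff) (use v w S_sub in \<open>auto intro!: bexI[of _ "{v, w}"]\<close>)
    then have "?I +>\<^bsub>?R\<^esub> (r * ?u) = ?I"
      by (rule R.a_rcos_zero[OF ideal_mono_ideal])
    then show "r \<odot>\<^bsub>?M\<^esub> (?I +>\<^bsub>?R\<^esub> ?u) = \<zero>\<^bsub>?M\<^esub>"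
      using h.hom_mult[of r ?u] u v by (simp add: quot_module_def FactRing_def)
  qed
  then show ?thesis
    using S(2) vs by (metis distinct_card length_map)
qed

theorem theorem2p9:
  fixes G :: "'v sgraph"
    and R :: "(('v \<Rightarrow>\<^sub>0 nat) \<Rightarrow>\<^sub>0 'k::field) ring"
  assumes "simple_graph G"
    and "C5_free G"
    and "vertex_decomposable G"
    and "R = poly_ring (verts G)"
  shows "projdim R (quot_module R (edge_ideal G)) = bight R (edge_ideal G) \<and>
         bight R (edge_ideal G) = enat (d_prime G)"
proof -
  have "projdim R (quot_module R (edge_ideal G)) \<le> enat (cover_number G)"
    unfolding assms(4) poly_ring_eq edge_ideal_eq[OF assms(1)]
    by (rule polys.projdim_le[OF ideal_mono_ideal has_free_res_vertex_decomposable[OF assms(3,1) order_refl]])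
  moreover have "enat (cover_number G) \<le> projdim R (quot_module R (edge_ideal G))"
    unfolding assms(4) poly_ring_eq edge_ideal_eq[OF assms(1)]
    by (rule projdim_edge_ideal_ge[OF assms(1)])
  moreover have "bight R (edge_ideal G) = enat (cover_number G)"
    unfolding assms(4) poly_ring_eq edge_ideal_eq[OF assms(1)]
    by (rule bight_edge_ideal[OF assms(1)])
  ultimately show ?thesis
    by (simp add: d_prime_eq_cover_number[OF assms(1)])
qed

end
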